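(* Let $\mu(dx)=\mathbf 1_K(x)e^{-\varphi(x)}\,dx$ be a log-concave probability measure on $\mathbb R^n$, with support $K$, and assume that the potential $\varphi$ is globally Lipschitz on $K$ with Lipschitz constant $L$. Let $x_0\in K$, and put $r_0=d(x_0,\partial K)$ and $\sigma_0=\frac1n\left(\varphi(x_0)-\inf_{y\in K}\varphi(y)\right)$. Let the time step $\eta>0$ satisfy $\eta<nL^{-2}$. Let $(X_t)_{t\ge0}$ be the (reflected) Langevin diffusion associated to $\mu$ started at $X_0=x_0$, and let $(x_k)_{k\ge0}$ be the Langevin algorithm associated to $\mu$ with time step $\eta$ started at the same point $x_0$. Then for every integer $k\ge1$, $$\frac1n W_2^2(X_{k\eta},x_k)\le A\,k\,\eta^{3/2},$$ where $$A=(2e^{1/2}+1)\,\frac{(1+\sigma_0)(n+2\log k)^{1/2}}{r_0}+\frac76\,\frac{L}{n^{1/2}}.$$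
   Context: Setting: $K\subset\mathbb R^n$ is a closed convex set with non-empty interior (possibly $K=\mathbb R^n$), $\varphi:\mathbb R^n\to\mathbb R$ is a convex function with $\int_K e^{-\varphi}dx=1$. For $x\in\mathbb R^n$, $\nabla\varphi(x)$ denotes the element of minimal Euclidean norm of the subdifferential of $\varphi$ at $x$ ($\varphi$ is not assumed differentiable). $|\cdot|$ is the Euclidean norm and $\partial K$ the boundary of $K$. Langevin diffusion: given a standard $n$-dimensional Brownian motion $(B_t)$, $(X_t)$ is the unique strong solution of $dX_t=dB_t-\frac12\nabla\varphi(X_t)\,dt-d\Phi_t$ with reflection at $\partial K$. That is, $X$ and $\Phi$ are continuous semimartingales with $\Phi_0=0$ such that almost surely: $X_t\in K$ for all $t\ge 0$; $X_t=X_0+B_t-\frac12\int_0^t\nabla\varphi(X_s)ds-\Phi_t$ for all $t\ge0$; and $\Phi_t=\int_0^t\nu_s\,d\ell_s$, where $\ell$ is a measure on $[0,\infty)$, finite on bounded intervals and supported on $\{t: X_t\in\partial K\}$, and for each such $t$ the vector $\nu_t$ is an outer unit normal to $K$ at $X_t$. If $K=\mathbb R^n$ there is no reflection term. Langevin algorithm: $x_{k+1}=\mathcal P\left(x_k+\xi_{k+1}-\frac\eta2\nabla\varphi(x_k)\right)$, where $(\xi_k)_{k\ge1}$ are i.i.d. centered Gaussian vectors with covariance $\eta\,\mathrm{Id}$ and $\mathcal P(y)$ is the closest point to $y$ in $K$. Wasserstein distance: $W_2^2(\mu,\nu)=\inf\{\mathbb E[|X-Y|^2]: X\sim\mu,\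 Y\sim\nu\}$; for random vectors, $W_2(X,Y)$ denotes the distance between their laws. Conventions: $r_0=+\infty$ (so $1/r_0=0$) if $K=\mathbb R^n$; if $r_0=0$ then $A=+\infty$; $nL^{-2}=+\infty$ if $L=0$. *)

theory Defs
  imports "HOL-Probability.Probability"
begin

section \<open>Minimal-norm subgradients and normals\<close>

definition subdifferential :: "('a::euclidean_space \<Rightarrow> real) \<Rightarrow> 'a \<Rightarrow> 'a set" where
  "subdifferential \<phi> x = {g. \<forall>y. \<phi> x + g \<bullet> (y - x) \<le> \<phi> y}"

definition min_subgradient :: "('a::euclidean_space \<Rightarrow> real) \<Rightarrow> 'a \<Rightarrow> 'a" where
  "min_subgradient \<phi> x = arg_min norm (\<lambda>g. g \<in> subdifferential \<phi> x)"

definition outer_unit_normal :: "'a::euclidean_space set \<Rightarrow> 'a \<Rightarrow> 'a \<Rightarrow> bool" where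
  "outer_unit_normal K x v \<longleftrightarrow> norm v = 1 \<and> (\<forall>y\<in>K. v \<bullet> (y - x) \<le> 0)"

section \<open>Gaussian vectors and Brownian motion\<close>

text \<open>Density of the centered Gaussian vector with covariance \<open>v Id\<close>.\<close>

definition isotropic_gaussian_density :: "real \<Rightarrow> 'a::euclidean_space \<Rightarrow> real" where
  "isotropic_gaussian_density v z =
     (2 * pi * v) powr (- real DIM('a) / 2) * exp (- (norm z)\<^sup>2 / (2 * v))"

definition centered_gaussian :: "'w measure \<Rightarrow> real \<Rightarrow> ('w \<Rightarrow> 'a::euclidean_space) \<Rightarrow> bool" where
  "centered_gaussian M v Z \<longleftrightarrow>
     distributed M lborel Z (\<lambda>z. ennreal (isotropic_gaussian_density v z))"

text \<open>Processes are indexed by the reals; only times \<open>t \<ge> 0\<close> are meaningful.\<close>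

locale standard_brownian_motion = prob_space M
  for M :: "'w measure" +
  fixes B :: "real \<Rightarrow> 'w \<Rightarrow> 'a::euclidean_space"
  assumes measurable_B: "\<And>t. 0 \<le> t \<Longrightarrow> B t \<in> borel_measurable M"
    and start_zero: "AE \<omega> in M. B 0 \<omega> = 0"
    and continuous_paths: "AE \<omega> in M. continuous_on {0..} (\<lambda>t. B t \<omega>)"
    and gaussian_increments:
      "\<And>s t. 0 \<le> s \<Longrightarrow> s < t \<Longrightarrow> centered_gaussian M (t - s) (\<lambda>\<omega>. B t \<omega> - B s \<omega>)"
    and independent_increments:
      "\<And>(t :: nat \<Rightarrow> real) m. 0 \<le> t 0 \<Longrightarrow> mono t \<Longrightarrow>
         indep_vars (\<lambda>_. borel) (\<lambda>i \<omega>. B (t (Suc i)) \<omega> - B (t i) \<omega>) {..<m}"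

section \<open>Continuous semimartingales\<close>

text \<open>The filtration generated by \<open>B\<close>, augmented by the null sets of \<open>M\<close>.\<close>

definition augmented_filtration ::
    "'w measure \<Rightarrow> (real \<Rightarrow> 'w \<Rightarrow> 'a::euclidean_space) \<Rightarrow> real \<Rightarrow> 'w measure" where
  "augmented_filtration M B t =
     sigma (space M)
       ({B s -` S \<inter> space M | s S. 0 \<le> s \<and> s \<le> t \<and> S \<in> sets borel} \<union> null_sets M)"

definition adapted :: "(real \<Rightarrow> 'w measure) \<Rightarrow> (real \<Rightarrow> 'w \<Rightarrow> real) \<Rightarrow> bool" where
  "adapted F X \<longleftrightarrow> (\<forall>t\<ge>0. X t \<in> borel_measurable (F t))"

definition martingale ::
    "'w measure \<Rightarrow> (real \<Rightarrow> 'w measure) \<Rightarrow> (real \<Rightarrow> 'w \<Rightarrow> real) \<Rightarrow> bool" where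
  "martingale M F X \<longleftrightarrow>
     adapted F X \<and> (\<forall>t\<ge>0. integrable M (X t)) \<and>
     (\<forall>s t. 0 \<le> s \<and> s \<le> t \<longrightarrow> (AE \<omega> in M. real_cond_exp M (F s) (X t) \<omega> = X s \<omega>))"

text \<open>Real-valued (hence finite) localizing times are no restriction: any localizing
  sequence \<open>\<tau> m\<close> may be replaced by \<open>min (\<tau> m) m\<close>.\<close>

definition continuous_local_martingale ::
    "'w measure \<Rightarrow> (real \<Rightarrow> 'w measure) \<Rightarrow> (real \<Rightarrow> 'w \<Rightarrow> real) \<Rightarrow> bool" where
  "continuous_local_martingale M F X \<longleftrightarrow>
     adapted F X \<and> (\<forall>\<omega>\<in>space M. continuous_on {0..} (\<lambda>t. X t \<omega>)) \<and>
     (\<exists>\<tau> :: nat \<Rightarrow> 'w \<Rightarrow> real.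
        (\<forall>m. stopping_time F (\<tau> m) \<and> (\<forall>\<omega>\<in>space M. 0 \<le> \<tau> m \<omega>)) \<and>
        (AE \<omega> in M. incseq (\<lambda>m. \<tau> m \<omega>) \<and> filterlim (\<lambda>m. \<tau> m \<omega>) at_top sequentially) \<and>
        (\<forall>m. martingale M F (\<lambda>t \<omega>. X (min t (\<tau> m \<omega>)) \<omega> - X 0 \<omega>)))"

definition locally_finite_variation :: "(real \<Rightarrow> real) \<Rightarrow> bool" where
  "locally_finite_variation a \<longleftrightarrow>
     (\<forall>T\<ge>0. \<exists>C. \<forall>(t :: nat \<Rightarrow> real) m. mono t \<and> 0 \<le> t 0 \<and> t m \<le> T \<longrightarrow>
        (\<Sum>i<m. \<bar>a (t (Suc i)) - a (t i)\<bar>) \<le> C)"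

definition continuous_fv_process ::
    "'w measure \<Rightarrow> (real \<Rightarrow> 'w measure) \<Rightarrow> (real \<Rightarrow> 'w \<Rightarrow> real) \<Rightarrow> bool" where
  "continuous_fv_process M F A \<longleftrightarrow>
     adapted F A \<and>
     (\<forall>\<omega>\<in>space M. continuous_on {0..} (\<lambda>t. A t \<omega>) \<and> locally_finite_variation (\<lambda>t. A t \<omega>))"

text \<open>The decomposition is required up to indistinguishability, so \<open>X\<close> itself has
  continuous paths almost surely.\<close>

definition continuous_semimartingale ::
    "'w measure \<Rightarrow> (real \<Rightarrow> 'w measure) \<Rightarrow> (real \<Rightarrow> 'w \<Rightarrow> 'a::euclidean_space) \<Rightarrow> bool" where
  "continuous_semimartingale M F X \<longleftrightarrow>
     (\<forall>b\<in>Basis. adapted F (\<lambda>t \<omega>. X t \<omega> \<bullet> b) \<and>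
        (\<exists>N A. continuous_local_martingale M F N \<and> continuous_fv_process M F A \<and>
           (AE \<omega> in M. \<forall>t\<ge>0. X t \<omega> \<bullet> b = N t \<omega> + A t \<omega>)))"

section \<open>The reflected Langevin diffusion\<close>

text \<open>Pathwise: \<open>p\<close> is the path of the boundary term \<open>\<Phi>\<close> attached to the path \<open>x\<close> of \<open>X\<close>.
  If \<open>K = UNIV\<close> then \<open>frontier K = {}\<close>, which forces \<open>l = 0\<close> and \<open>p = 0\<close>.\<close>

definition reflection_term ::
    "'a::euclidean_space set \<Rightarrow> (real \<Rightarrow> 'a) \<Rightarrow> (real \<Rightarrow> 'a) \<Rightarrow> bool" where
  "reflection_term K x p \<longleftrightarrow>
     (\<exists>(l :: real measure) (\<nu> :: real \<Rightarrow> 'a).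
        sets l = sets borel \<and>
        (\<forall>T. emeasure l {0..T} < \<infinity>) \<and>
        (AE t in l. 0 \<le> t \<and> x t \<in> frontier K) \<and>
        \<nu> \<in> borel_measurable borel \<and>
        (\<forall>t\<ge>0. x t \<in> frontier K \<longrightarrow> outer_unit_normal K (x t) (\<nu> t)) \<and>
        (\<forall>t\<ge>0. p t = (LINT s:{0..t}|l. \<nu> s)))"

text \<open>Strong solution started at \<open>x0\<close>: the processes are semimartingales for the augmented
  filtration of the driving Brownian motion.\<close>

definition langevin_diffusion ::
    "'w measure \<Rightarrow> (real \<Rightarrow> 'w \<Rightarrow> 'a::euclidean_space) \<Rightarrow> 'a set \<Rightarrow> ('a \<Rightarrow> real) \<Rightarrow> 'a \<Rightarrow>
     (real \<Rightarrow> 'w \<Rightarrow> 'a) \<Rightarrow> (real \<Rightarrow> 'w \<Rightarrow> 'a) \<Rightarrow> bool" where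
  "langevin_diffusion M B K \<phi> x0 X \<Phi> \<longleftrightarrow>
     standard_brownian_motion M B \<and>
     continuous_semimartingale M (augmented_filtration M B) X \<and>
     continuous_semimartingale M (augmented_filtration M B) \<Phi> \<and>
     (AE \<omega> in M. X 0 \<omega> = x0 \<and> \<Phi> 0 \<omega> = 0) \<and>
     (AE \<omega> in M.
        (\<forall>t\<ge>0. X t \<omega> \<in> K) \<and>
        (\<forall>t\<ge>0. X t \<omega> = X 0 \<omega> + B t \<omega>
           - (1/2) *\<^sub>R (LINT s:{0..t}|lborel. min_subgradient \<phi> (X s \<omega>)) - \<Phi> t \<omega>) \<and>
        reflection_term K (\<lambda>t. X t \<omega>) (\<lambda>t. \<Phi> t \<omega>))"

section \<open>The Langevin algorithm\<close>

primrec langevin_algorithm ::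
    "'a::euclidean_space set \<Rightarrow> ('a \<Rightarrow> real) \<Rightarrow> real \<Rightarrow> 'a \<Rightarrow> (nat \<Rightarrow> 'w \<Rightarrow> 'a) \<Rightarrow> nat \<Rightarrow> 'w \<Rightarrow> 'a"
where
  "langevin_algorithm K \<phi> \<eta> x0 \<xi> 0 \<omega> = x0"
| "langevin_algorithm K \<phi> \<eta> x0 \<xi> (Suc k) \<omega> =
     closest_point K
       (langevin_algorithm K \<phi> \<eta> x0 \<xi> k \<omega> + \<xi> (Suc k) \<omega>
         - (\<eta> / 2) *\<^sub>R min_subgradient \<phi> (langevin_algorithm K \<phi> \<eta> x0 \<xi> k \<omega>))"

section \<open>Wasserstein distance\<close>

text \<open>A coupling is the joint law of a pair of random vectors with the given laws.\<close>

definition couplings ::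
    "'a::euclidean_space measure \<Rightarrow> 'a measure \<Rightarrow> ('a \<times> 'a) measure set" where
  "couplings \<mu> \<nu> =
     {\<pi>. prob_space \<pi> \<and> sets \<pi> = sets (borel \<Otimes>\<^sub>M borel) \<and>
         distr \<pi> borel fst = \<mu> \<and> distr \<pi> borel snd = \<nu>}"

text \<open>The square \<open>W\<^sub>2\<^sup>2\<close> of the distance.\<close>

definition wasserstein2_sq ::
    "'a::euclidean_space measure \<Rightarrow> 'a measure \<Rightarrow> ennreal" where
  "wasserstein2_sq \<mu> \<nu> =
     (INF \<pi>\<in>couplings \<mu> \<nu>. \<integral>\<^sup>+ z. ennreal ((norm (fst z - snd z))\<^sup>2) \<partial>\<pi>)"

end

theory Submission
  imports Defs
begin

text \<open>
  The diffusion and the algorithm are coupled synchronously: the algorithm is driven by the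
  increments of the Brownian motion \<open>B\<close> of the diffusion. Consider one step of the algorithm,
  starting at time \<open>s\<close> in the state \<open>y\<close>, and let \<open>e u\<close> be the difference between
  \<open>X u\<close> and \<open>y + (B u - B s) - (u - s) / 2 * g\<close>, where \<open>g\<close> is the gradient
  at \<open>y\<close>. The noise cancels, so \<open>e\<close> has finite variation and \<open>|e|\<^sup>2\<close> obeys
  the ordinary chain rule. The derivative pairs the difference of the drifts
  and \<open>- d\<Phi>\<close> with \<open>e u\<close>, and the part \<open>X u - y\<close> of \<open>e u\<close> is favourable, by monotonicity of subgradients and by
  convexity of \<open>K\<close>. What remains is the pairing of \<open>B u - B s\<close> with the drift and with the
  boundary term \<open>\<Phi>\<close>, and terms of order \<open>u - s\<close>. At the end of the step the
  projection onto \<open>K\<close> only decreases the distance (\<open>coupling_block\<close>).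

  The pairing with the drift costs \<open>L E|B u - B s|\<close>, because \<open>B u - B s\<close> is centred given
  the past and its pairing with \<open>g\<close> has mean zero; together with the term
  \<open>L\<^sup>2 \<eta>\<^sup>2 / 2\<close> this gives \<open>7/6 = 2/3 + 1/2\<close>. The pairing with \<open>d\<Phi>\<close> is
  integrated by parts: it is the full increment of \<open>B\<close> paired with the increment of \<open>\<Phi>\<close>, up to a
  martingale. Hence its expectation is at most that of the largest noise norm times the
  local time at the boundary up to the final time \<open>T\<close>. Both factors are bounded in \<open>L\<^sup>2\<close>
  (\<open>noise_envelope\<close> and \<open>local_time_bound\<close>), and the Cauchy-Schwarz inequality concludes in
  \<open>coupling_bound\<close>.

  The bound on the local time is an energy estimate. A ball of radius \<open>r\<close> around \<open>x0\<close> lies in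
  \<open>K\<close>, so the outer normal at a boundary point \<open>x\<close> satisfies \<open>(x - x0) \<bullet> \<nu> \<ge> r\<close>, and by
  convexity \<open>(x - x0) \<bullet> g \<ge> \<phi> x - \<phi> x0 \<ge> - n \<sigma>0\<close>. Thus
  \<open>|X t - x0|\<^sup>2\<close> plus \<open>2 r\<close> times the local time is at most \<open>n (1 + \<sigma>0) t\<close> plus a martingale, which
  bounds first \<open>E|X t - x0|\<^sup>2\<close> (\<open>second_moment\<close>) and then the second moment of the local time.

  Stochastic integrals are replaced by finite sums. Every estimate is a telescoping sum over a uniform grid, in which the
  martingales are finite sums \<open>mart_sum\<close>. For each path the inequalities hold up to an error that
  vanishes with the mesh, by uniform continuity of the path. The errors are not known to be integrable,
  so expectations pass to the limit by \<open>nn_integral_le_of_L2_bounded\<close>, a variant of Fatou's lemma for which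
  it is enough that the grid sums are bounded in \<open>L\<^sup>2\<close>. Before any moment of \<open>X\<close> is known, that
  bound is obtained by replacing \<open>|z|\<^sup>2\<close> by a bounded concave function of it instead of stopping the process.
\<close>

section \<open>Minimal-norm subgradients of convex functions\<close>

lemma subdifferential_iff: "g \<in> subdifferential \<phi> x \<longleftrightarrow> (\<forall>y. \<phi> x + g \<bullet> (y - x) \<le> \<phi> y)"
  by (simp add: subdifferential_def)

lemma continuous_on_convex_UNIV:
  fixes \<phi> :: "'a::euclidean_space \<Rightarrow> real"
  assumes "convex_on UNIV \<phi>" shows "continuous_on A \<phi>"
  using convex_on_continuous[OF open_UNIV assms] continuous_on_subset by blast

text \<open>A hyperplane that separates the point of the graph from the strict epigraph is not vertical,
  because \<open>\<phi>\<close> is finite everywhere. Its slope is a subgradient.\<close>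

lemma subdifferential_nonempty:
  fixes \<phi> :: "'a::euclidean_space \<Rightarrow> real"
  assumes \<phi>: "convex_on UNIV \<phi>"
  shows "subdifferential \<phi> x \<noteq> {}"
proof -
  define S where "S = {(y, t). \<phi> y < t}"
  have cS: "convex S"
    unfolding convex_alt
  proof (intro ballI allI impI, clarsimp simp: S_def)
    fix y1 t1 y2 t2 and u :: real
    assume a: "\<phi> y1 < t1" "\<phi> y2 < t2" "0 \<le> u" "u \<le> 1"
    have "\<phi> ((1 - u) *\<^sub>R y1 + u *\<^sub>R y2) \<le> (1 - u) * \<phi> y1 + u * \<phi> y2"
      using convex_onD[OF \<phi>, of u y1 y2] a by simp
    also have "\<dots> < (1 - u) * t1 + u * t2"
    proof (cases "u = 0")
      case False
      then have "u * \<phi> y2 < u * t2" using a by simp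
      moreover have "(1 - u) * \<phi> y1 \<le> (1 - u) * t1" using a by (intro mult_left_mono) auto
      ultimately show ?thesis by linarith
    qed (use a in simp)
    finally show "\<phi> ((1 - u) *\<^sub>R y1 + u *\<^sub>R y2) < (1 - u) * t1 + u * t2" .
  qed
  have disj: "{(x, \<phi> x)} \<inter> S = {}" "S \<noteq> {}" by (auto simp: S_def intro: lt_ex gt_ex)
  obtain a b where ab: "a \<noteq> 0" "\<forall>z\<in>{(x, \<phi> x)}. a \<bullet> z \<le> b" "\<forall>z\<in>S. a \<bullet> z \<ge> b"
    using separating_hyperplane_sets[OF convex_singleton[of "(x, \<phi> x)"] cS] disj by blast
  obtain c \<alpha> where a: "a = (c, \<alpha>)" by (cases a)
  have le: "c \<bullet> x + \<alpha> * \<phi> x \<le> c \<bullet> y + \<alpha> * t" if "\<phi> y < t" for y t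
    using ab(2) ab(3) that by (force simp: a S_def)
  have "\<alpha> \<ge> 0" using le[of x "\<phi> x + 1"] by (simp add: algebra_simps)
  moreover have "\<alpha> \<noteq> 0"
  proof
    assume "\<alpha> = 0"
    then have "c \<bullet> x \<le> c \<bullet> (x - c)" using le[of "x - c" "\<phi> (x - c) + 1"] by simp
    then have "c \<bullet> c \<le> 0" by (simp add: inner_diff_right)
    then have "c = 0" by (metis inner_ge_zero inner_eq_zero_iff order_antisym)
    then show False using \<open>\<alpha> = 0\<close> ab(1) a by (simp add: zero_prod_def)
  qed
  ultimately have pos: "\<alpha> > 0" by simp
  have "\<phi> x + ((- 1 / \<alpha>) *\<^sub>R c) \<bullet> (y - x) \<le> \<phi> y" for y
  proof (rule field_le_epsilon)
    fix e :: real assume "0 < e"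
    then have "c \<bullet> x + \<alpha> * \<phi> x \<le> c \<bullet> y + \<alpha> * (\<phi> y + e)" by (intro le) simp
    then have "\<alpha> * (\<phi> x + ((- 1 / \<alpha>) *\<^sub>R c) \<bullet> (y - x)) \<le> \<alpha> * (\<phi> y + e)"
      using pos by (simp add: algebra_simps inner_diff_right)
    then show "\<phi> x + ((- 1 / \<alpha>) *\<^sub>R c) \<bullet> (y - x) \<le> \<phi> y + e" using pos by simp
  qed
  then have "(- 1 / \<alpha>) *\<^sub>R c \<in> subdifferential \<phi> x" unfolding subdifferential_iff by blast
  then show ?thesis by blast
qed

lemma closed_subdifferential:
  fixes \<phi> :: "'a::euclidean_space \<Rightarrow> real"
  shows "closed (subdifferential \<phi> x)"
proof -
  have "subdifferential \<phi> x = (\<Inter>y. {g. \<phi> x + g \<bullet> (y - x) \<le> \<phi> y})"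
    by (auto simp: subdifferential_def)
  also have "closed \<dots>"
    by (intro closed_INT ballI closed_Collect_le continuous_intros)
  finally show ?thesis .
qed

lemma convex_subdifferential:
  fixes \<phi> :: "'a::euclidean_space \<Rightarrow> real"
  shows "convex (subdifferential \<phi> x)"
  unfolding convex_alt
proof (intro ballI allI impI)
  fix g h and u :: real
  assume gh: "g \<in> subdifferential \<phi> x" "h \<in> subdifferential \<phi> x" and u: "0 \<le> u \<and> u \<le> 1"
  have "\<phi> x + ((1 - u) *\<^sub>R g + u *\<^sub>R h) \<bullet> (y - x) \<le> \<phi> y" for y
  proof -
    have "(1 - u) * (\<phi> x + g \<bullet> (y - x)) + u * (\<phi> x + h \<bullet> (y - x)) \<le> (1 - u) * \<phi> y + u * \<phi> y"
      using gh u by (intro add_mono mult_left_mono) (auto simp: subdifferential_def)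
    then show ?thesis by (simp add: algebra_simps inner_add_left)
  qed
  then show "(1 - u) *\<^sub>R g + u *\<^sub>R h \<in> subdifferential \<phi> x" by (simp add: subdifferential_def)
qed

lemma min_subgradient_props:
  fixes \<phi> :: "'a::euclidean_space \<Rightarrow> real"
  assumes \<phi>: "convex_on UNIV \<phi>"
  shows min_subgradient_in: "min_subgradient \<phi> x \<in> subdifferential \<phi> x"
    and min_subgradient_le: "g \<in> subdifferential \<phi> x \<Longrightarrow> norm (min_subgradient \<phi> x) \<le> norm g"
proof -
  obtain g0 where g0: "g0 \<in> subdifferential \<phi> x" "\<And>g. g \<in> subdifferential \<phi> x \<Longrightarrow> norm g0 \<le> norm g"
    using distance_attains_inf[OF closed_subdifferential subdifferential_nonempty[OF \<phi>, of x], of 0]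
    by (auto simp: dist_norm)
  have "is_arg_min norm (\<lambda>g. g \<in> subdifferential \<phi> x) (min_subgradient \<phi> x)"
    unfolding min_subgradient_def arg_min_def
    by (rule someI[of _ g0]) (use g0 in \<open>auto simp: is_arg_min_def not_less\<close>)
  then show "min_subgradient \<phi> x \<in> subdifferential \<phi> x"
    "g \<in> subdifferential \<phi> x \<Longrightarrow> norm (min_subgradient \<phi> x) \<le> norm g"
    by (auto simp: is_arg_min_def not_less)
qed

lemma min_subgradient_ineq:
  fixes \<phi> :: "'a::euclidean_space \<Rightarrow> real"
  assumes "convex_on UNIV \<phi>"
  shows "\<phi> x + min_subgradient \<phi> x \<bullet> (y - x) \<le> \<phi> y"
  using min_subgradient_in[OF assms, of x] by (simp add: subdifferential_def)

lemma min_subgradient_monotone: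
  fixes \<phi> :: "'a::euclidean_space \<Rightarrow> real"
  assumes "convex_on UNIV \<phi>"
  shows "(x - y) \<bullet> min_subgradient \<phi> y \<le> (x - y) \<bullet> min_subgradient \<phi> x"
  using min_subgradient_ineq[OF assms, of x y] min_subgradient_ineq[OF assms, of y x]
  by (simp add: inner_diff_left inner_diff_right inner_commute)

text \<open>By the parallelogram identity, the midpoint of two distinct elements of least norm would be
  shorter than both.\<close>

lemma min_subgradient_unique:
  fixes \<phi> :: "'a::euclidean_space \<Rightarrow> real"
  assumes \<phi>: "convex_on UNIV \<phi>" and g: "g \<in> subdifferential \<phi> x"
    and le: "norm g \<le> norm (min_subgradient \<phi> x)"
  shows "g = min_subgradient \<phi> x"
proof -
  let ?m = "min_subgradient \<phi> x"
  have "(1/2) *\<^sub>R g + (1/2) *\<^sub>R ?m \<in> subdifferential \<phi> x"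
    using convexD[OF convex_subdifferential g min_subgradient_in[OF \<phi>], of "1/2" "1/2"] by simp
  then have "norm ?m \<le> norm ((1/2) *\<^sub>R g + (1/2) *\<^sub>R ?m)" by (rule min_subgradient_le[OF \<phi>])
  then have "norm ?m * 2 \<le> norm (g + ?m)" by (simp flip: scaleR_add_right)
  then have "(norm ?m * 2)\<^sup>2 \<le> (norm (g + ?m))\<^sup>2" by (intro power_mono) auto
  then have "(norm ?m)\<^sup>2 * 4 \<le> (norm (g + ?m))\<^sup>2" by (simp add: power_mult_distrib)
  moreover have "(norm g)\<^sup>2 \<le> (norm ?m)\<^sup>2" using le by (intro power_mono) auto
  moreover have "(norm (g + ?m))\<^sup>2 + (norm (g - ?m))\<^sup>2 = 2 * (norm g)\<^sup>2 + 2 * (norm ?m)\<^sup>2"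
    by (simp add: power2_norm_eq_inner algebra_simps inner_commute)
  ultimately have "(norm (g - ?m))\<^sup>2 \<le> 0" by linarith
  then show ?thesis by simp
qed

text \<open>The graph of the subdifferential is closed. This gives the norm bound at boundary points of
  \<open>K\<close>, by approximation from the interior, as well as the measurability of the
  minimal-norm subgradient.\<close>

lemma closed_subdifferential_meets_compact:
  fixes \<phi> :: "'a::euclidean_space \<Rightarrow> real"
  assumes \<phi>: "convex_on UNIV \<phi>" and C: "compact C"
  shows "closed {x. subdifferential \<phi> x \<inter> C \<noteq> {}}"
  unfolding closed_sequential_limits
proof (intro allI impI, elim conjE)
  fix x l assume x: "\<forall>n. x n \<in> {x. subdifferential \<phi> x \<inter> C \<noteq> {}}" and xl: "x \<longlonglongrightarrow> l"
  then obtain g where g: "\<And>n. g n \<in> subdifferential \<phi> (x n)" "\<And>n. g n \<in> C"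
    by (auto simp: Int_def set_eq_iff) metis
  obtain h r where h: "h \<in> C" "strict_mono (r :: nat \<Rightarrow> nat)" "(g \<circ> r) \<longlonglongrightarrow> h"
    using C g(2) unfolding compact_def by blast
  have xr: "(x \<circ> r) \<longlonglongrightarrow> l" using LIMSEQ_subseq_LIMSEQ[OF xl h(2)] .
  have "\<phi> l + h \<bullet> (y - l) \<le> \<phi> y" for y
  proof (rule tendsto_le[OF _ tendsto_const])
    have "isCont \<phi> l" using continuous_on_convex_UNIV[OF \<phi>, of UNIV] by (simp add: continuous_on_eq_continuous_at)
    then have "(\<lambda>n. \<phi> ((x \<circ> r) n)) \<longlonglongrightarrow> \<phi> l" using xr by (rule isCont_tendsto_compose)
    then show "(\<lambda>n. \<phi> ((x \<circ> r) n) + (g \<circ> r) n \<bullet> (y - (x \<circ> r) n)) \<longlonglongrightarrow> \<phi> l + h \<bullet> (y - l)"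
      by (intro tendsto_intros xr h(3))
    show "\<forall>\<^sub>F n in sequentially. \<phi> ((x \<circ> r) n) + (g \<circ> r) n \<bullet> (y - (x \<circ> r) n) \<le> \<phi> y"
      using g(1) by (auto simp: subdifferential_def)
  qed simp
  then show "l \<in> {x. subdifferential \<phi> x \<inter> C \<noteq> {}}" using h(1) by (auto simp: subdifferential_def)
qed

text \<open>At an interior point every subgradient has norm at most \<open>L\<close>, as moving in its own
  direction shows. At a boundary point this need hold only for some subgradient, a limit of
  subgradients at interior points, and hence of the shortest one.\<close>

lemma min_subgradient_bound:
  fixes \<phi> :: "'a::euclidean_space \<Rightarrow> real"
  assumes \<phi>: "convex_on UNIV \<phi>" and K: "closed K" "convex K" "interior K \<noteq> {}"
    and lip: "L-lipschitz_on K \<phi>" and x: "x \<in> K"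
  shows "norm (min_subgradient \<phi> x) \<le> L"
proof -
  have L: "L \<ge> 0" using lip by (simp add: lipschitz_on_def)
  have "interior K \<subseteq> {x. subdifferential \<phi> x \<inter> cball 0 L \<noteq> {}}"
  proof
    fix z assume z: "z \<in> interior K"
    obtain g where g: "g \<in> subdifferential \<phi> z" using subdifferential_nonempty[OF \<phi>] by blast
    obtain e where e: "e > 0" "cball z e \<subseteq> K" using z by (auto simp: mem_interior_cball)
    have "norm g \<le> L"
    proof (cases "g = 0")
      case False
      define y where "y = z + (e / norm g) *\<^sub>R g"
      have dy: "dist y z = e" using False e by (simp add: y_def dist_norm)
      then have "y \<in> K" "z \<in> K" using e by (auto simp: dist_commute)
      then have "dist (\<phi> y) (\<phi> z) \<le> L * e" using lipschitz_onD[OF lip, of y z] dy by simp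
      moreover have "\<phi> z + g \<bullet> (y - z) \<le> \<phi> y" using g by (simp add: subdifferential_def)
      moreover have "g \<bullet> (y - z) = e * norm g"
        using False by (simp add: y_def power2_norm_eq_inner[symmetric] power2_eq_square)
      ultimately have "e * norm g \<le> e * L" by (simp add: dist_real_def algebra_simps)
      then show ?thesis using e by simp
    qed (use L in simp)
    then show "z \<in> {x. subdifferential \<phi> x \<inter> cball 0 L \<noteq> {}}" using g by auto
  qed
  then have "closure (interior K) \<subseteq> {x. subdifferential \<phi> x \<inter> cball 0 L \<noteq> {}}"
    by (intro closure_minimal closed_subdifferential_meets_compact[OF \<phi>]) auto
  moreover have "closure (interior K) = K"
    using convex_closure_interior[OF K(2,3)] K(1) by simp
  ultimately obtain g where "g \<in> subdifferential \<phi> x" "norm g \<le> L" using x by fastforce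
  then show ?thesis using min_subgradient_le[OF \<phi>] by force
qed

text \<open>By compactness, the shortest subgradient at \<open>x\<close> lies in a closed set
  \<open>F\<close> as soon as \<open>F\<close> contains subgradients whose norms come
  arbitrarily close to the least one. Letting the admitted norm run through the rationals
  expresses the preimage of \<open>F\<close> through countably many closed sets and their
  complements.\<close>

lemma borel_measurable_min_subgradient:
  fixes \<phi> :: "'a::euclidean_space \<Rightarrow> real"
  assumes \<phi>: "convex_on UNIV \<phi>"
  shows "min_subgradient \<phi> \<in> borel_measurable borel"
proof -
  let ?m = "min_subgradient \<phi>"
  have "{x. norm (?m x) \<le> a} = {x. subdifferential \<phi> x \<inter> cball 0 a \<noteq> {}}" for a
    using min_subgradient_in[OF \<phi>] min_subgradient_le[OF \<phi>] by (fastforce simp: Int_def)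
  then have nm: "{x. norm (?m x) \<le> a} \<in> sets borel" for a
    using closed_subdifferential_meets_compact[OF \<phi> compact_cball] by simp
  have *: "?m -` F = (\<Inter>n. {x. \<not> norm (?m x) \<le> of_rat n} \<union>
      {x. subdifferential \<phi> x \<inter> (F \<inter> cball 0 (of_rat n)) \<noteq> {}})" (is "_ = ?R") if F: "closed F" for F
  proof (intro equalityI subsetI)
    fix x assume "x \<in> ?m -` F"
    then show "x \<in> ?R" using min_subgradient_in[OF \<phi>, of x] by auto
  next
    fix x assume x: "x \<in> ?R"
    define c where "c n = norm (?m x) + 1 / Suc n" for n
    have "\<exists>g. g \<in> subdifferential \<phi> x \<and> g \<in> F \<and> norm g \<le> c n" for n
    proof -
      obtain q where q: "norm (?m x) < of_rat q" "of_rat q < c n"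
        using of_rat_dense[of "norm (?m x)" "c n"] by (auto simp: c_def)
      then have "subdifferential \<phi> x \<inter> (F \<inter> cball 0 (of_rat q)) \<noteq> {}" using x by force
      then show ?thesis using q by fastforce
    qed
    then obtain g where g: "\<And>n. g n \<in> subdifferential \<phi> x" "\<And>n. g n \<in> F" "\<And>n. norm (g n) \<le> c n" by metis
    have "norm (g n) \<le> norm (?m x) + 1" for n 
    proof -
      have "1 / real (Suc n) \<le> 1" by simp
      then show ?thesis using g(3)[of n] unfolding c_def by linarith
    qed
    then have "\<forall>n. g n \<in> (subdifferential \<phi> x \<inter> F) \<inter> cball 0 (norm (?m x) + 1)" using g by auto
    moreover have "compact ((subdifferential \<phi> x \<inter> F) \<inter> cball 0 (norm (?m x) + 1))"
      by (intro closed_Int_compact closed_Int closed_subdifferential F compact_cball)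
    ultimately obtain h r where h: "h \<in> (subdifferential \<phi> x \<inter> F)" "strict_mono (r :: nat \<Rightarrow> nat)" "(g \<circ> r) \<longlonglongrightarrow> h"
      unfolding compact_def by blast
    have "(\<lambda>n. 1 / real (Suc n)) \<longlonglongrightarrow> 0" using LIMSEQ_Suc[OF lim_1_over_n] by simp
    then have "c \<longlonglongrightarrow> norm (?m x) + 0" unfolding c_def by (intro tendsto_add tendsto_const)
    then have "(c \<circ> r) \<longlonglongrightarrow> norm (?m x)" using LIMSEQ_subseq_LIMSEQ[OF _ h(2)] by simp
    then have "norm h \<le> norm (?m x)"
      using tendsto_norm[OF h(3)] g(3) by (intro LIMSEQ_le) auto
    then have "h = ?m x" using min_subgradient_unique[OF \<phi>] h(1) by auto
    then show "x \<in> ?m -` F" using h(1) by auto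
  qed
  show ?thesis
    unfolding borel_eq_closed
  proof (rule measurable_measure_of)
    fix F :: "'a set" assume "F \<in> Collect closed"
    then have F: "closed F" by simp
    have "closed {x. subdifferential \<phi> x \<inter> (F \<inter> cball 0 a) \<noteq> {}}" for a
      using F by (intro closed_subdifferential_meets_compact[OF \<phi>] closed_Int_compact compact_cball)
    then have "?m -` F \<in> sets borel"
      unfolding *[OF F] using nm by (intro sets.countable_INT' sets.Un borel_closed)
        (auto simp: Compl_eq[symmetric] Collect_neg_eq)
    then show "?m -` F \<inter> space (sigma UNIV (Collect closed)) \<in> sets (sigma UNIV (Collect closed))"
      by (simp flip: borel_eq_closed)
  qed auto
qed

text \<open>If \<open>\<phi>\<close> were very negative at some \<open>x\<close>, then by convexity it
  would be very negative on the image of a fixed ball in \<open>K\<close> under the homothety of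
  ratio 1/2 centred at \<open>x\<close>. All these images have the same volume, so \<open>exp (-
  \<phi>)\<close> could not have integral 1.\<close>

lemma convex_potential_bdd_below:
  fixes \<phi> :: "'a::euclidean_space \<Rightarrow> real"
  assumes \<phi>: "convex_on UNIV \<phi>" and K: "closed K" "convex K" "interior K \<noteq> {}"
    and lip: "L-lipschitz_on K \<phi>"
    and int: "(\<integral>\<^sup>+x. indicator K x * ennreal (exp (- \<phi> x)) \<partial>lborel) = 1"
  shows "bdd_below (\<phi> ` K)"
proof -
  obtain c e where e: "e > 0" "cball c e \<subseteq> K" using K(3) mem_interior_cball[of _ K] by blast
  have L: "L \<ge> 0" using lip by (simp add: lipschitz_on_def)
  have cK: "c \<in> K" using e by auto
  define \<beta> where "\<beta> = measure lborel (ball (0::'a) (e/2))"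
  have \<beta>: "\<beta> > 0" unfolding \<beta>_def using content_ball_pos[of "e/2" "0::'a"] e by simp
  have "ln \<beta> * 2 - \<phi> c - L * e \<le> \<phi> x" if x: "x \<in> K" for x
  proof -
    define m where "m = (1/2) *\<^sub>R (x + c)"
    define q where "q = (\<phi> x + \<phi> c + L * e) / 2"
    have sub: "y \<in> K \<and> \<phi> y \<le> q" if "y \<in> ball m (e/2)" for y
    proof -
      define z where "z = 2 *\<^sub>R y - x"
      have y: "y = (1/2) *\<^sub>R x + (1/2) *\<^sub>R z" by (simp add: z_def algebra_simps)
      have "c - z = 2 *\<^sub>R (m - y)" by (simp add: z_def m_def algebra_simps)
      then have "dist c z = 2 * dist m y" by (simp add: dist_norm)
      then have dz: "dist c z \<le> e" using that by simp
      then have zK: "z \<in> K" using e by auto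
      have "\<bar>\<phi> z - \<phi> c\<bar> \<le> L * dist z c" using lipschitz_onD[OF lip zK cK] by (simp add: dist_real_def)
      also have "\<dots> \<le> L * e" using dz L by (intro mult_left_mono) (auto simp: dist_commute)
      finally have "\<phi> z \<le> \<phi> c + L * e" by simp
      moreover have "\<phi> y \<le> (1/2) * \<phi> x + (1/2) * \<phi> z"
        unfolding y using convex_onD[OF \<phi>, of "1/2" x z] by simp
      moreover have "y \<in> K" unfolding y using convexD[OF K(2) x zK, of "1/2" "1/2"] by simp
      ultimately show ?thesis by (simp add: q_def)
    qed
    have em: "emeasure lborel (ball m (e/2)) = ennreal \<beta>"
      using content_ball_conv_unit_ball[of "e/2" m] content_ball_conv_unit_ball[of "e/2" "0::'a"] e
      emeasure_lborel_ball_finite[of m "e/2"]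
      by (simp add: \<beta>_def emeasure_eq_ennreal_measure)
    have "ennreal (exp (- q) * \<beta>) = (\<integral>\<^sup>+y. ennreal (exp (- q)) * indicator (ball m (e/2)) y \<partial>lborel)"
      using em \<beta> by (subst nn_integral_cmult_indicator) (simp_all add: ennreal_mult)
    also have "\<dots> \<le> (\<integral>\<^sup>+x. indicator K x * ennreal (exp (- \<phi> x)) \<partial>lborel)"
      using sub by (intro nn_integral_mono) (auto split: split_indicator simp del: mem_ball)
    finally have "exp (- q) * \<beta> \<le> 1" using int by simp
    then have "\<beta> \<le> exp q" by (simp add: exp_minus field_simps)
    then have "ln \<beta> \<le> q" using \<beta> by (metis ln_exp ln_mono exp_gt_zero)
    then show ?thesis by (simp add: q_def)
  qed
  then show ?thesis by (intro bdd_belowI2)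
qed

section \<open>Passing to the limit in sequences bounded in mean square\<close>

text \<open>A sequence bounded in \<open>L\<^sup>2\<close> is uniformly integrable, so expectations
  survive the limit although \<open>S m\<close> has no integrable lower bound. Instead of
  proving uniform integrability, Fatou's lemma is applied to \<open>h (S m)\<close>, where
  \<open>h y = \<kappa> (max 0 (y + 1 / (2 \<kappa>)))\<^sup>2\<close>. This \<open>h\<close> is
  nonnegative and increasing, and it lies between \<open>y + 1 / (4 \<kappa>)\<close> and
  \<open>y + 1 / (4 \<kappa>) + \<kappa> y\<^sup>2\<close>, so that the loss \<open>\<kappa>
  C\<close> vanishes with \<open>\<kappa>\<close>.\<close>

lemma (in prob_space) nn_integral_le_of_L2_bounded:
  fixes f W :: "'a \<Rightarrow> real" and S :: "nat \<Rightarrow> 'a \<Rightarrow> real"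
  assumes f: "f \<in> borel_measurable M" "AE \<omega> in M. 0 \<le> f \<omega>"
    and W: "integrable M W"
    and S: "\<And>m. S m \<in> borel_measurable M" "\<And>m. integrable M (\<lambda>\<omega>. (S m \<omega>)\<^sup>2)"
    and C: "\<And>m. expectation (\<lambda>\<omega>. (S m \<omega>)\<^sup>2) \<le> C"
    and c: "\<And>m. expectation (S m) \<le> c m" "c \<longlonglongrightarrow> d"
    and le: "AE \<omega> in M. \<forall>\<epsilon>>0. eventually (\<lambda>m. f \<omega> \<le> W \<omega> + S m \<omega> + \<epsilon>) sequentially"
  shows "(\<integral>\<^sup>+\<omega>. ennreal (f \<omega>) \<partial>M) \<le> ennreal (expectation W + d)"
proof -
  have Si: "integrable M (S m)" for m using square_integrable_imp_integrable[OF S] .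
  have bound: "expectation (\<lambda>\<omega>. min (f \<omega>) b) \<le> expectation W + d" if b: "b \<ge> 0" for b
  proof (rule field_le_epsilon)
    fix \<epsilon> :: real assume \<epsilon>: "0 < \<epsilon>"
    \<comment> \<open>With this \<open>\<kappa>\<close> the loss \<open>\<kappa> C\<close> is at most the prescribed \<open>\<epsilon>\<close>.\<close>
    define \<kappa> where "\<kappa> = \<epsilon> / (\<bar>C\<bar> + 1)"
    have "\<epsilon> * C \<le> \<epsilon> * (\<bar>C\<bar> + 1)" using \<epsilon> by (intro mult_left_mono) auto
    then have \<kappa>: "\<kappa> > 0" "\<kappa> * C \<le> \<epsilon>" using \<epsilon> by (auto simp: \<kappa>_def divide_le_eq)
    define h where "h y = \<kappa> * (max 0 (y + 1 / (2 * \<kappa>)))\<^sup>2" for y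
    have h0: "h y \<ge> 0" for y using \<kappa> by (simp add: h_def)
    have h_ge: "y + 1 / (4 * \<kappa>) \<le> h y" for y
    proof (cases "y + 1 / (2 * \<kappa>) \<ge> 0")
      case True
      then have "h y = y + 1 / (4 * \<kappa>) + \<kappa> * y\<^sup>2"
        using \<kappa> by (simp add: h_def power2_eq_square field_simps)
      then show ?thesis using \<kappa> by simp
    next
      case False
      have "1 / (4 * \<kappa>) \<le> 1 / (2 * \<kappa>)" using \<kappa> by (simp add: field_simps)
      then show ?thesis using False h0[of y] by linarith
    qed
    have h_le: "h y \<le> \<kappa> * y\<^sup>2 + y + 1 / (4 * \<kappa>)" for y
    proof -
      have "h y \<le> \<kappa> * (y + 1 / (2 * \<kappa>))\<^sup>2" using \<kappa> by (auto simp: h_def max_def)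
      also have "\<dots> = \<kappa> * y\<^sup>2 + y + 1 / (4 * \<kappa>)" using \<kappa> by (simp add: power2_eq_square field_simps)
      finally show ?thesis .
    qed
    have hcont: "continuous_on UNIV h" unfolding h_def by (intro continuous_intros)
    have hmono: "mono h" unfolding h_def using \<kappa> by (intro monoI mult_left_mono power_mono) auto
    have [measurable]: "h \<in> borel_measurable borel" using hcont by (rule borel_measurable_continuous_onI)
    define Y where "Y \<omega> = min (f \<omega>) b - W \<omega>" for \<omega>
    have [measurable]: "f \<in> borel_measurable M" "W \<in> borel_measurable M" "S m \<in> borel_measurable M" for m
      using f W S by auto
    have fb: "integrable M (\<lambda>\<omega>. min (f \<omega>) b)"
      using f(2) b by (intro integrable_const_bound[of _ b]) auto
    have Yi: "integrable M Y" unfolding Y_def using fb W by simp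
    \<comment> \<open>The error \<open>\<epsilon>\<close> of the hypothesis runs through \<open>1 / Suc k\<close> and disappears by continuity of \<open>h\<close>.\<close>
    have lim: "AE \<omega> in M. ennreal (h (Y \<omega>)) \<le> liminf (\<lambda>m. ennreal (h (S m \<omega>)))"
      using le
    proof eventually_elim
      case (elim \<omega>)
      have "ennreal (h (Y \<omega> - 1 / Suc k)) \<le> liminf (\<lambda>m. ennreal (h (S m \<omega>)))" for k
      proof (rule Liminf_bounded)
        have "eventually (\<lambda>m. f \<omega> \<le> W \<omega> + S m \<omega> + 1 / Suc k) sequentially" using elim by simp
        then show "\<forall>\<^sub>F m in sequentially. ennreal (h (Y \<omega> - 1 / Suc k)) \<le> ennreal (h (S m \<omega>))"
          by eventually_elim (intro ennreal_leI monoD[OF hmono], simp add: Y_def)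
      qed
      moreover have "(\<lambda>k. ennreal (h (Y \<omega> - 1 / Suc k))) \<longlonglongrightarrow> ennreal (h (Y \<omega>))"
      proof -
        have "(\<lambda>n. 1 / real (Suc n)) \<longlonglongrightarrow> 0" using LIMSEQ_Suc[OF lim_1_over_n] by simp
        then have "(\<lambda>k. Y \<omega> - 1 / Suc k) \<longlonglongrightarrow> Y \<omega>" using tendsto_diff[OF tendsto_const] by fastforce
        moreover have "isCont h (Y \<omega>)" using hcont by (simp add: continuous_on_eq_continuous_at)
        ultimately show ?thesis by (intro tendsto_ennrealI isCont_tendsto_compose[of _ h])
      qed
      ultimately show ?case by (intro LIMSEQ_le_const2) auto
    qed
    have hS: "integrable M (\<lambda>\<omega>. h (S m \<omega>))" for m
      by (rule Bochner_Integration.integrable_bound[of _ "\<lambda>\<omega>. \<kappa> * (S m \<omega>)\<^sup>2 + S m \<omega> + 1 / (4 * \<kappa>)"])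
        (use S Si h0 h_le in \<open>auto intro!: AE_I2 order.trans[OF h_le]\<close>)
    have ES: "expectation (\<lambda>\<omega>. h (S m \<omega>)) \<le> \<epsilon> + c m + 1 / (4 * \<kappa>)" for m
    proof -
      have "expectation (\<lambda>\<omega>. h (S m \<omega>)) \<le> expectation (\<lambda>\<omega>. \<kappa> * (S m \<omega>)\<^sup>2 + S m \<omega> + 1 / (4 * \<kappa>))"
        using S Si hS h_le by (intro integral_mono) auto
      also have "\<dots> = \<kappa> * expectation (\<lambda>\<omega>. (S m \<omega>)\<^sup>2) + expectation (S m) + 1 / (4 * \<kappa>)"
        using S Si by (simp add: prob_space)
      also have "\<dots> \<le> \<epsilon> + c m + 1 / (4 * \<kappa>)"
        using mult_left_mono[OF C[of m] less_imp_le[OF \<kappa>(1)]] \<kappa>(2) c(1)[of m] by linarith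
      finally show ?thesis .
    qed
    have "(\<integral>\<^sup>+\<omega>. ennreal (h (Y \<omega>)) \<partial>M) \<le> (\<integral>\<^sup>+\<omega>. liminf (\<lambda>m. ennreal (h (S m \<omega>))) \<partial>M)"
      using lim by (rule nn_integral_mono_AE)
    also have "\<dots> \<le> liminf (\<lambda>m. \<integral>\<^sup>+\<omega>. ennreal (h (S m \<omega>)) \<partial>M)"
      by (rule nn_integral_liminf) measurable
    also have "\<dots> \<le> liminf (\<lambda>m. ennreal (\<epsilon> + c m + 1 / (4 * \<kappa>)))"
      using hS ES h0 by (intro Liminf_mono always_eventually allI) (simp add: nn_integral_eq_integral ennreal_leI)
    also have "\<dots> = ennreal (\<epsilon> + d + 1 / (4 * \<kappa>))"
      by (intro lim_imp_Liminf tendsto_ennrealI tendsto_intros c(2)) simp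
    finally have hY: "(\<integral>\<^sup>+\<omega>. ennreal (h (Y \<omega>)) \<partial>M) \<le> ennreal (\<epsilon> + d + 1 / (4 * \<kappa>))" .
    have nn: "0 \<le> \<epsilon> + d + 1 / (4 * \<kappa>)"
    proof (rule LIMSEQ_le_const)
      show "(\<lambda>m. \<epsilon> + c m + 1 / (4 * \<kappa>)) \<longlonglongrightarrow> \<epsilon> + d + 1 / (4 * \<kappa>)" by (intro tendsto_intros c(2))
      have "0 \<le> \<epsilon> + c m + 1 / (4 * \<kappa>)" for m
        by (rule order.trans[OF Bochner_Integration.integral_nonneg ES]) (simp add: h0)
      then show "\<exists>N. \<forall>n\<ge>N. 0 \<le> \<epsilon> + c n + 1 / (4 * \<kappa>)" by blast
    qed
    have hYi: "integrable M (\<lambda>\<omega>. h (Y \<omega>))"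
      using hY h0 Yi by (intro integrableI_bounded) (auto simp: less_top[symmetric] top_unique)
    have "expectation Y + 1 / (4 * \<kappa>) = expectation (\<lambda>\<omega>. Y \<omega> + 1 / (4 * \<kappa>))"
      using Yi by (simp add: prob_space)
    also have "\<dots> \<le> expectation (\<lambda>\<omega>. h (Y \<omega>))"
      using Yi hYi h_ge by (intro integral_mono) auto
    also have "\<dots> \<le> \<epsilon> + d + 1 / (4 * \<kappa>)"
      using hY hYi h0 nn by (simp add: nn_integral_eq_integral)
    finally show "expectation (\<lambda>\<omega>. min (f \<omega>) b) \<le> expectation W + d + \<epsilon>"
      using Bochner_Integration.integral_diff[OF fb W] unfolding Y_def[abs_def] by linarith
  qed
  have [measurable]: "f \<in> borel_measurable M" using f by auto
  have "(\<integral>\<^sup>+\<omega>. ennreal (f \<omega>) \<partial>M) = (\<integral>\<^sup>+\<omega>. (SUP i. ennreal (min (f \<omega>) (real i))) \<partial>M)"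
  proof (rule nn_integral_cong)
    fix \<omega>
    obtain i where "f \<omega> \<le> real i" using real_arch_simple by blast
    then have "ennreal (f \<omega>) \<le> (SUP i. ennreal (min (f \<omega>) (real i)))"
      by (intro SUP_upper2[of i]) auto
    moreover have "(SUP i. ennreal (min (f \<omega>) (real i))) \<le> ennreal (f \<omega>)"
      by (intro SUP_least ennreal_leI) simp
    ultimately show "ennreal (f \<omega>) = (SUP i. ennreal (min (f \<omega>) (real i)))" by (rule antisym)
  qed
  also have "\<dots> = (SUP i. \<integral>\<^sup>+\<omega>. ennreal (min (f \<omega>) (real i)) \<partial>M)"
    by (intro nn_integral_monotone_convergence_SUP) (auto simp: incseq_def le_fun_def intro!: ennreal_leI)
  also have "\<dots> \<le> ennreal (expectation W + d)"
  proof (rule SUP_least)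
    fix i :: nat
    have "integrable M (\<lambda>\<omega>. min (f \<omega>) (real i))"
      using f(2) by (intro integrable_const_bound[of _ "real i"]) auto
    then have "(\<integral>\<^sup>+\<omega>. ennreal (min (f \<omega>) (real i)) \<partial>M) = ennreal (expectation (\<lambda>\<omega>. min (f \<omega>) (real i)))"
      using f(2) by (intro nn_integral_eq_integral) auto
    then show "(\<integral>\<^sup>+\<omega>. ennreal (min (f \<omega>) (real i)) \<partial>M) \<le> ennreal (expectation W + d)"
      using bound[of "real i"] by (simp add: ennreal_leI)
  qed
  finally show ?thesis .
qed

section \<open>Moments of isotropic Gaussian vectors\<close>

lemma lborel_distr_uminus_euclidean:
  "distr lborel borel uminus = (lborel :: 'a::euclidean_space measure)"
  using lborel_affine[of "-1" "0 :: 'a"] by (simp add: density_1 one_ennreal_def[symmetric])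

lemma isotropic_gaussian_density_nonneg: "0 \<le> isotropic_gaussian_density v z"
  by (simp add: isotropic_gaussian_density_def)

lemma borel_measurable_isotropic_gaussian_density [measurable]:
  "isotropic_gaussian_density v \<in> borel_measurable borel"
  unfolding isotropic_gaussian_density_def[abs_def] by measurable

lemma distributed_emeasure_UNIV:
  assumes "prob_space M" "distributed M lborel Z f"
  shows "(\<integral>\<^sup>+z. f z \<partial>lborel) = 1"
proof -
  have Z: "Z \<in> measurable M lborel" and f: "f \<in> borel_measurable lborel" and eq: "distr M lborel Z = density lborel f"
    using assms(2) by (auto simp: distributed_def)
  interpret prob_space M by fact
  interpret D: prob_space "distr M lborel Z" using Z by (rule prob_space_distr)
  have "1 = emeasure (density lborel f) (space (density lborel f))"
    using D.emeasure_space_1 eq by simp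
  also have "\<dots> = (\<integral>\<^sup>+z. f z \<partial>lborel)"
    using f by (subst emeasure_density) auto
  finally show ?thesis by simp
qed

context standard_brownian_motion
begin

text \<open>A Brownian increment over a time span \<open>v\<close> has this density, which therefore has
  integral 1.\<close>

lemma gaussian_density_normalised:
  assumes "v > 0"
  shows "(\<integral>\<^sup>+z. ennreal (isotropic_gaussian_density v (z::'a)) \<partial>lborel) = 1"
  using distributed_emeasure_UNIV[OF prob_space_axioms] gaussian_increments[of 0 v] assms
  unfolding centered_gaussian_def by simp

text \<open>Multiplication by this exponential turns the density of variance \<open>v\<close> into
  \<open>s powr (n / 2)\<close> times the density of variance \<open>s v\<close>, where
  \<open>n\<close> is the dimension.\<close>

lemma gaussian_exp_moment:
  fixes Z :: "'w \<Rightarrow> 'a"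
  assumes Z: "centered_gaussian M v Z" and v: "v > 0" and s: "s > 1"
  shows "(\<integral>\<^sup>+\<omega>. ennreal (exp ((1 - 1 / s) * (norm (Z \<omega>))\<^sup>2 / (2 * v))) \<partial>M)
           = ennreal (s powr (real DIM('a) / 2))"
proof -
  have D: "distributed M lborel Z (\<lambda>z. ennreal (isotropic_gaussian_density v z))"
    using Z by (simp add: centered_gaussian_def)
  have eq: "isotropic_gaussian_density v z * exp ((1 - 1 / s) * (norm z)\<^sup>2 / (2 * v))
      = s powr (real DIM('a) / 2) * isotropic_gaussian_density (s * v) z" for z :: 'a
  proof -
    have "(2 * pi * (s * v)) powr (- real DIM('a) / 2)
        = s powr (- real DIM('a) / 2) * (2 * pi * v) powr (- real DIM('a) / 2)"
      using s v by (subst powr_mult[symmetric]) (auto simp: ac_simps)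
    moreover have "s powr (real DIM('a) / 2) * s powr (- real DIM('a) / 2) = 1"
      using s by (simp flip: powr_add)
    moreover have "exp (- (norm z)\<^sup>2 / (2 * v)) * exp ((1 - 1 / s) * (norm z)\<^sup>2 / (2 * v))
        = exp (- (norm z)\<^sup>2 / (2 * (s * v)))"
      using s v by (simp add: exp_add[symmetric] field_simps)
    ultimately show ?thesis unfolding isotropic_gaussian_density_def by (simp add: mult.assoc)
  qed
  have "(\<integral>\<^sup>+\<omega>. ennreal (exp ((1 - 1 / s) * (norm (Z \<omega>))\<^sup>2 / (2 * v))) \<partial>M)
     = (\<integral>\<^sup>+z. ennreal (isotropic_gaussian_density v (z::'a)) * ennreal (exp ((1 - 1 / s) * (norm z)\<^sup>2 / (2 * v))) \<partial>lborel)"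
    by (rule distributed_nn_integral[OF D, of "\<lambda>z. ennreal (exp ((1 - 1 / s) * (norm z)\<^sup>2 / (2 * v)))", symmetric]) measurable
  also have "\<dots> = (\<integral>\<^sup>+z. ennreal (s powr (real DIM('a) / 2)) * ennreal (isotropic_gaussian_density (s * v) (z::'a)) \<partial>lborel)"
    by (intro nn_integral_cong) (simp add: ennreal_mult'[symmetric] eq isotropic_gaussian_density_nonneg)
  also have "\<dots> = ennreal (s powr (real DIM('a) / 2))"
    using s v by (subst nn_integral_cmult)
      (simp_all add: gaussian_density_normalised)
  finally show ?thesis .
qed

text \<open>Everything follows from the exponential moment. The sharp bound \<open>n v\<close> on the
  second moment comes from \<open>1 + x \<le> exp x\<close> by letting \<open>s\<close> tend to
  1: it is a derivative of \<open>s powr (n / 2)\<close> at 1. The constant in the fourth moment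
  is crude, because that moment enters only through errors that vanish with the mesh.\<close>

lemma gaussian_moments:
  fixes Z :: "'w \<Rightarrow> 'a"
  assumes Z: "centered_gaussian M v Z" and v: "v > 0"
  shows gaussian_measurable: "Z \<in> borel_measurable M"
    and gaussian_square_integrable: "integrable M (\<lambda>\<omega>. (norm (Z \<omega>))\<^sup>2)"
    and gaussian_second_moment: "expectation (\<lambda>\<omega>. (norm (Z \<omega>))\<^sup>2) \<le> real DIM('a) * v"
    and gaussian_fourth_integrable: "integrable M (\<lambda>\<omega>. ((norm (Z \<omega>))\<^sup>2)\<^sup>2)"
    and gaussian_fourth_moment: "expectation (\<lambda>\<omega>. ((norm (Z \<omega>))\<^sup>2)\<^sup>2) \<le> 32 * 2 powr (real DIM('a) / 2) * v\<^sup>2"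
    and gaussian_integrable: "integrable M (\<lambda>\<omega>. Z \<omega> \<bullet> e)"
    and gaussian_mean_zero: "expectation (\<lambda>\<omega>. Z \<omega> \<bullet> e) = 0"
proof -
  let ?n = "real DIM('a)"
  have D: "distributed M lborel Z (\<lambda>z. ennreal (isotropic_gaussian_density v z))"
    using Z by (simp add: centered_gaussian_def)
  then show [measurable]: "Z \<in> borel_measurable M" by (auto simp: distributed_def)
  have int: "integrable M (\<lambda>\<omega>. exp ((1 - 1 / s) * (norm (Z \<omega>))\<^sup>2 / (2 * v)))"
    and E: "expectation (\<lambda>\<omega>. exp ((1 - 1 / s) * (norm (Z \<omega>))\<^sup>2 / (2 * v))) = s powr (?n / 2)" if "s > 1" for s
  proof -
    show i: "integrable M (\<lambda>\<omega>. exp ((1 - 1 / s) * (norm (Z \<omega>))\<^sup>2 / (2 * v)))"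
      using gaussian_exp_moment[OF Z v that] by (intro integrableI_bounded) auto
    show "expectation (\<lambda>\<omega>. exp ((1 - 1 / s) * (norm (Z \<omega>))\<^sup>2 / (2 * v))) = s powr (?n / 2)"
      using gaussian_exp_moment[OF Z v that] by (simp add: nn_integral_eq_integral[OF i])
  qed
  have int2: "integrable M (\<lambda>\<omega>. exp ((norm (Z \<omega>))\<^sup>2 / (4 * v)))"
    and E2: "expectation (\<lambda>\<omega>. exp ((norm (Z \<omega>))\<^sup>2 / (4 * v))) = 2 powr (?n / 2)"
    using int[of 2] E[of 2] by simp_all
  show sq: "integrable M (\<lambda>\<omega>. (norm (Z \<omega>))\<^sup>2)"
  proof (rule Bochner_Integration.integrable_bound[OF integrable_mult_right[OF int2, of "4 * v"]])
    show "AE \<omega> in M. norm ((norm (Z \<omega>))\<^sup>2) \<le> norm (4 * v * exp ((norm (Z \<omega>))\<^sup>2 / (4 * v)))"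
    proof (rule AE_I2)
      fix \<omega>
      have "(norm (Z \<omega>))\<^sup>2 / (4 * v) \<le> exp ((norm (Z \<omega>))\<^sup>2 / (4 * v))"
        using exp_ge_add_one_self[of "(norm (Z \<omega>))\<^sup>2 / (4 * v)"] by linarith
      then show "norm ((norm (Z \<omega>))\<^sup>2) \<le> norm (4 * v * exp ((norm (Z \<omega>))\<^sup>2 / (4 * v)))"
        using v by (simp add: abs_mult divide_le_eq mult.commute)
    qed
  qed measurable
  have exp2: "x\<^sup>2 \<le> 2 * exp x" if "x \<ge> 0" for x :: real
    using exp_lower_Taylor_quadratic[OF that] that by simp
  have four: "((norm (Z \<omega>))\<^sup>2)\<^sup>2 \<le> 32 * v\<^sup>2 * exp ((norm (Z \<omega>))\<^sup>2 / (4 * v))" for \<omega>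
    using exp2[of "(norm (Z \<omega>))\<^sup>2 / (4 * v)"] v
    by (simp add: power_divide power_mult_distrib field_simps)
  show fi: "integrable M (\<lambda>\<omega>. ((norm (Z \<omega>))\<^sup>2)\<^sup>2)"
    by (rule Bochner_Integration.integrable_bound[OF integrable_mult_right[OF int2, of "32 * v\<^sup>2"]])
      (use four v in \<open>auto simp: abs_mult\<close>)
  have "expectation (\<lambda>\<omega>. ((norm (Z \<omega>))\<^sup>2)\<^sup>2) \<le> expectation (\<lambda>\<omega>. 32 * v\<^sup>2 * exp ((norm (Z \<omega>))\<^sup>2 / (4 * v)))"
    using fi int2 four by (intro integral_mono) auto
  also have "\<dots> = 32 * 2 powr (?n / 2) * v\<^sup>2"
    by (simp only: integral_mult_right_zero E2) (simp only: mult_ac)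
  finally show "expectation (\<lambda>\<omega>. ((norm (Z \<omega>))\<^sup>2)\<^sup>2) \<le> 32 * 2 powr (?n / 2) * v\<^sup>2" .
  \<comment> \<open>The exponential moment with \<open>s = 1 + h\<close>; afterwards \<open>h\<close> tends to 0.\<close>
  have bnd: "expectation (\<lambda>\<omega>. (norm (Z \<omega>))\<^sup>2) \<le> 2 * v * (1 + h) * (((1 + h) powr (?n / 2) - 1 powr (?n / 2)) / h)"
    if h: "h > 0" for h
  proof -
    define \<theta> where "\<theta> = (1 - 1 / (1 + h)) / (2 * v)"
    have "\<theta> = h / (2 * v * (1 + h))" using h v by (simp add: \<theta>_def field_simps)
    then have \<theta>: "\<theta> > 0" "1 / \<theta> = 2 * v * (1 + h) / h" using h v by auto
    have eq: "(1 - 1 / (1 + h)) * x / (2 * v) = \<theta> * x" for x by (simp add: \<theta>_def)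
    have "expectation (\<lambda>\<omega>. \<theta> * (norm (Z \<omega>))\<^sup>2 + 1) \<le> expectation (\<lambda>\<omega>. exp (\<theta> * (norm (Z \<omega>))\<^sup>2))"
      using int[of "1 + h"] h sq unfolding eq
      by (intro integral_mono) (auto simp: add.commute intro: exp_ge_add_one_self[of "\<theta> * _", simplified add.commute[of 1]])
    also have "\<dots> = (1 + h) powr (?n / 2)" using E[of "1 + h"] h unfolding eq by simp
    finally have "\<theta> * expectation (\<lambda>\<omega>. (norm (Z \<omega>))\<^sup>2) \<le> (1 + h) powr (?n / 2) - 1"
      using sq by (simp add: prob_space)
    then have "expectation (\<lambda>\<omega>. (norm (Z \<omega>))\<^sup>2) \<le> (1 / \<theta>) * ((1 + h) powr (?n / 2) - 1)"
      using \<theta>(1) by (simp add: field_simps)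
    then show ?thesis unfolding \<theta>(2) using h by (simp add: mult.assoc)
  qed
  have inv0: "(\<lambda>n. 1 / real (Suc n)) \<longlonglongrightarrow> 0" using LIMSEQ_Suc[OF lim_1_over_n] by simp
  have "((\<lambda>x. x powr (?n / 2)) has_real_derivative ?n / 2) (at (1::real))"
    by (auto intro!: derivative_eq_intros)
  then have "((\<lambda>h. ((1 + h) powr (?n / 2) - 1 powr (?n / 2)) / h) \<longlongrightarrow> ?n / 2) (at (0::real))"
    by (simp add: DERIV_def)
  moreover have "filterlim (\<lambda>k. 1 / real (Suc k)) (at 0) sequentially"
    using inv0 by (simp add: filterlim_at)
  ultimately have "(\<lambda>k. ((1 + 1 / real (Suc k)) powr (?n / 2) - 1 powr (?n / 2)) / (1 / real (Suc k))) \<longlonglongrightarrow> ?n / 2"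
    by (rule filterlim_compose)
  then have "(\<lambda>k. 2 * v * (1 + 1 / real (Suc k)) * (((1 + 1 / real (Suc k)) powr (?n / 2) - 1 powr (?n / 2)) / (1 / real (Suc k))))
      \<longlonglongrightarrow> 2 * v * (1 + 0) * (?n / 2)"
    by (intro tendsto_mult tendsto_const tendsto_add inv0)
  moreover have "expectation (\<lambda>\<omega>. (norm (Z \<omega>))\<^sup>2) \<le> 2 * v * (1 + 1 / real (Suc k)) * (((1 + 1 / real (Suc k)) powr (?n / 2) - 1 powr (?n / 2)) / (1 / real (Suc k)))" for k
    by (rule bnd) simp
  ultimately have "expectation (\<lambda>\<omega>. (norm (Z \<omega>))\<^sup>2) \<le> 2 * v * (1 + 0) * (?n / 2)"
    by (intro LIMSEQ_le_const) auto
  then show "expectation (\<lambda>\<omega>. (norm (Z \<omega>))\<^sup>2) \<le> ?n * v" by (simp add: mult.commute)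
  have "integrable M (\<lambda>\<omega>. norm (Z \<omega>))" using square_integrable_imp_integrable[of "\<lambda>\<omega>. norm (Z \<omega>)"] sq by simp
  then have Zi: "integrable M Z" by (simp add: integrable_norm_iff)
  then show "integrable M (\<lambda>\<omega>. Z \<omega> \<bullet> e)" by simp
  \<comment> \<open>The mean vanishes because the density is even.\<close>
  have "expectation (\<lambda>\<omega>. Z \<omega> \<bullet> e) = (\<integral>z. isotropic_gaussian_density v (z::'a) * (z \<bullet> e) \<partial>lborel)"
    by (rule distributed_integral[OF D, symmetric]) (auto simp: isotropic_gaussian_density_nonneg)
  also have "\<dots> = (\<integral>z. isotropic_gaussian_density v (z::'a) * (z \<bullet> e) \<partial>(distr lborel borel uminus))"
    by (simp add: lborel_distr_uminus_euclidean)
  also have "\<dots> = (\<integral>z. isotropic_gaussian_density v (- z) * (- z \<bullet> (e::'a)) \<partial>lborel)"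
    by (subst integral_distr) (auto intro!: borel_measurable_times measurable_compose[OF _ borel_measurable_isotropic_gaussian_density])
  also have "\<dots> = - (\<integral>z. isotropic_gaussian_density v (z::'a) * (z \<bullet> e) \<partial>lborel)"
    by (simp add: isotropic_gaussian_density_def)
  also have "(\<integral>z. isotropic_gaussian_density v (z::'a) * (z \<bullet> e) \<partial>lborel) = expectation (\<lambda>\<omega>. Z \<omega> \<bullet> e)"
    by (rule distributed_integral[OF D]) (auto simp: isotropic_gaussian_density_nonneg)
  finally show "expectation (\<lambda>\<omega>. Z \<omega> \<bullet> e) = 0" by simp
qed

section \<open>Increments are independent of the past\<close>

abbreviation F :: "real \<Rightarrow> 'w measure" where "F \<equiv> augmented_filtration M B"

lemma filtration_generators:
  "{B u -` S \<inter> space M | u S. 0 \<le> u \<and> u \<le> t \<and> S \<in> sets borel} \<union> null_sets M \<subseteq> sets M"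
  using measurable_B by (auto intro: measurable_sets)

lemma space_F [simp]: "space (F t) = space M"
  by (simp add: augmented_filtration_def space_measure_of_conv)

lemma sets_F: "sets (F t) = sigma_sets (space M)
    ({B u -` S \<inter> space M | u S. 0 \<le> u \<and> u \<le> t \<and> S \<in> sets borel} \<union> null_sets M)"
  unfolding augmented_filtration_def
  by (rule sets_measure_of) (use filtration_generators[of t] sets.space_closed in blast)

lemma subalgebra_F: "subalgebra M (F t)"
  unfolding subalgebra_def sets_F using sets.sigma_sets_subset[OF filtration_generators[of t]] by simp

lemma measurable_F: "X \<in> measurable (F t) N \<Longrightarrow> X \<in> measurable M N"
  by (rule measurable_from_subalg[OF subalgebra_F])

lemma sets_F_mono: "s \<le> t \<Longrightarrow> sets (F s) \<subseteq> sets (F t)"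
  unfolding sets_F by (intro sigma_sets_mono' Un_mono Collect_mono) (metis order.trans, simp)

lemma measurable_F_mono: "s \<le> t \<Longrightarrow> X \<in> measurable (F s) N \<Longrightarrow> X \<in> measurable (F t) N"
  by (rule subsetD[OF measurable_mono]) (simp_all add: sets_F_mono)

lemma B_measurable_F:
  assumes "0 \<le> u" "u \<le> t" shows "B u \<in> borel_measurable (F t)"
  by (rule measurableI) (use assms in \<open>auto simp: sets_F intro!: sigma_sets.Basic\<close>)

text \<open>Sorting the finitely many times makes the values of \<open>B\<close> partial sums of
  increments that are independent of the last one. As \<open>B 0 = 0\<close> holds only almost
  surely, the event is first replaced by the corresponding event for \<open>B u - B 0\<close>.\<close>

lemma increment_indep_cylinder:
  assumes J: "finite J" "J \<subseteq> {0..s}" and st: "0 \<le> s" "s < t"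
    and S: "\<And>u. S u \<in> sets borel" and E: "E \<in> sets borel"
  shows "prob ({\<omega>\<in>space M. \<forall>u\<in>J. B u \<omega> \<in> S u} \<inter> ((\<lambda>\<omega>. B t \<omega> - B s \<omega>) -` E \<inter> space M)) =
    prob {\<omega>\<in>space M. \<forall>u\<in>J. B u \<omega> \<in> S u} * prob ((\<lambda>\<omega>. B t \<omega> - B s \<omega>) -` E \<inter> space M)"
proof -
  define xs where "xs = sorted_list_of_set (insert 0 J)"
  define q where "q = length xs"
  have xs: "sorted xs" "set xs = insert 0 J" using J by (simp_all add: xs_def del: sorted_list_of_set_insert_remove)
  have pos: "0 \<le> xs ! i" "xs ! i \<le> s" if "i < q" for i
    using that xs(2) J(2) st nth_mem[of i xs] by (auto simp: q_def simp del: nth_mem)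
  have q: "q > 0" using xs(2) by (auto simp: q_def)
  have xs0: "xs ! 0 = 0"
  proof -
    obtain i where "i < q" "xs ! i = 0" using xs(2) by (metis insertI1 in_set_conv_nth q_def)
    then have "xs ! 0 \<le> 0" using sorted_nth_mono[OF xs(1), of 0 i] by (simp add: q_def)
    then show ?thesis using pos[of 0] q by simp
  qed
  \<comment> \<open>The sorted times, followed by \<open>s\<close> and then by \<open>t\<close> forever; the increment of index \<open>q\<close> runs from \<open>s\<close> to \<open>t\<close>.\<close>
  define \<tau> where "\<tau> i = (if i < q then xs ! i else if i = q then s else t)" for i
  have "\<tau> i \<le> \<tau> (Suc i)" for i
    using sorted_nth_mono[OF xs(1), of i "Suc i"] pos[of i] st by (auto simp: \<tau>_def q_def)
  then have mono: "mono \<tau>" by (simp add: mono_iff_le_Suc)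
  have \<tau>0: "\<tau> 0 = 0" using q xs0 by (simp add: \<tau>_def)
  define I where "I i \<omega> = B (\<tau> (Suc i)) \<omega> - B (\<tau> i) \<omega>" for i \<omega>
  have ind: "indep_vars (\<lambda>_. borel) I {..<Suc q}"
    using independent_increments[of \<tau> "Suc q"] mono \<tau>0 by (simp add: I_def[abs_def])
  have tel: "(\<Sum>j<i. I j \<omega>) = B (\<tau> i) \<omega> - B 0 \<omega>" for i \<omega>
    using \<tau>0 by (induction i) (simp_all add: I_def)
  have "\<exists>i<q. xs ! i = u" if "u \<in> J" for u using that xs(2) by (metis insertI2 in_set_conv_nth q_def)
  then obtain idx where idx: "\<And>u. u \<in> J \<Longrightarrow> idx u < q \<and> xs ! idx u = u" by metis
  define C where "C = {x \<in> space (PiM {..<q} (\<lambda>_. borel :: 'a measure)). \<forall>u\<in>J. (\<Sum>j<idx u. x j) \<in> S u}"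
  define D where "D = {x \<in> space (PiM {q} (\<lambda>_. borel :: 'a measure)). x q \<in> E}"
  have iv: "indep_var (PiM {..<q} (\<lambda>_. borel)) (\<lambda>\<omega>. \<lambda>i\<in>{..<q}. I i \<omega>) (PiM {q} (\<lambda>_. borel)) (\<lambda>\<omega>. \<lambda>i\<in>{q}. I i \<omega>)"
    by (rule indep_var_restrict[OF ind]) auto
  have "C \<in> sets (PiM {..<q} (\<lambda>_. borel))"
    unfolding C_def
  proof (intro sets.sets_Collect_finite_All J(1))
    fix u assume u: "u \<in> J"
    have "(\<lambda>x. \<Sum>j<idx u. x j) \<in> borel_measurable (PiM {..<q} (\<lambda>_. borel :: 'a measure))"
      using idx[OF u] by (intro borel_measurable_sum measurable_component_singleton) auto
    from measurable_sets[OF this S[of u]]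
    show "{x \<in> space (PiM {..<q} (\<lambda>_. borel)). (\<Sum>j<idx u. x j) \<in> S u} \<in> sets (PiM {..<q} (\<lambda>_. borel))"
      by (simp add: vimage_def Int_def conj_commute)
  qed
  moreover have "D \<in> sets (PiM {q} (\<lambda>_. borel))"
    unfolding D_def using E by measurable
  ultimately have "prob ((\<lambda>\<omega>. (\<lambda>i\<in>{..<q}. I i \<omega>, \<lambda>i\<in>{q}. I i \<omega>)) -` (C \<times> D) \<inter> space M) =
      prob ((\<lambda>\<omega>. \<lambda>i\<in>{..<q}. I i \<omega>) -` C \<inter> space M) * prob ((\<lambda>\<omega>. \<lambda>i\<in>{q}. I i \<omega>) -` D \<inter> space M)"
    by (intro indep_varD[OF iv])
  moreover have Deq: "(\<lambda>\<omega>. \<lambda>i\<in>{q}. I i \<omega>) -` D \<inter> space M = (\<lambda>\<omega>. B t \<omega> - B s \<omega>) -` E \<inter> space M"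
    by (auto simp: D_def space_PiM I_def \<tau>_def)
  define A' where "A' = {\<omega>\<in>space M. \<forall>u\<in>J. B u \<omega> - B 0 \<omega> \<in> S u}"
  have Ceq: "(\<lambda>\<omega>. \<lambda>i\<in>{..<q}. I i \<omega>) -` C \<inter> space M = A'"
  proof -
    have "(\<Sum>j<idx u. (\<lambda>i\<in>{..<q}. I i \<omega>) j) = B u \<omega> - B 0 \<omega>" if "u \<in> J" for u \<omega>
    proof -
      have "(\<Sum>j<idx u. (\<lambda>i\<in>{..<q}. I i \<omega>) j) = (\<Sum>j<idx u. I j \<omega>)"
        using idx[OF that] by (intro sum.cong) auto
      then show ?thesis using tel[of _ "idx u"] idx[OF that] by (simp add: \<tau>_def)
    qed
    then show ?thesis by (auto simp: C_def A'_def space_PiM)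
  qed
  have "(\<lambda>\<omega>. (\<lambda>i\<in>{..<q}. I i \<omega>, \<lambda>i\<in>{q}. I i \<omega>)) -` (C \<times> D) \<inter> space M
      = A' \<inter> ((\<lambda>\<omega>. B t \<omega> - B s \<omega>) -` E \<inter> space M)"
    using Deq Ceq by auto
  ultimately have eq: "prob (A' \<inter> ((\<lambda>\<omega>. B t \<omega> - B s \<omega>) -` E \<inter> space M)) =
      prob A' * prob ((\<lambda>\<omega>. B t \<omega> - B s \<omega>) -` E \<inter> space M)"
    using Deq Ceq by simp
  let ?A = "{\<omega>\<in>space M. \<forall>u\<in>J. B u \<omega> \<in> S u}" and ?E = "(\<lambda>\<omega>. B t \<omega> - B s \<omega>) -` E \<inter> space M"
  have *: "{\<omega>\<in>space M. X \<omega> \<in> S u} \<in> sets M" if "X \<in> borel_measurable M" for X :: "'w \<Rightarrow> 'a" and u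
    using measurable_sets[OF that S[of u]] by (simp add: vimage_def Int_def conj_commute)
  have Bm: "B u \<in> borel_measurable M" if "u \<in> J \<or> u \<in> {0, s, t}" for u
    using that J st by (intro measurable_B) auto
  have "?A \<in> sets M"
    using Bm by (intro sets.sets_Collect_finite_All J(1) *) auto
  moreover have "A' \<in> sets M" unfolding A'_def
  proof (intro sets.sets_Collect_finite_All J(1))
    fix u assume "u \<in> J"
    then have "(\<lambda>\<omega>. B u \<omega> - B 0 \<omega>) \<in> borel_measurable M" using Bm by (intro borel_measurable_diff) auto
    then show "{\<omega>\<in>space M. B u \<omega> - B 0 \<omega> \<in> S u} \<in> sets M" by (rule *)
  qed
  moreover have "?E \<in> sets M"
    using Bm E by (intro measurable_sets[of _ M borel] borel_measurable_diff) auto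
  moreover have "AE \<omega> in M. \<omega> \<in> ?A \<longleftrightarrow> \<omega> \<in> A'"
    using start_zero by eventually_elim (simp add: A'_def)
  ultimately have "prob (?A \<inter> ?E) = prob (A' \<inter> ?E)" "prob ?A = prob A'"
    by (auto intro!: finite_measure_eq_AE)
  then show ?thesis using eq by simp
qed

text \<open>Cylinder events and null sets together form a generator of the augmented filtration that is
  closed under intersection, so independence extends to the generated sigma-algebra.\<close>

lemma increment_indep_past:
  assumes st: "0 \<le> s" "s < t" and A: "A \<in> sets (F s)" and E: "E \<in> sets borel"
  shows "prob (A \<inter> ((\<lambda>\<omega>. B t \<omega> - B s \<omega>) -` E \<inter> space M)) = prob A * prob ((\<lambda>\<omega>. B t \<omega> - B s \<omega>) -` E \<inter> space M)"
proof -
  define cyl where "cyl J S = {\<omega>\<in>space M. \<forall>u\<in>J. B u \<omega> \<in> S u}" for J :: "real set" and S :: "real \<Rightarrow> 'a set"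
  define P where "P = {cyl J S | J S. finite J \<and> J \<subseteq> {0..s} \<and> (\<forall>u. S u \<in> sets borel)}"
  define G where "G = P \<union> null_sets M"
  define D where "D = {(\<lambda>\<omega>. B t \<omega> - B s \<omega>) -` E \<inter> space M | E. E \<in> sets borel}"
  have dB: "(\<lambda>\<omega>. B t \<omega> - B s \<omega>) \<in> borel_measurable M"
    using st by (intro borel_measurable_diff measurable_B) auto
  have D: "D \<subseteq> sets M" using measurable_sets[OF dB] by (auto simp: D_def)
  have cyl: "cyl J S \<in> sets M" if "finite J" "J \<subseteq> {0..s}" "\<forall>u. S u \<in> sets borel" for J S
    unfolding cyl_def
  proof (intro sets.sets_Collect_finite_All that(1))
    fix u assume "u \<in> J"
    then have "B u \<in> borel_measurable M" using that by (intro measurable_B) auto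
    from measurable_sets[OF this that(3)[rule_format, of u]]
    show "{\<omega>\<in>space M. B u \<omega> \<in> S u} \<in> sets M" by (simp add: vimage_def Int_def conj_commute)
  qed
  have G: "G \<subseteq> sets M" using cyl by (auto simp: G_def P_def)
  have "indep_set G D"
  proof (rule indep_setI[OF G D])
    fix a d assume a: "a \<in> G" and d: "d \<in> D"
    show "prob (a \<inter> d) = prob a * prob d"
    proof (cases "a \<in> P")
      case True
      then show ?thesis
        using d increment_indep_cylinder[OF _ _ st] by (auto simp: P_def D_def cyl_def)
    next
      case False
      then have a: "a \<in> null_sets M" using a by (simp add: G_def)
      then have "a \<inter> d \<in> null_sets M" using d D by (intro null_set_Int2) auto
      then show ?thesis using a by (simp add: measure_def null_setsD1)
    qed
  qed
  moreover have "Int_stable G"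
  proof (rule Int_stableI)
    fix a b assume ab: "a \<in> G" "b \<in> G"
    show "a \<inter> b \<in> G"
    proof (cases "a \<in> null_sets M \<or> b \<in> null_sets M")
      case True
      then show ?thesis using ab G by (auto simp: G_def Int_commute intro: null_set_Int2 null_set_Int1)
    next
      case False
      then obtain J S J' S' where a: "a = cyl J S" "finite J" "J \<subseteq> {0..s}" "\<forall>u. S u \<in> sets borel"
        and b: "b = cyl J' S'" "finite J'" "J' \<subseteq> {0..s}" "\<forall>u. S' u \<in> sets borel"
        using ab by (auto simp: G_def P_def)
      have "a \<inter> b = cyl (J \<union> J') (\<lambda>u. (if u \<in> J then S u else UNIV) \<inter> (if u \<in> J' then S' u else UNIV))"
        unfolding a(1) b(1) by (auto simp: cyl_def split: if_splits)
      moreover have "\<forall>u. (if u \<in> J then S u else UNIV) \<inter> (if u \<in> J' then S' u else UNIV) \<in> sets borel"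
        using a b by auto
      ultimately show ?thesis using a b unfolding G_def P_def by blast
    qed
  qed
  moreover have "Int_stable D"
  proof (rule Int_stableI)
    fix a b assume "a \<in> D" "b \<in> D"
    then obtain E E' where "E \<in> sets borel" "E' \<in> sets borel"
      "a = (\<lambda>\<omega>. B t \<omega> - B s \<omega>) -` E \<inter> space M" "b = (\<lambda>\<omega>. B t \<omega> - B s \<omega>) -` E' \<inter> space M"
      by (auto simp: D_def)
    then show "a \<inter> b \<in> D" unfolding D_def by (intro CollectI exI[of _ "E \<inter> E'"]) auto
  qed
  ultimately have ind: "indep_set (sigma_sets (space M) G) (sigma_sets (space M) D)"
    by (rule indep_set_sigma_sets)
  have "sets (F s) \<subseteq> sigma_sets (space M) G"
    unfolding sets_F
  proof (rule sigma_sets_mono', safe)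
    fix u S assume u: "0 \<le> u" "u \<le> s" and S: "S \<in> sets (borel :: 'a measure)"
    have "B u -` S \<inter> space M = cyl {u} (\<lambda>_. S)" by (auto simp: cyl_def)
    then show "B u -` S \<inter> space M \<in> G" using u S unfolding G_def P_def by (intro UnI1 CollectI exI[of _ "{u}"] exI[of _ "\<lambda>_. S"]) auto
  qed (simp add: G_def)
  then have "A \<in> sigma_sets (space M) G" using A by blast
  moreover have "(\<lambda>\<omega>. B t \<omega> - B s \<omega>) -` E \<inter> space M \<in> sigma_sets (space M) D"
    using E by (auto simp: D_def)
  ultimately show ?thesis by (rule indep_setD[OF ind])
qed

lemma indep_var_past_increment:
  fixes U :: "'w \<Rightarrow> real" and g :: "'a \<Rightarrow> real"
  assumes st: "0 \<le> s" "s < t" and U: "U \<in> borel_measurable (F s)" and g: "g \<in> borel_measurable borel"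
  shows "indep_var borel U borel (\<lambda>\<omega>. g (B t \<omega> - B s \<omega>))"
proof -
  let ?d = "\<lambda>\<omega>. g (B t \<omega> - B s \<omega>)"
  have dB: "?d \<in> borel_measurable M"
    using st by (intro measurable_compose[OF _ g] borel_measurable_diff measurable_B) auto
  have UM: "U \<in> borel_measurable M" using U by (rule measurable_F)
  have stable: "Int_stable {X -` A \<inter> space M |A. A \<in> sets (borel :: real measure)}" for X :: "'w \<Rightarrow> real"
  proof (rule Int_stableI)
    fix a b assume "a \<in> {X -` A \<inter> space M |A. A \<in> sets borel}" "b \<in> {X -` A \<inter> space M |A. A \<in> sets borel}"
    then obtain A A' where "A \<in> sets borel" "A' \<in> sets borel" "a = X -` A \<inter> space M" "b = X -` A' \<inter> space M" by auto
    then show "a \<inter> b \<in> {X -` A \<inter> space M |A. A \<in> sets borel}" by (intro CollectI exI[of _ "A \<inter> A'"]) auto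
  qed
  have "indep_set {U -` A \<inter> space M |A. A \<in> sets borel} {?d -` A \<inter> space M |A. A \<in> sets borel}"
  proof (rule indep_setI)
    fix a b assume "a \<in> {U -` A \<inter> space M |A. A \<in> sets borel}" and b: "b \<in> {?d -` A \<inter> space M |A. A \<in> sets borel}"
    then have a: "a \<in> sets (F s)" using measurable_sets[OF U] by auto
    obtain A where A: "A \<in> sets borel" "b = ?d -` A \<inter> space M" using b by auto
    have "b = (\<lambda>\<omega>. B t \<omega> - B s \<omega>) -` (g -` A) \<inter> space M" using A(2) by auto
    moreover have "g -` A \<in> sets borel" using measurable_sets[OF g A(1)] by simp
    ultimately show "prob (a \<inter> b) = prob a * prob b" using increment_indep_past[OF st a] by simp
  qed (use measurable_sets[OF UM] measurable_sets[OF dB] in auto)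
  then have "indep_set (sigma_sets (space M) {U -` A \<inter> space M |A. A \<in> sets borel})
      (sigma_sets (space M) {?d -` A \<inter> space M |A. A \<in> sets borel})"
    by (rule indep_set_sigma_sets) (rule stable)+
  then show ?thesis using UM dB by (simp add: indep_var_eq)
qed

section \<open>Discrete stochastic integrals\<close>

abbreviation incr :: "real \<Rightarrow> real \<Rightarrow> 'w \<Rightarrow> 'a" where
  "incr s t \<omega> \<equiv> B t \<omega> - B s \<omega>"

lemma incr_measurable_F: "0 \<le> s \<Longrightarrow> s \<le> t \<Longrightarrow> incr s t \<in> borel_measurable (F t)"
  by (intro borel_measurable_diff B_measurable_F) auto

lemma incr_measurable: "0 \<le> s \<Longrightarrow> s \<le> t \<Longrightarrow> incr s t \<in> borel_measurable M"
  by (intro borel_measurable_diff measurable_B) auto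

lemma past_times_increment:
  fixes U :: "'w \<Rightarrow> real"
  assumes st: "0 \<le> s" "s < t" and U: "U \<in> borel_measurable (F s)" "integrable M U"
  shows past_times_increment_integrable: "integrable M (\<lambda>\<omega>. U \<omega> * (incr s t \<omega> \<bullet> e))"
    and past_times_increment_mean: "expectation (\<lambda>\<omega>. U \<omega> * (incr s t \<omega> \<bullet> e)) = 0"
    and past_times_square_integrable: "integrable M (\<lambda>\<omega>. U \<omega> * (norm (incr s t \<omega>))\<^sup>2)"
    and past_times_square_mean: "(\<And>\<omega>. 0 \<le> U \<omega>) \<Longrightarrow>
      expectation (\<lambda>\<omega>. U \<omega> * (norm (incr s t \<omega>))\<^sup>2) \<le> expectation U * (real DIM('a) * (t - s))"
proof -
  have g: "centered_gaussian M (t - s) (incr s t)" and v: "t - s > 0" using gaussian_increments st by auto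
  note G = gaussian_moments[OF g v]
  have ind: "indep_var borel U borel (\<lambda>\<omega>. incr s t \<omega> \<bullet> e)"
    by (rule indep_var_past_increment[OF st U(1), of "\<lambda>z. z \<bullet> e"]) measurable
  have ind2: "indep_var borel U borel (\<lambda>\<omega>. (norm (incr s t \<omega>))\<^sup>2)"
    by (rule indep_var_past_increment[OF st U(1), of "\<lambda>z. (norm z)\<^sup>2"]) measurable
  show "integrable M (\<lambda>\<omega>. U \<omega> * (incr s t \<omega> \<bullet> e))"
    by (rule indep_var_integrable[OF ind U(2) G(6)])
  show "expectation (\<lambda>\<omega>. U \<omega> * (incr s t \<omega> \<bullet> e)) = 0"
    using indep_var_lebesgue_integral[OF ind U(2) G(6)] G(7) by simp
  show "integrable M (\<lambda>\<omega>. U \<omega> * (norm (incr s t \<omega>))\<^sup>2)"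
    by (rule indep_var_integrable[OF ind2 U(2) G(2)])
  show "expectation (\<lambda>\<omega>. U \<omega> * (norm (incr s t \<omega>))\<^sup>2) \<le> expectation U * (real DIM('a) * (t - s))"
    if "\<And>\<omega>. 0 \<le> U \<omega>"
    using indep_var_lebesgue_integral[OF ind2 U(2) G(2)] G(3) that
    by (simp add: mult_left_mono)
qed

lemma integrable_product_of_squares:
  fixes f g :: "'w \<Rightarrow> real"
  assumes "f \<in> borel_measurable M" "g \<in> borel_measurable M"
    and "integrable M (\<lambda>\<omega>. (f \<omega>)\<^sup>2)" "integrable M (\<lambda>\<omega>. (g \<omega>)\<^sup>2)"
  shows "integrable M (\<lambda>\<omega>. f \<omega> * g \<omega>)"
proof (rule Bochner_Integration.integrable_bound)
  show "integrable M (\<lambda>\<omega>. (f \<omega>)\<^sup>2 + (g \<omega>)\<^sup>2)" using assms by simp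
  have "\<bar>x * y\<bar> \<le> x\<^sup>2 + y\<^sup>2" for x y :: real
  proof -
    have "2 * (\<bar>x\<bar> * \<bar>y\<bar>) \<le> x\<^sup>2 + y\<^sup>2" using sum_squares_bound[of "\<bar>x\<bar>" "\<bar>y\<bar>"] by (simp add: mult.assoc)
    moreover have "0 \<le> \<bar>x\<bar> * \<bar>y\<bar>" by simp
    ultimately show ?thesis unfolding abs_mult by linarith
  qed
  then show "AE \<omega> in M. norm (f \<omega> * g \<omega>) \<le> norm ((f \<omega>)\<^sup>2 + (g \<omega>)\<^sup>2)" by simp
qed (use assms in measurable)

lemma integrable_sum_square:
  fixes f g :: "'w \<Rightarrow> real"
  assumes "f \<in> borel_measurable M" "g \<in> borel_measurable M"
    and "integrable M (\<lambda>\<omega>. (f \<omega>)\<^sup>2)" "integrable M (\<lambda>\<omega>. (g \<omega>)\<^sup>2)"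
  shows "integrable M (\<lambda>\<omega>. (f \<omega> + g \<omega>)\<^sup>2)"
    and "expectation (\<lambda>\<omega>. (f \<omega> + g \<omega>)\<^sup>2) =
      expectation (\<lambda>\<omega>. (f \<omega>)\<^sup>2) + 2 * expectation (\<lambda>\<omega>. f \<omega> * g \<omega>) + expectation (\<lambda>\<omega>. (g \<omega>)\<^sup>2)"
proof -
  have eq: "(\<lambda>\<omega>. (f \<omega> + g \<omega>)\<^sup>2) = (\<lambda>\<omega>. (f \<omega>)\<^sup>2 + 2 * (f \<omega> * g \<omega>) + (g \<omega>)\<^sup>2)"
    by (simp add: fun_eq_iff power2_sum)
  note i = integrable_product_of_squares[OF assms]
  show "integrable M (\<lambda>\<omega>. (f \<omega> + g \<omega>)\<^sup>2)" unfolding eq using i assms by simp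
  show "expectation (\<lambda>\<omega>. (f \<omega> + g \<omega>)\<^sup>2) =
      expectation (\<lambda>\<omega>. (f \<omega>)\<^sup>2) + 2 * expectation (\<lambda>\<omega>. f \<omega> * g \<omega>) + expectation (\<lambda>\<omega>. (g \<omega>)\<^sup>2)"
    unfolding eq using i assms by simp
qed

lemma past_inner_increment:
  fixes U :: "'w \<Rightarrow> real" and H :: "'w \<Rightarrow> 'a"
  assumes st: "0 \<le> s" "s < t"
    and U: "U \<in> borel_measurable (F s)" "integrable M (\<lambda>\<omega>. (U \<omega>)\<^sup>2)"
    and H: "H \<in> borel_measurable (F s)" "integrable M (\<lambda>\<omega>. (norm (H \<omega>))\<^sup>2)"
  shows "integrable M (\<lambda>\<omega>. U \<omega> * (H \<omega> \<bullet> incr s t \<omega>))"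
    and "expectation (\<lambda>\<omega>. U \<omega> * (H \<omega> \<bullet> incr s t \<omega>)) = 0"
proof -
  have [measurable]: "U \<in> borel_measurable M" "H \<in> borel_measurable M"
    using U H measurable_F by auto
  have Ub: "(\<lambda>\<omega>. U \<omega> * (H \<omega> \<bullet> b)) \<in> borel_measurable (F s)" for b
    using U(1) H(1) by measurable
  have Ui: "integrable M (\<lambda>\<omega>. U \<omega> * (H \<omega> \<bullet> b))" if "b \<in> Basis" for b
  proof (rule integrable_product_of_squares)
    show "integrable M (\<lambda>\<omega>. (H \<omega> \<bullet> b)\<^sup>2)"
      by (rule Bochner_Integration.integrable_bound[OF H(2)])
        (use that in \<open>auto simp: abs_le_square_iff[symmetric] intro!: Basis_le_norm\<close>)
  qed (use U in auto)
  have eq: "U \<omega> * (H \<omega> \<bullet> incr s t \<omega>) = (\<Sum>b\<in>Basis. U \<omega> * (H \<omega> \<bullet> b) * (incr s t \<omega> \<bullet> b))" for \<omega>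
    by (subst euclidean_inner) (simp add: sum_distrib_left mult.assoc)
  show "integrable M (\<lambda>\<omega>. U \<omega> * (H \<omega> \<bullet> incr s t \<omega>))"
    unfolding eq by (intro Bochner_Integration.integrable_sum past_times_increment_integrable[OF st Ub Ui])
  show "expectation (\<lambda>\<omega>. U \<omega> * (H \<omega> \<bullet> incr s t \<omega>)) = 0"
    unfolding eq
    by (subst Bochner_Integration.integral_sum)
      (auto intro!: past_times_increment_integrable[OF st Ub Ui] sum.neutral past_times_increment_mean[OF st Ub Ui])
qed

text \<open>The Cauchy-Schwarz inequality loses the dimension against the exact isometry, whose factor is
  \<open>t - s\<close>. The final constant leaves room for this loss.\<close>

lemma inner_increment_square:
  fixes H :: "'w \<Rightarrow> 'a"
  assumes st: "0 \<le> s" "s < t"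
    and H: "H \<in> borel_measurable (F s)" "integrable M (\<lambda>\<omega>. (norm (H \<omega>))\<^sup>2)"
  shows "integrable M (\<lambda>\<omega>. (H \<omega> \<bullet> incr s t \<omega>)\<^sup>2)"
    and "expectation (\<lambda>\<omega>. (H \<omega> \<bullet> incr s t \<omega>)\<^sup>2) \<le> expectation (\<lambda>\<omega>. (norm (H \<omega>))\<^sup>2) * (real DIM('a) * (t - s))"
proof -
  have [measurable]: "H \<in> borel_measurable M" "incr s t \<in> borel_measurable M"
    using H measurable_F incr_measurable st by auto
  have Hm: "(\<lambda>\<omega>. (norm (H \<omega>))\<^sup>2) \<in> borel_measurable (F s)" using H(1) by measurable
  have le: "(H \<omega> \<bullet> incr s t \<omega>)\<^sup>2 \<le> (norm (H \<omega>))\<^sup>2 * (norm (incr s t \<omega>))\<^sup>2" for \<omega>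
    using Cauchy_Schwarz_ineq[of "H \<omega>" "incr s t \<omega>"] by (simp add: power2_norm_eq_inner)
  note P = past_times_square_integrable[OF st Hm H(2)]
  show i: "integrable M (\<lambda>\<omega>. (H \<omega> \<bullet> incr s t \<omega>)\<^sup>2)"
    by (rule Bochner_Integration.integrable_bound[OF P]) (use le in auto)
  have "expectation (\<lambda>\<omega>. (H \<omega> \<bullet> incr s t \<omega>)\<^sup>2) \<le> expectation (\<lambda>\<omega>. (norm (H \<omega>))\<^sup>2 * (norm (incr s t \<omega>))\<^sup>2)"
    using i P le by (intro integral_mono)
  also have "\<dots> \<le> expectation (\<lambda>\<omega>. (norm (H \<omega>))\<^sup>2) * (real DIM('a) * (t - s))"
    by (rule past_times_square_mean[OF st Hm H(2)]) simp
  finally show "expectation (\<lambda>\<omega>. (H \<omega> \<bullet> incr s t \<omega>)\<^sup>2) \<le> expectation (\<lambda>\<omega>. (norm (H \<omega>))\<^sup>2) * (real DIM('a) * (t - s))" .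
qed

text \<open>The discrete stochastic integral of \<open>H\<close> with respect to \<open>B\<close>.\<close>

definition mart_sum :: "(nat \<Rightarrow> 'w \<Rightarrow> 'a) \<Rightarrow> (nat \<Rightarrow> real) \<Rightarrow> nat \<Rightarrow> 'w \<Rightarrow> real" where
  "mart_sum H \<tau> p \<omega> = (\<Sum>i<p. H i \<omega> \<bullet> incr (\<tau> i) (\<tau> (Suc i)) \<omega>)"

text \<open>Cross terms have mean zero, since each increment is centred and independent of the past.\<close>

lemma mart_sum:
  assumes \<tau>: "0 \<le> \<tau> 0" "strict_mono \<tau>"
    and H: "\<And>i. H i \<in> borel_measurable (F (\<tau> i))" "\<And>i. integrable M (\<lambda>\<omega>. (norm (H i \<omega>))\<^sup>2)"
  shows mart_sum_measurable_F: "mart_sum H \<tau> p \<in> borel_measurable (F (\<tau> p))"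
    and mart_sum_measurable: "mart_sum H \<tau> p \<in> borel_measurable M"
    and mart_sum_integrable: "integrable M (\<lambda>\<omega>. (mart_sum H \<tau> p \<omega>)\<^sup>2)"
    and mart_sum_mean: "expectation (mart_sum H \<tau> p) = 0"
    and mart_sum_variance: "expectation (\<lambda>\<omega>. (mart_sum H \<tau> p \<omega>)\<^sup>2)
      \<le> (\<Sum>i<p. expectation (\<lambda>\<omega>. (norm (H i \<omega>))\<^sup>2) * (real DIM('a) * (\<tau> (Suc i) - \<tau> i)))"
proof -
  have \<tau>i: "0 \<le> \<tau> i" "\<tau> i < \<tau> (Suc i)" for i
    using \<tau> strict_mono_leD[OF \<tau>(2), of 0 i] by (auto simp: strict_mono_Suc_iff)
  have main: "mart_sum H \<tau> p \<in> borel_measurable (F (\<tau> p)) \<and> integrable M (\<lambda>\<omega>. (mart_sum H \<tau> p \<omega>)\<^sup>2) \<and>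
     expectation (\<lambda>\<omega>. mart_sum H \<tau> p \<omega>) = 0 \<and> expectation (\<lambda>\<omega>. (mart_sum H \<tau> p \<omega>)\<^sup>2)
      \<le> (\<Sum>i<p. expectation (\<lambda>\<omega>. (norm (H i \<omega>))\<^sup>2) * (real DIM('a) * (\<tau> (Suc i) - \<tau> i)))"
  proof (induction p)
    case 0
    then show ?case by (simp add: mart_sum_def[abs_def])
  next
    case (Suc p)
    let ?S = "mart_sum H \<tau> p" and ?d = "\<lambda>\<omega>. H p \<omega> \<bullet> incr (\<tau> p) (\<tau> (Suc p)) \<omega>"
    have S: "?S \<in> borel_measurable (F (\<tau> p))" "integrable M (\<lambda>\<omega>. (?S \<omega>)\<^sup>2)" "expectation (\<lambda>\<omega>. ?S \<omega>) = 0"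
      and V: "expectation (\<lambda>\<omega>. (?S \<omega>)\<^sup>2) \<le> (\<Sum>i<p. expectation (\<lambda>\<omega>. (norm (H i \<omega>))\<^sup>2) * (real DIM('a) * (\<tau> (Suc i) - \<tau> i)))"
      using Suc by auto
    have eq: "mart_sum H \<tau> (Suc p) = (\<lambda>\<omega>. ?S \<omega> + ?d \<omega>)" by (simp add: mart_sum_def fun_eq_iff)
    note sq = inner_increment_square[OF \<tau>i(1)[of p] \<tau>i(2)[of p] H(1)[of p] H(2)[of p]]
    note U = past_inner_increment[OF \<tau>i(1)[of p] \<tau>i(2)[of p] S(1,2) H(1)[of p] H(2)[of p]]
    note U1 = past_inner_increment[OF \<tau>i(1)[of p] \<tau>i(2)[of p] _ _ H(1)[of p] H(2)[of p], of "\<lambda>_. 1", simplified]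
    have [measurable]: "?S \<in> borel_measurable M" using S(1) by (rule measurable_F)
    have dm: "?d \<in> borel_measurable (F (\<tau> (Suc p)))"
      using \<tau>i measurable_F_mono[OF less_imp_le[OF \<tau>i(2)] H(1)] incr_measurable_F[OF \<tau>i(1), of p "\<tau> (Suc p)"]
      by (intro borel_measurable_inner) (auto simp: less_imp_le)
    then have [measurable]: "?d \<in> borel_measurable M" by (rule measurable_F)
    have "mart_sum H \<tau> (Suc p) \<in> borel_measurable (F (\<tau> (Suc p)))"
      unfolding eq using dm measurable_F_mono[OF less_imp_le[OF \<tau>i(2)] S(1)] by (intro borel_measurable_add)
    moreover have "integrable M (\<lambda>\<omega>. (mart_sum H \<tau> (Suc p) \<omega>)\<^sup>2)"
      unfolding eq by (rule integrable_sum_square) (use S sq in measurable)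
    moreover have "expectation (\<lambda>\<omega>. mart_sum H \<tau> (Suc p) \<omega>) = 0"
      unfolding eq using square_integrable_imp_integrable[OF _ S(2)] S(3) U1 by simp
    moreover have "expectation (\<lambda>\<omega>. (?S \<omega> + ?d \<omega>)\<^sup>2) = expectation (\<lambda>\<omega>. (?S \<omega>)\<^sup>2) + expectation (\<lambda>\<omega>. (?d \<omega>)\<^sup>2)"
      by (subst integrable_sum_square(2)) (use S sq U in auto)
    ultimately show ?case using V sq(2) unfolding eq by simp
  qed
  then show "mart_sum H \<tau> p \<in> borel_measurable (F (\<tau> p))" "integrable M (\<lambda>\<omega>. (mart_sum H \<tau> p \<omega>)\<^sup>2)"
    "expectation (mart_sum H \<tau> p) = 0" "expectation (\<lambda>\<omega>. (mart_sum H \<tau> p \<omega>)\<^sup>2)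
      \<le> (\<Sum>i<p. expectation (\<lambda>\<omega>. (norm (H i \<omega>))\<^sup>2) * (real DIM('a) * (\<tau> (Suc i) - \<tau> i)))" by auto
  then show "mart_sum H \<tau> p \<in> borel_measurable M" by (auto intro: measurable_F)
qed

definition quad_sum :: "(nat \<Rightarrow> real) \<Rightarrow> nat \<Rightarrow> 'w \<Rightarrow> real" where
  "quad_sum \<tau> p \<omega> = (\<Sum>i<p. (norm (incr (\<tau> i) (\<tau> (Suc i)) \<omega>))\<^sup>2)"

text \<open>Only the leading term of the second moment survives a refinement of the grid, because the sum
  of the squared steps tends to 0.\<close>

lemma quad_sum:
  assumes \<tau>: "0 \<le> \<tau> 0" "strict_mono \<tau>"
  shows quad_sum_measurable: "quad_sum \<tau> p \<in> borel_measurable M"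
    and quad_sum_integrable: "integrable M (\<lambda>\<omega>. (quad_sum \<tau> p \<omega>)\<^sup>2)"
    and quad_sum_mean: "expectation (quad_sum \<tau> p) \<le> real DIM('a) * (\<tau> p - \<tau> 0)"
    and quad_sum_variance: "expectation (\<lambda>\<omega>. (quad_sum \<tau> p \<omega>)\<^sup>2) \<le> (real DIM('a) * (\<tau> p - \<tau> 0))\<^sup>2
      + 32 * 2 powr (real DIM('a) / 2) * (\<Sum>i<p. (\<tau> (Suc i) - \<tau> i)\<^sup>2)"
proof -
  let ?n = "real DIM('a)"
  have \<tau>i: "0 \<le> \<tau> i" "\<tau> i < \<tau> (Suc i)" "\<tau> 0 \<le> \<tau> i" for i
    using \<tau> strict_mono_leD[OF \<tau>(2), of 0 i] by (auto simp: strict_mono_Suc_iff)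
  have nonneg: "0 \<le> quad_sum \<tau> p \<omega>" for p \<omega> by (simp add: quad_sum_def sum_nonneg)
  have main: "quad_sum \<tau> p \<in> borel_measurable (F (\<tau> p)) \<and> integrable M (\<lambda>\<omega>. (quad_sum \<tau> p \<omega>)\<^sup>2) \<and>
     expectation (\<lambda>\<omega>. quad_sum \<tau> p \<omega>) \<le> ?n * (\<tau> p - \<tau> 0) \<and> expectation (\<lambda>\<omega>. (quad_sum \<tau> p \<omega>)\<^sup>2)
      \<le> (?n * (\<tau> p - \<tau> 0))\<^sup>2 + 32 * 2 powr (?n / 2) * (\<Sum>i<p. (\<tau> (Suc i) - \<tau> i)\<^sup>2)"
  proof (induction p)
    case 0
    then show ?case by (simp add: quad_sum_def[abs_def])
  next
    case (Suc p)
    let ?S = "quad_sum \<tau> p" and ?d = "\<lambda>\<omega>. (norm (incr (\<tau> p) (\<tau> (Suc p)) \<omega>))\<^sup>2"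
    let ?C = "32 * 2 powr (?n / 2)" and ?h = "\<tau> (Suc p) - \<tau> p"
    have S: "?S \<in> borel_measurable (F (\<tau> p))" "integrable M (\<lambda>\<omega>. (?S \<omega>)\<^sup>2)" "expectation (\<lambda>\<omega>. ?S \<omega>) \<le> ?n * (\<tau> p - \<tau> 0)"
      and V: "expectation (\<lambda>\<omega>. (?S \<omega>)\<^sup>2) \<le> (?n * (\<tau> p - \<tau> 0))\<^sup>2 + ?C * (\<Sum>i<p. (\<tau> (Suc i) - \<tau> i)\<^sup>2)"
      using Suc by auto
    have eq: "quad_sum \<tau> (Suc p) = (\<lambda>\<omega>. ?S \<omega> + ?d \<omega>)" by (simp add: quad_sum_def fun_eq_iff)
    have g: "centered_gaussian M ?h (incr (\<tau> p) (\<tau> (Suc p)))" and v: "?h > 0" using gaussian_increments \<tau>i by auto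
    note G = gaussian_moments[OF g v]
    have [measurable]: "?S \<in> borel_measurable M" using S(1) by (rule measurable_F)
    have Si: "integrable M ?S" using square_integrable_imp_integrable[OF _ S(2)] by simp
    have dm: "?d \<in> borel_measurable (F (\<tau> (Suc p)))"
      using incr_measurable_F[OF \<tau>i(1), of p "\<tau> (Suc p)"] \<tau>i
      by (intro borel_measurable_power measurable_compose[OF _ borel_measurable_norm]) (auto simp: less_imp_le)
    then have [measurable]: "?d \<in> borel_measurable M" by (rule measurable_F)
    have "quad_sum \<tau> (Suc p) \<in> borel_measurable (F (\<tau> (Suc p)))"
      unfolding eq using dm measurable_F_mono[OF less_imp_le[OF \<tau>i(2)] S(1)] by (intro borel_measurable_add)
    moreover have "integrable M (\<lambda>\<omega>. (quad_sum \<tau> (Suc p) \<omega>)\<^sup>2)"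
      unfolding eq by (rule integrable_sum_square) (use S G in measurable)
    moreover have "expectation (\<lambda>\<omega>. quad_sum \<tau> (Suc p) \<omega>) \<le> ?n * (\<tau> (Suc p) - \<tau> 0)"
      unfolding eq using Si G S(3) by (simp add: algebra_simps)
    moreover have "expectation (\<lambda>\<omega>. (?S \<omega> + ?d \<omega>)\<^sup>2) \<le> (?n * (\<tau> (Suc p) - \<tau> 0))\<^sup>2 + ?C * (\<Sum>i<Suc p. (\<tau> (Suc i) - \<tau> i)\<^sup>2)"
    proof -
      have "expectation (\<lambda>\<omega>. ?S \<omega> * ?d \<omega>) \<le> expectation ?S * (?n * ?h)"
        by (rule past_times_square_mean[OF \<tau>i(1,2) S(1) Si]) (rule nonneg)
      also have "\<dots> \<le> (?n * (\<tau> p - \<tau> 0)) * (?n * ?h)" using S(3) v by (intro mult_right_mono) auto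
      finally have c: "expectation (\<lambda>\<omega>. ?S \<omega> * ?d \<omega>) \<le> (?n * (\<tau> p - \<tau> 0)) * (?n * ?h)" .
      have "expectation (\<lambda>\<omega>. (?S \<omega> + ?d \<omega>)\<^sup>2) = expectation (\<lambda>\<omega>. (?S \<omega>)\<^sup>2) + 2 * expectation (\<lambda>\<omega>. ?S \<omega> * ?d \<omega>) + expectation (\<lambda>\<omega>. (?d \<omega>)\<^sup>2)"
        by (rule integrable_sum_square(2)) (use S G in measurable)
      also have "\<dots> \<le> (?n * (\<tau> p - \<tau> 0))\<^sup>2 + ?C * (\<Sum>i<p. (\<tau> (Suc i) - \<tau> i)\<^sup>2) + 2 * ((?n * (\<tau> p - \<tau> 0)) * (?n * ?h)) + ?C * ?h\<^sup>2"
        using V c G(5) by (intro add_mono mult_left_mono) auto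
      also have "\<dots> \<le> (?n * (\<tau> p - \<tau> 0))\<^sup>2 + 2 * ((?n * (\<tau> p - \<tau> 0)) * (?n * ?h)) + (?n * ?h)\<^sup>2 + ?C * (\<Sum>i<Suc p. (\<tau> (Suc i) - \<tau> i)\<^sup>2)"
        by (simp add: algebra_simps)
      also have "(?n * (\<tau> p - \<tau> 0))\<^sup>2 + 2 * ((?n * (\<tau> p - \<tau> 0)) * (?n * ?h)) + (?n * ?h)\<^sup>2 = (?n * (\<tau> (Suc p) - \<tau> 0))\<^sup>2"
        by (simp add: power2_eq_square algebra_simps)
      finally show ?thesis .
    qed
    ultimately show ?case unfolding eq by blast
  qed
  then show "integrable M (\<lambda>\<omega>. (quad_sum \<tau> p \<omega>)\<^sup>2)"
    "expectation (quad_sum \<tau> p) \<le> ?n * (\<tau> p - \<tau> 0)" "expectation (\<lambda>\<omega>. (quad_sum \<tau> p \<omega>)\<^sup>2)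
      \<le> (?n * (\<tau> p - \<tau> 0))\<^sup>2 + 32 * 2 powr (?n / 2) * (\<Sum>i<p. (\<tau> (Suc i) - \<tau> i)\<^sup>2)" by auto
  show "quad_sum \<tau> p \<in> borel_measurable M" using main measurable_F by blast
qed

end

section \<open>Paths of the reflected diffusion\<close>

text \<open>This serves both finite-variation parts of the diffusion: for the drift \<open>l\<close> is
  Lebesgue measure, and for the boundary term it is the measure that carries the local time.\<close>

lemma increment_of_integral:
  fixes l :: "real measure" and g :: "real \<Rightarrow> 'a::euclidean_space"
  assumes l: "sets l = sets borel" "\<And>T. emeasure l {0..T} < \<infinity>"
    and g: "(\<lambda>u. indicator {0..} u *\<^sub>R g u) \<in> borel_measurable borel"
    and bound: "AE u in l. 0 \<le> u \<longrightarrow> norm (g u) \<le> C"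
    and st: "0 \<le> s" "s \<le> t"
  shows norm_increment_of_integral:
      "norm ((LINT u:{0..t}|l. g u) - (LINT u:{0..s}|l. g u)) \<le> C * (measure l {0..t} - measure l {0..s})"
    and inner_increment_of_integral:
      "(AE u in l. u \<in> {s..t} \<longrightarrow> c \<le> z \<bullet> g u) \<Longrightarrow>
        c * (measure l {0..t} - measure l {0..s}) \<le> z \<bullet> ((LINT u:{0..t}|l. g u) - (LINT u:{0..s}|l. g u))"
proof -
  let ?I = "\<lambda>A. LINT u:A|l. g u"
  have fin: "emeasure l A < \<infinity>" if "A \<in> sets borel" "A \<subseteq> {0..t}" for A
    by (rule le_less_trans[OF emeasure_mono[OF that(2)] l(2)]) (simp add: l(1))
  have gm: "(\<lambda>u. indicator A u *\<^sub>R g u) \<in> borel_measurable l" if "A \<in> sets borel" "A \<subseteq> {0..}" for A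
  proof -
    have "(\<lambda>u. indicator A u *\<^sub>R (indicator {0..} u *\<^sub>R g u)) \<in> borel_measurable borel"
      using g that by measurable
    moreover have "(\<lambda>u. indicator A u *\<^sub>R (indicator {0..} u *\<^sub>R g u)) = (\<lambda>u. indicator A u *\<^sub>R g u)"
      using that(2) by (auto simp: fun_eq_iff indicator_def)
    ultimately have "(\<lambda>u. indicator A u *\<^sub>R g u) \<in> borel_measurable borel" by (simp only:)
    then show ?thesis by (simp only: measurable_cong_sets[OF l(1) refl])
  qed
  have sub: "{0..t} \<subseteq> {0..}" by auto
  have int: "set_integrable l A g" if "A \<in> sets borel" "A \<subseteq> {0..t}" for A
    unfolding set_integrable_def
  proof (rule integrableI_bounded_set[of A _ _ C])
    show "AE x\<in>A in l. norm (indicator A x *\<^sub>R g x) \<le> C"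
      using bound by eventually_elim (use that(2) in \<open>auto simp: indicator_def\<close>)
  qed (use that l(1) fin gm[OF that(1) order.trans[OF that(2) sub]] in auto)
  have sub2: "{s<..t} \<subseteq> {0..t}" "{0..s} \<subseteq> {0..t}" using st by auto
  have split: "{0..t} = {0..s} \<union> {s<..t}" using st by auto
  have "?I {0..t} = ?I {0..s} + ?I {s<..t}"
    unfolding split using st by (intro set_integral_Un int) auto
  then have diff: "?I {0..t} - ?I {0..s} = ?I {s<..t}" by simp
  have "measure l {0..t} = measure l {0..s} + measure l {s<..t}"
    unfolding split using sub2 l(1) fin[of "{0..s}"] fin[of "{s<..t}"] by (intro measure_Union) auto
  then have meas: "measure l {0..t} - measure l {0..s} = measure l {s<..t}" by simp
  have int_const: "integrable l (\<lambda>u. c * indicator {s<..t} u)" "(\<integral>u. c * indicator {s<..t} u \<partial>l) = c * measure l {s<..t}" for c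
    using fin[of "{s<..t}"] sub2 l(1) by (auto simp: less_top)
  have i: "integrable l (\<lambda>u. indicator {s<..t} u *\<^sub>R g u)" using int[of "{s<..t}"] sub2 by (simp add: set_integrable_def)
  have "norm (?I {s<..t}) \<le> (\<integral>u. norm (indicator {s<..t} u *\<^sub>R g u) \<partial>l)"
    unfolding set_lebesgue_integral_def by (rule integral_norm_bound)
  also have "\<dots> \<le> (\<integral>u. C * indicator {s<..t} u \<partial>l)"
  proof (rule integral_mono_AE)
    show "AE u in l. norm (indicator {s<..t} u *\<^sub>R g u) \<le> C * indicator {s<..t} u"
      using bound by eventually_elim (use st in \<open>auto simp: indicator_def\<close>)
  qed (rule integrable_norm[OF i] int_const(1))+
  finally show "norm (?I {0..t} - ?I {0..s}) \<le> C * (measure l {0..t} - measure l {0..s})"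
    unfolding diff meas int_const .
  assume c: "AE u in l. u \<in> {s..t} \<longrightarrow> c \<le> z \<bullet> g u"
  have "(\<integral>u. c * indicator {s<..t} u \<partial>l) \<le> (\<integral>u. z \<bullet> (indicator {s<..t} u *\<^sub>R g u) \<partial>l)"
  proof (rule integral_mono_AE)
    show "AE u in l. c * indicator {s<..t} u \<le> z \<bullet> (indicator {s<..t} u *\<^sub>R g u)"
      using c by eventually_elim (auto simp: indicator_def)
  qed (rule integrable_inner_right[OF i] int_const(1))+
  also have "\<dots> = z \<bullet> ?I {s<..t}" unfolding set_lebesgue_integral_def using i by (rule integral_inner_right)
  finally show "c * (measure l {0..t} - measure l {0..s}) \<le> z \<bullet> (?I {0..t} - ?I {0..s})"
    unfolding diff meas int_const .
qed

text \<open>The point \<open>y + \<rho> \<nu>\<close> belongs to \<open>K\<close>, hence to the half-space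
  that \<open>\<nu>\<close> supports at \<open>x\<close>.\<close>

lemma inner_outer_unit_normal:
  fixes y :: "'a::euclidean_space"
  assumes "outer_unit_normal K x \<nu>" "cball y \<rho> \<subseteq> K" "0 \<le> \<rho>"
  shows "\<rho> \<le> (x - y) \<bullet> \<nu>"
proof -
  have \<nu>: "norm \<nu> = 1" using assms(1) by (simp add: outer_unit_normal_def)
  have "y + \<rho> *\<^sub>R \<nu> \<in> cball y \<rho>" using assms(3) \<nu> by (simp add: dist_norm)
  then have "\<nu> \<bullet> (y + \<rho> *\<^sub>R \<nu> - x) \<le> 0" using assms by (auto simp: outer_unit_normal_def)
  then have "\<rho> * (\<nu> \<bullet> \<nu>) \<le> (x - y) \<bullet> \<nu>" by (simp add: inner_diff_right inner_diff_left inner_add_right inner_commute)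
  then show ?thesis using \<nu> by (simp flip: power2_norm_eq_inner)
qed

text \<open>Here \<open>r\<close> is the radius of any ball around \<open>x0\<close> inside
  \<open>K\<close>, not the distance to the boundary, so that the case \<open>K = UNIV\<close>
  is covered by letting \<open>r\<close> tend to infinity. The number \<open>\<sigma>\<close>
  stands for \<open>n \<sigma>0\<close>.\<close>

locale langevin = standard_brownian_motion M B
  for M :: "'w measure" and B :: "real \<Rightarrow> 'w \<Rightarrow> 'a::euclidean_space" +
  fixes K :: "'a set" and \<phi> :: "'a \<Rightarrow> real" and x0 :: 'a and X \<Phi> :: "real \<Rightarrow> 'w \<Rightarrow> 'a" and L \<sigma> r n :: real
  assumes n: "n = real DIM('a)"
    and K: "closed K" "convex K" "interior K \<noteq> {}"
    and convex_\<phi>: "convex_on UNIV \<phi>"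
    and lipschitz: "L-lipschitz_on K \<phi>"
    and x0: "x0 \<in> K"
    and diffusion: "langevin_diffusion M B K \<phi> x0 X \<Phi>"
    and \<sigma>: "\<And>y. y \<in> K \<Longrightarrow> \<phi> x0 - \<sigma> \<le> \<phi> y"
    and r: "0 < r" "cball x0 r \<subseteq> K"
begin

abbreviation m :: "'a \<Rightarrow> 'a" where "m \<equiv> min_subgradient \<phi>"

lemma L_nonneg: "0 \<le> L" using lipschitz by (simp add: lipschitz_on_def)

lemma \<sigma>_nonneg: "0 \<le> \<sigma>" using \<sigma>[OF x0] by simp

lemma norm_m: "x \<in> K \<Longrightarrow> norm (m x) \<le> L"
  by (rule min_subgradient_bound[OF convex_\<phi> K lipschitz])

lemma X_measurable_F: assumes "0 \<le> t" shows "X t \<in> borel_measurable (F t)"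
proof (rule borel_measurable_euclidean_space[THEN iffD2], intro ballI)
  fix b :: 'a assume "b \<in> Basis"
  then show "(\<lambda>\<omega>. X t \<omega> \<bullet> b) \<in> borel_measurable (F t)"
    using diffusion assms by (auto simp: langevin_diffusion_def continuous_semimartingale_def adapted_def)
qed

lemma \<Phi>_measurable_F: assumes "0 \<le> t" shows "\<Phi> t \<in> borel_measurable (F t)"
proof (rule borel_measurable_euclidean_space[THEN iffD2], intro ballI)
  fix b :: 'a assume "b \<in> Basis"
  then show "(\<lambda>\<omega>. \<Phi> t \<omega> \<bullet> b) \<in> borel_measurable (F t)"
    using diffusion assms by (auto simp: langevin_diffusion_def continuous_semimartingale_def adapted_def)
qed

lemma AE_continuous_X: "AE \<omega> in M. continuous_on {0..} (\<lambda>t. X t \<omega>)"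
proof -
  have comp: "AE \<omega> in M. continuous_on {0..} (\<lambda>t. X t \<omega> \<bullet> b)" if b: "b \<in> Basis" for b
  proof -
    obtain N A where N: "continuous_local_martingale M F N" and A: "continuous_fv_process M F A"
      and eq: "AE \<omega> in M. \<forall>t\<ge>0. X t \<omega> \<bullet> b = N t \<omega> + A t \<omega>"
      using diffusion b unfolding langevin_diffusion_def continuous_semimartingale_def by blast
    show ?thesis
      using eq AE_space
    proof eventually_elim
      case (elim \<omega>)
      have "continuous_on {0..} (\<lambda>t. N t \<omega> + A t \<omega>)"
        using N A elim(2) unfolding continuous_local_martingale_def continuous_fv_process_def
        by (intro continuous_on_add) auto
      then show ?case using elim(1) by (subst continuous_on_cong[OF refl]) auto
    qed
  qed
  have "AE \<omega> in M. \<forall>b\<in>Basis. continuous_on {0..} (\<lambda>t. X t \<omega> \<bullet> b)"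
    using comp by (simp add: AE_ball_countable countable_finite)
  then show ?thesis
    by eventually_elim (rule continuous_on_componentwise[THEN iffD2])
qed

text \<open>The increment of half the integral of the gradient, read off from the equation for
  \<open>X\<close>.\<close>

definition drift :: "real \<Rightarrow> real \<Rightarrow> 'w \<Rightarrow> 'a" where
  "drift s t \<omega> = incr s t \<omega> - (X t \<omega> - X s \<omega>) - (\<Phi> t \<omega> - \<Phi> s \<omega>)"

text \<open>Collects what the equation says about the path of \<open>\<omega>\<close>. The function
  \<open>\<Lambda>\<close> plays the part of the local time at the boundary; in
  \<open>AE_local_time\<close> it is the mass of \<open>{0..t}\<close> under the measure behind
  \<open>\<Phi>\<close>. The two lower bounds compare an integral of the path against
  \<open>d\<Phi>\<close> or against the drift with the value of the path at the right end point;
  \<open>w\<close> is the oscillation of the path over the step.\<close>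

definition local_time :: "'w \<Rightarrow> (real \<Rightarrow> real) \<Rightarrow> bool" where
  "local_time \<omega> \<Lambda> \<longleftrightarrow> X 0 \<omega> = x0 \<and> continuous_on {0..} (\<lambda>t. X t \<omega>) \<and> (\<forall>t\<ge>0. X t \<omega> \<in> K) \<and>
    (\<forall>s t. 0 \<le> s \<and> s \<le> t \<longrightarrow> norm (\<Phi> t \<omega> - \<Phi> s \<omega>) \<le> \<Lambda> t - \<Lambda> s) \<and>
    (\<forall>s t y \<rho> w. 0 \<le> s \<and> s \<le> t \<and> 0 \<le> \<rho> \<and> cball y \<rho> \<subseteq> K \<and> (\<forall>u\<in>{s..t}. norm (X u \<omega> - X t \<omega>) \<le> w) \<longrightarrow>
      (\<rho> - w) * (\<Lambda> t - \<Lambda> s) \<le> (X t \<omega> - y) \<bullet> (\<Phi> t \<omega> - \<Phi> s \<omega>)) \<and>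
    (\<forall>s t. 0 \<le> s \<and> s \<le> t \<longrightarrow> norm (drift s t \<omega>) \<le> L / 2 * (t - s)) \<and>
    (\<forall>s t y c w. 0 \<le> s \<and> s \<le> t \<and> (\<forall>u\<in>{s..t}. norm (X u \<omega> - X t \<omega>) \<le> w \<and> c \<le> (X u \<omega> - y) \<bullet> m (X u \<omega>)) \<longrightarrow>
      (c - w * L) / 2 * (t - s) \<le> (X t \<omega> - y) \<bullet> drift s t \<omega>)"

lemma AE_local_time: "AE \<omega> in M. \<exists>\<Lambda>. local_time \<omega> \<Lambda>"
proof -
  note diff = diffusion[unfolded langevin_diffusion_def, THEN conjunct2, THEN conjunct2, THEN conjunct2]
  from diff[THEN conjunct1] diff[THEN conjunct2] AE_continuous_X show ?thesis
  proof eventually_elim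
    case (elim \<omega>)
    let ?x = "\<lambda>t. X t \<omega>" and ?p = "\<lambda>t. \<Phi> t \<omega>"
    have XK: "\<And>t. 0 \<le> t \<Longrightarrow> ?x t \<in> K" using elim(2)[THEN conjunct1] by blast
    obtain l :: "real measure" and \<nu> where l: "sets l = sets borel" "\<forall>T. emeasure l {0..T} < \<infinity>"
      and fr: "AE t in l. 0 \<le> t \<and> ?x t \<in> frontier K"
      and \<nu>: "\<nu> \<in> borel_measurable borel" "\<forall>t\<ge>0. ?x t \<in> frontier K \<longrightarrow> outer_unit_normal K (?x t) (\<nu> t)"
      and p: "\<forall>t\<ge>0. ?p t = (LINT s:{0..t}|l. \<nu> s)"
      using elim(2) unfolding reflection_term_def by blast
    have normal: "AE u in l. 0 \<le> u \<and> outer_unit_normal K (?x u) (\<nu> u)"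
      using fr by eventually_elim (use \<nu> in auto)
    have \<nu>b: "AE u in l. 0 \<le> u \<longrightarrow> norm (\<nu> u) \<le> 1"
      using normal by eventually_elim (auto simp: outer_unit_normal_def)
    have \<nu>m: "(\<lambda>u. indicator {0..} u *\<^sub>R \<nu> u) \<in> borel_measurable borel" using \<nu>(1) by measurable
    note refl = increment_of_integral[OF l(1) l(2)[rule_format] \<nu>m \<nu>b]
    define \<Lambda> where "\<Lambda> t = measure l {0..t}" for t
    have xm: "(\<lambda>u. indicator {0..} u *\<^sub>R ?x u) \<in> borel_measurable borel"
      using elim(3) by (intro borel_measurable_continuous_on_indicator) auto
    have mm: "(\<lambda>u. indicator {0..} u *\<^sub>R m (?x u)) \<in> borel_measurable borel"
    proof -
      have "(\<lambda>u. m (indicator {0..} u *\<^sub>R ?x u)) \<in> borel_measurable borel"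
        by (rule measurable_compose[OF xm borel_measurable_min_subgradient[OF convex_\<phi>]])
      then have "(\<lambda>u. indicator {0..} u *\<^sub>R m (indicator {0..} u *\<^sub>R ?x u)) \<in> borel_measurable borel" by measurable
      moreover have "(\<lambda>u. indicator {0..} u *\<^sub>R m (indicator {0..} u *\<^sub>R ?x u)) = (\<lambda>u. indicator {0..} u *\<^sub>R m (?x u))"
        by (auto simp: fun_eq_iff indicator_def)
      ultimately show ?thesis by simp
    qed
    have mb: "AE u in lborel. 0 \<le> u \<longrightarrow> norm (m (?x u)) \<le> L" using XK norm_m by auto
    have leb: "emeasure lborel {0..T} < \<infinity>" for T :: real by (cases "0 \<le> T") auto
    note dr = increment_of_integral[OF sets_lborel leb mm mb]
    have drift_eq: "drift s t \<omega> = (1/2) *\<^sub>R ((LINT u:{0..t}|lborel. m (?x u)) - (LINT u:{0..s}|lborel. m (?x u)))"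
      if "0 \<le> s" "s \<le> t" for s t
    proof -
      have "?x t = X 0 \<omega> + B t \<omega> - (1/2) *\<^sub>R (LINT s:{0..t}|lborel. m (X s \<omega>)) - ?p t"
        "?x s = X 0 \<omega> + B s \<omega> - (1/2) *\<^sub>R (LINT s:{0..s}|lborel. m (X s \<omega>)) - ?p s"
        using that by (auto intro: elim(2)[THEN conjunct2, THEN conjunct1, rule_format])
      then show ?thesis unfolding drift_def by (simp add: algebra_simps)
    qed
    have "local_time \<omega> \<Lambda>"
      unfolding local_time_def
    proof (intro conjI allI impI; (elim conjE)?)
      fix s t :: real assume st: "0 \<le> s" "s \<le> t"
      show "norm (\<Phi> t \<omega> - \<Phi> s \<omega>) \<le> \<Lambda> t - \<Lambda> s" using refl(1)[OF st] p st by (simp add: \<Lambda>_def)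
      show "norm (drift s t \<omega>) \<le> L / 2 * (t - s)"
        using dr(1)[OF st] st unfolding drift_eq[OF st] by simp
    next
      fix s t y \<rho> w assume st: "0 \<le> s" "s \<le> t" and \<rho>: "0 \<le> \<rho>" "cball y \<rho> \<subseteq> K"
        and w: "\<forall>u\<in>{s..t}. norm (X u \<omega> - X t \<omega>) \<le> w"
      have "AE u in l. u \<in> {s..t} \<longrightarrow> \<rho> - w \<le> (X t \<omega> - y) \<bullet> \<nu> u"
        using normal
      proof eventually_elim
        case (elim u)
        show ?case
        proof
          assume u: "u \<in> {s..t}"
          have "\<rho> \<le> (X u \<omega> - y) \<bullet> \<nu> u" using inner_outer_unit_normal[OF _ \<rho>(2,1)] elim by auto
          moreover have "(X u \<omega> - X t \<omega>) \<bullet> \<nu> u \<le> norm (X u \<omega> - X t \<omega>) * norm (\<nu> u)" by (rule norm_cauchy_schwarz)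
          ultimately show "\<rho> - w \<le> (X t \<omega> - y) \<bullet> \<nu> u"
            using w[rule_format, OF u] elim unfolding inner_diff_left by (simp add: outer_unit_normal_def)
        qed
      qed
      from refl(2)[OF st this] show "(\<rho> - w) * (\<Lambda> t - \<Lambda> s) \<le> (X t \<omega> - y) \<bullet> (\<Phi> t \<omega> - \<Phi> s \<omega>)"
        using p st by (simp add: \<Lambda>_def)
    next
      fix s t y c w assume st: "0 \<le> s" "s \<le> t"
        and w: "\<forall>u\<in>{s..t}. norm (X u \<omega> - X t \<omega>) \<le> w \<and> c \<le> (X u \<omega> - y) \<bullet> m (X u \<omega>)"
      have "c - w * L \<le> (X t \<omega> - y) \<bullet> m (X u \<omega>)" if u: "u \<in> {s..t}" for u
      proof -
        have "(X u \<omega> - X t \<omega>) \<bullet> m (X u \<omega>) \<le> norm (X u \<omega> - X t \<omega>) * norm (m (X u \<omega>))" by (rule norm_cauchy_schwarz)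
        also have "\<dots> \<le> w * L" using w u st XK norm_m by (intro mult_mono) (auto intro: order.trans[OF norm_ge_zero])
        finally show ?thesis using w[rule_format, OF u] unfolding inner_diff_left by auto
      qed
      then have "AE u in lborel. u \<in> {s..t} \<longrightarrow> c - w * L \<le> (X t \<omega> - y) \<bullet> m (X u \<omega>)" by auto
      from dr(2)[OF st this] show "(c - w * L) / 2 * (t - s) \<le> (X t \<omega> - y) \<bullet> drift s t \<omega>"
        using st unfolding drift_eq[OF st] by simp
    qed (use elim(1,3) XK in \<open>auto simp: \<Lambda>_def\<close>)
    then show ?case by blast
  qed
qed

context
  fixes \<omega> and \<Lambda> :: "real \<Rightarrow> real"
  assumes lt: "local_time \<omega> \<Lambda>"
begin

lemma path_in_K: "0 \<le> t \<Longrightarrow> X t \<omega> \<in> K" using lt by (simp add: local_time_def)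

lemmas local_time_unfolded = lt[unfolded local_time_def, THEN conjunct2, THEN conjunct2, THEN conjunct2]

lemma norm_boundary_increment: "0 \<le> s \<Longrightarrow> s \<le> t \<Longrightarrow> norm (\<Phi> t \<omega> - \<Phi> s \<omega>) \<le> \<Lambda> t - \<Lambda> s"
  using local_time_unfolded[THEN conjunct1] by simp

lemma inner_boundary_increment:
  "0 \<le> s \<Longrightarrow> s \<le> t \<Longrightarrow> 0 \<le> \<rho> \<Longrightarrow> cball y \<rho> \<subseteq> K \<Longrightarrow> (\<And>u. u \<in> {s..t} \<Longrightarrow> norm (X u \<omega> - X t \<omega>) \<le> w) \<Longrightarrow>
      (\<rho> - w) * (\<Lambda> t - \<Lambda> s) \<le> (X t \<omega> - y) \<bullet> (\<Phi> t \<omega> - \<Phi> s \<omega>)"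
  by (rule local_time_unfolded[THEN conjunct2, THEN conjunct1, rule_format]) (intro conjI ballI; assumption)

lemma norm_drift: "0 \<le> s \<Longrightarrow> s \<le> t \<Longrightarrow> norm (drift s t \<omega>) \<le> L / 2 * (t - s)"
  using local_time_unfolded[THEN conjunct2, THEN conjunct2, THEN conjunct1] by simp

lemma inner_drift:
  "0 \<le> s \<Longrightarrow> s \<le> t \<Longrightarrow> (\<And>u. u \<in> {s..t} \<Longrightarrow> norm (X u \<omega> - X t \<omega>) \<le> w) \<Longrightarrow>
      (\<And>u. u \<in> {s..t} \<Longrightarrow> c \<le> (X u \<omega> - y) \<bullet> m (X u \<omega>)) \<Longrightarrow>
      (c - w * L) / 2 * (t - s) \<le> (X t \<omega> - y) \<bullet> drift s t \<omega>"
  by (rule local_time_unfolded[THEN conjunct2, THEN conjunct2, THEN conjunct2, rule_format]) (intro conjI ballI; assumption)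

lemma local_time_mono: "0 \<le> s \<Longrightarrow> s \<le> t \<Longrightarrow> \<Lambda> s \<le> \<Lambda> t"
  using order.trans[OF norm_ge_zero norm_boundary_increment] by fastforce

lemma path_modulus:
  assumes "0 < w"
  obtains \<delta> where "0 < \<delta>" "\<And>s t u. 0 \<le> s \<Longrightarrow> t \<le> T \<Longrightarrow> t - s \<le> \<delta> \<Longrightarrow> u \<in> {s..t} \<Longrightarrow> norm (X u \<omega> - X t \<omega>) \<le> w"
proof -
  have "continuous_on {0..T} (\<lambda>t. X t \<omega>)"
    using lt by (auto simp: local_time_def intro: continuous_on_subset)
  then have "uniformly_continuous_on {0..T} (\<lambda>t. X t \<omega>)" by (rule compact_uniformly_continuous) simp
  then obtain \<delta> where \<delta>: "0 < \<delta>" "\<And>u v. u \<in> {0..T} \<Longrightarrow> v \<in> {0..T} \<Longrightarrow> dist v u < \<delta> \<Longrightarrow> dist (X v \<omega>) (X u \<omega>) < w"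
    unfolding uniformly_continuous_on_def using assms by metis
  show ?thesis
  proof (rule that[of "\<delta> / 2"])
    fix s t u assume "0 \<le> s" "t \<le> T" "t - s \<le> \<delta> / 2" "u \<in> {s..t}"
    then show "norm (X u \<omega> - X t \<omega>) \<le> w"
      using \<delta>(2)[of t u] \<delta>(1) by (force simp: dist_norm)
  qed (use \<delta> in simp)
qed

text \<open>The discrete version of Ito's formula for \<open>|X - x0|\<^sup>2\<close>. The part of finite
  variation is tested at the right end point, where its second-order term has the favourable
  sign.\<close>

lemma path_energy_step:
  assumes st: "0 \<le> s" "s \<le> t" and w: "\<And>u. u \<in> {s..t} \<Longrightarrow> norm (X u \<omega> - X t \<omega>) \<le> w"
  shows "(norm (X t \<omega> - x0))\<^sup>2 - (norm (X s \<omega> - x0))\<^sup>2 + 2 * r * (\<Lambda> t - \<Lambda> s)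
    \<le> 2 * ((X s \<omega> - x0) \<bullet> incr s t \<omega>) + (norm (incr s t \<omega>))\<^sup>2 + \<sigma> * (t - s) + w * (L * (t - s) + 2 * (\<Lambda> t - \<Lambda> s))"
proof -
  define z z' b d p h lm where "z = X s \<omega> - x0" and "z' = X t \<omega> - x0" and "b = incr s t \<omega>"
    and "d = drift s t \<omega>" and "p = \<Phi> t \<omega> - \<Phi> s \<omega>" and "h = t - s" and "lm = \<Lambda> t - \<Lambda> s"
  have z': "z' = z + b - (d + p)" by (simp add: z_def z'_def b_def d_def p_def drift_def)
  have "(r - w) * lm \<le> z' \<bullet> p"
    unfolding z'_def p_def lm_def by (rule inner_boundary_increment[OF st less_imp_le[OF r(1)] r(2) w])
  then have 1: "r * lm - w * lm \<le> z' \<bullet> p" by (simp add: left_diff_distrib)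
  have "(- \<sigma> - w * L) / 2 * h \<le> z' \<bullet> d"
  proof -
    have "- \<sigma> \<le> (X u \<omega> - x0) \<bullet> m (X u \<omega>)" if "u \<in> {s..t}" for u
      using min_subgradient_ineq[OF convex_\<phi>, of "X u \<omega>" x0] \<sigma>[OF path_in_K, of u] that st
      by (simp add: inner_diff_left inner_diff_right inner_commute)
    then show ?thesis unfolding z'_def d_def h_def by (intro inner_drift[OF st w])
  qed
  then have 2: "- (\<sigma> * h) - w * (L * h) \<le> 2 * (z' \<bullet> d)" by (simp add: algebra_simps)
  have 3: "(norm z')\<^sup>2 - (norm z)\<^sup>2 = 2 * (z \<bullet> b) + (norm b)\<^sup>2 - 2 * (z' \<bullet> d) - 2 * (z' \<bullet> p) - (norm (d + p))\<^sup>2"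
    unfolding z' power2_norm_eq_inner by (simp add: inner_add_left inner_add_right inner_diff_left inner_diff_right inner_commute)
  have 4: "0 \<le> (norm (d + p))\<^sup>2" by simp
  have "(norm z')\<^sup>2 - (norm z)\<^sup>2 + 2 * (r * lm) \<le> 2 * (z \<bullet> b) + (norm b)\<^sup>2 + \<sigma> * h + (w * (L * h) + 2 * (w * lm))"
    using 1 2 3 4 by linarith
  then show ?thesis
    unfolding z_def[symmetric] z'_def[symmetric] b_def[symmetric] h_def[symmetric] lm_def[symmetric]
    by (simp add: distrib_left mult.assoc mult.left_commute)
qed

text \<open>One step of the chain rule for the coupled difference \<open>e\<close>, again tested at the
  right end point. In the decomposition of \<open>e t\<close> into \<open>X t - y\<close>, the
  increment of \<open>B\<close> and the displacement by the gradient, the first part is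
  favourable up to the oscillation \<open>w\<close>. The second part yields the first and the
  third term of the bound, the third part yields the second and the fourth term.\<close>

lemma path_coupling_step:
  assumes st: "0 \<le> s0" "s0 \<le> s" "s \<le> t" and w: "\<And>u. u \<in> {s..t} \<Longrightarrow> norm (X u \<omega> - X t \<omega>) \<le> w" and y: "y \<in> K"
    and e: "\<And>u. e u = X u \<omega> - (y + incr s0 u \<omega> - ((u - s0) / 2) *\<^sub>R m y)"
  shows "(norm (e t))\<^sup>2 - (norm (e s))\<^sup>2 \<le> (t - s) * (L * norm (incr s0 t \<omega>) - incr s0 t \<omega> \<bullet> m y)
    + (t - s0) * (t - s) * L\<^sup>2 + 2 * (incr s0 t \<omega> \<bullet> (\<Phi> t \<omega> - \<Phi> s \<omega>)) + (t - s0) * L * (\<Lambda> t - \<Lambda> s)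
    + 2 * w * (L * (t - s) + (\<Lambda> t - \<Lambda> s))"
proof -
  define a b h k d p lm where "a = m y" and "b = incr s0 t \<omega>" and "h = t - s" and "k = t - s0"
    and "d = drift s t \<omega>" and "p = \<Phi> t \<omega> - \<Phi> s \<omega>" and "lm = \<Lambda> t - \<Lambda> s"
  have s0: "0 \<le> s" using st by simp
  have k: "0 \<le> h" "0 \<le> k" using st by (auto simp: h_def k_def)
  have a: "norm a \<le> L" using norm_m[OF y] by (simp add: a_def)
  have d: "norm d \<le> L / 2 * h" unfolding d_def h_def by (rule norm_drift[OF s0 st(3)])
  have p: "norm p \<le> lm" unfolding p_def lm_def by (rule norm_boundary_increment[OF s0 st(3)])
  have w0: "norm (X t \<omega> - X t \<omega>) \<le> w" using w[of t] st by simp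
  have "(0 - w) * lm \<le> (X t \<omega> - y) \<bullet> p"
    unfolding p_def lm_def by (rule inner_boundary_increment[OF s0 st(3) order.refl _ w]) (simp_all add: y)
  then have "- (w * lm) \<le> (X t \<omega> - y) \<bullet> p" by (simp only: diff_0 mult_minus_left)
  then have 1: "- 2 * ((X t \<omega> - y) \<bullet> p) \<le> 2 * w * lm" by linarith
  have mono: "(X t \<omega> - y) \<bullet> a - w * L \<le> (X u \<omega> - y) \<bullet> m (X u \<omega>)" if u: "u \<in> {s..t}" for u
  proof -
    have "(X t \<omega> - X u \<omega>) \<bullet> a \<le> norm (X t \<omega> - X u \<omega>) * norm a" by (rule norm_cauchy_schwarz)
    also have "\<dots> \<le> w * L" using w[OF u] w0 a by (intro mult_mono) (auto simp: norm_minus_commute)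
    finally show ?thesis
      using min_subgradient_monotone[OF convex_\<phi>, of "X u \<omega>" y] by (simp add: a_def inner_diff_left)
  qed
  have eq: "(\<alpha> - w * L - w * L) / 2 * h = h / 2 * \<alpha> - w * (L * h)" for \<alpha> by (simp add: field_simps)
  have "((X t \<omega> - y) \<bullet> a - w * L - w * L) / 2 * h \<le> (X t \<omega> - y) \<bullet> d"
    unfolding d_def h_def by (intro inner_drift[OF s0 st(3) w] mono)
  from this[unfolded eq] have "- 2 * ((X t \<omega> - y) \<bullet> (d - (h / 2) *\<^sub>R a)) \<le> 2 * (w * (L * h))"
  proof -
    have gen: "q - W \<le> P \<Longrightarrow> - 2 * (P - q) \<le> 2 * W" for q W P :: real by (simp add: algebra_simps)
    show "h / 2 * ((X t \<omega> - y) \<bullet> a) - w * (L * h) \<le> (X t \<omega> - y) \<bullet> d \<Longrightarrow>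
      - 2 * ((X t \<omega> - y) \<bullet> (d - (h / 2) *\<^sub>R a)) \<le> 2 * (w * (L * h))"
      unfolding inner_diff_right[of "X t \<omega> - y"] inner_scaleR_right by (rule gen)
  qed
  then have 2: "- 2 * ((X t \<omega> - y) \<bullet> (d - (h / 2) *\<^sub>R a)) \<le> 2 * w * (L * h)" by (simp only: mult.assoc)
  have 3: "2 * (b \<bullet> (d - (h / 2) *\<^sub>R a)) \<le> h * (L * norm b - b \<bullet> a)"
  proof -
    have "b \<bullet> d \<le> norm b * norm d" by (rule norm_cauchy_schwarz)
    also have "\<dots> \<le> norm b * (L / 2 * h)" using d by (intro mult_left_mono) auto
    finally show ?thesis by (simp add: inner_diff_right algebra_simps)
  qed
  have 4: "- k * (a \<bullet> (d - (h / 2) *\<^sub>R a)) \<le> k * h * L\<^sup>2"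
  proof -
    have "- (a \<bullet> d) \<le> norm a * norm d" using norm_cauchy_schwarz[of "- a" d] by simp
    also have "\<dots> \<le> L * (L / 2 * h)" using d a by (intro mult_mono) (auto intro: order.trans[OF norm_ge_zero])
    finally have "- (a \<bullet> d) \<le> L\<^sup>2 * h / 2" by (simp add: power2_eq_square)
    moreover have "h / 2 * (a \<bullet> a) \<le> h / 2 * L\<^sup>2"
      using a k by (intro mult_left_mono) (auto simp: power2_norm_eq_inner[symmetric] intro!: power_mono)
    moreover have "L\<^sup>2 * h / 2 + h / 2 * L\<^sup>2 = h * L\<^sup>2" by (simp add: field_simps)
    moreover have "- (a \<bullet> (d - (h / 2) *\<^sub>R a)) = - (a \<bullet> d) + h / 2 * (a \<bullet> a)" by (simp add: inner_diff_right)
    ultimately have "- (a \<bullet> (d - (h / 2) *\<^sub>R a)) \<le> h * L\<^sup>2" by (metis add_mono)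
    then have "k * - (a \<bullet> (d - (h / 2) *\<^sub>R a)) \<le> k * (h * L\<^sup>2)" using k by (intro mult_left_mono) auto
    then show ?thesis by simp
  qed
  have 5: "- k * (a \<bullet> p) \<le> k * L * lm"
  proof -
    have "- (a \<bullet> p) \<le> norm a * norm p" using norm_cauchy_schwarz[of "- a" p] by simp
    also have "\<dots> \<le> L * lm" using p a by (intro mult_mono) (auto intro: order.trans[OF norm_ge_zero])
    finally have "k * - (a \<bullet> p) \<le> k * (L * lm)" using k by (intro mult_left_mono) auto
    then show ?thesis by simp
  qed
  let ?D = "(d - (h / 2) *\<^sub>R a) + p"
  have es: "e s = e t + ?D"
    unfolding e a_def d_def p_def h_def drift_def by (simp add: algebra_simps) (simp add: field_simps flip: scaleR_add_left scaleR_diff_left)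
  have et: "e t = (X t \<omega> - y) - b + (k / 2) *\<^sub>R a" unfolding e a_def b_def k_def by simp
  have "(norm (e t))\<^sup>2 - (norm (e s))\<^sup>2 = - 2 * (e t \<bullet> ?D) - (norm ?D)\<^sup>2"
    unfolding es power2_norm_eq_inner by (simp add: inner_add_left inner_add_right inner_commute)
  also have "\<dots> \<le> - 2 * (e t \<bullet> ?D)" by simp
  also have "\<dots> = (- 2 * ((X t \<omega> - y) \<bullet> (d - (h / 2) *\<^sub>R a)) + 2 * (b \<bullet> (d - (h / 2) *\<^sub>R a)) + - k * (a \<bullet> (d - (h / 2) *\<^sub>R a)))
     + (- 2 * ((X t \<omega> - y) \<bullet> p) + 2 * (b \<bullet> p) + - k * (a \<bullet> p))"
    unfolding et inner_add_left inner_diff_left[of _ b] inner_add_right inner_scaleR_left by (simp add: algebra_simps)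
  also have "\<dots> \<le> (2 * w * (L * h) + h * (L * norm b - b \<bullet> a) + k * h * L\<^sup>2) + (2 * w * lm + 2 * (b \<bullet> p) + k * L * lm)"
    by (intro add_mono 1 2 3 4 5 order.refl)
  also have "\<dots> = h * (L * norm b - b \<bullet> a) + k * h * L\<^sup>2 + 2 * (b \<bullet> p) + k * L * lm + 2 * w * (L * h + lm)"
  proof -
    have "(2 * w * (L * h) + P + k * h * L\<^sup>2) + (2 * w * lm + 2 * Q + k * L * lm)
      = P + k * h * L\<^sup>2 + 2 * Q + k * L * lm + 2 * w * (L * h + lm)" for P Q
      by (simp add: distrib_left)
    then show ?thesis .
  qed
  finally show ?thesis
    unfolding a_def[symmetric] b_def[symmetric] h_def[symmetric] k_def[symmetric] p_def[symmetric] lm_def[symmetric] .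
qed

end

end

section \<open>Energy estimates along grids\<close>

lemma eventually_mesh_le:
  fixes t \<delta> :: real
  assumes "0 < \<delta>"
  shows "eventually (\<lambda>k. t / real (Suc k) \<le> \<delta>) sequentially"
proof -
  obtain N :: nat where N: "t / \<delta> \<le> real N" using real_arch_simple by blast
  have "t / real (Suc k) \<le> \<delta>" if "N \<le> k" for k
  proof -
    have "t / \<delta> \<le> real (Suc k)" using N that by linarith
    then show ?thesis using assms by (simp add: field_simps)
  qed
  then show ?thesis by (auto simp: eventually_sequentially)
qed

text \<open>The grid of \<open>Suc k\<close> steps that divides the interval of length \<open>t\<close> starting at \<open>c\<close>, continued beyond its end.\<close>

definition grid :: "real \<Rightarrow> real \<Rightarrow> nat \<Rightarrow> nat \<Rightarrow> real" where
  "grid c t k i = c + real i * (t / real (Suc k))"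

lemma grid_0 [simp]: "grid c t k 0 = c" by (simp add: grid_def)

lemma grid_end [simp]: "grid c t k (Suc k) = c + t"
  by (simp add: grid_def del: of_nat_Suc)

lemma grid_step: "grid c t k (Suc i) - grid c t k i = t / real (Suc k)"
  unfolding grid_def of_nat_Suc[of i] distrib_right by simp

lemma strict_mono_grid: "0 < t \<Longrightarrow> strict_mono (grid c t k)"
  unfolding strict_mono_Suc_iff
proof
  fix i assume "0 < t"
  then have "0 < t / real (Suc k)" by simp
  then show "grid c t k i < grid c t k (Suc i)" using grid_step[of c t k i] by linarith
qed

lemma grid_ge: "0 \<le> t \<Longrightarrow> c \<le> grid c t k i" by (simp add: grid_def)

lemma grid_le: "0 \<le> t \<Longrightarrow> i \<le> Suc k \<Longrightarrow> grid c t k i \<le> c + t"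
proof -
  assume a: "0 \<le> t" "i \<le> Suc k"
  have "real i * (t / real (Suc k)) \<le> real (Suc k) * (t / real (Suc k))" using a by (intro mult_right_mono) auto
  then show ?thesis by (simp add: grid_def del: of_nat_Suc)
qed

lemma grid_Suc_ge: "0 \<le> t \<Longrightarrow> grid c t k i \<le> grid c t k (Suc i)"
  unfolding grid_def by (intro add_left_mono mult_right_mono) auto

lemma sum_grid_steps: "(\<Sum>i<Suc k. c * (t / real (Suc k))) = c * t"
  by (simp del: of_nat_Suc)

context langevin
begin

abbreviation Z :: "real \<Rightarrow> 'w \<Rightarrow> 'a" where "Z t \<omega> \<equiv> X t \<omega> - x0"

abbreviation rate :: real where "rate \<equiv> n + \<sigma>"

text \<open>The constant in the fourth moment of a Gaussian vector, from \<open>gaussian_moments\<close>.\<close>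

abbreviation C4 :: real where "C4 \<equiv> 32 * 2 powr (n / 2)"

lemma n_pos: "1 \<le> n" unfolding n using DIM_positive[where 'a = 'a] by linarith

lemma Z_measurable_F: "0 \<le> t \<Longrightarrow> Z t \<in> borel_measurable (F t)"
  using X_measurable_F by (intro borel_measurable_diff) auto

text \<open>One tolerance \<open>w\<close> for the oscillation works on all steps of a fine grid, and its
  total contribution is at most \<open>\<epsilon>\<close>. It depends on the path.\<close>

lemma energy_grid:
  assumes lt: "local_time \<omega> \<Lambda>" and t: "0 < t" and e: "0 < \<epsilon>"
  shows "eventually (\<lambda>k. \<exists>w>0. w * (L * t + 2 * (\<Lambda> t - \<Lambda> 0)) \<le> \<epsilon> \<and>
    (\<forall>i<Suc k. (norm (Z (grid 0 t k (Suc i)) \<omega>))\<^sup>2 - (norm (Z (grid 0 t k i) \<omega>))\<^sup>2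
        + 2 * r * (\<Lambda> (grid 0 t k (Suc i)) - \<Lambda> (grid 0 t k i))
      \<le> 2 * (Z (grid 0 t k i) \<omega> \<bullet> incr (grid 0 t k i) (grid 0 t k (Suc i)) \<omega>)
        + (norm (incr (grid 0 t k i) (grid 0 t k (Suc i)) \<omega>))\<^sup>2 + \<sigma> * (t / real (Suc k))
        + w * (L * (t / real (Suc k)) + 2 * (\<Lambda> (grid 0 t k (Suc i)) - \<Lambda> (grid 0 t k i))))) sequentially"
proof -
  define D where "D = L * t + 2 * (\<Lambda> t - \<Lambda> 0)"
  have D: "0 \<le> D" using L_nonneg t local_time_mono[OF lt, of 0 t] by (simp add: D_def)
  define w where "w = \<epsilon> / (D + 1)"
  have w: "0 < w" using e D by (simp add: w_def)
  have "w * D \<le> w * (D + 1)" using w by (intro mult_left_mono) auto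
  also have "\<dots> = \<epsilon>" using D by (simp add: w_def)
  finally have wD: "w * D \<le> \<epsilon>" .
  obtain \<delta> where \<delta>: "0 < \<delta>" "\<And>s t' u. 0 \<le> s \<Longrightarrow> t' \<le> t \<Longrightarrow> t' - s \<le> \<delta> \<Longrightarrow> u \<in> {s..t'} \<Longrightarrow> norm (X u \<omega> - X t' \<omega>) \<le> w"
    using path_modulus[OF lt w, of t] by metis
  from eventually_mesh_le[OF \<delta>(1), of t] show ?thesis
  proof eventually_elim
    case (elim k)
    show ?case
    proof (intro exI[of _ w] conjI allI impI)
      show "0 < w" "w * (L * t + 2 * (\<Lambda> t - \<Lambda> 0)) \<le> \<epsilon>" using w wD by (auto simp: D_def)
      fix i assume i: "i < Suc k"
      let ?s = "grid 0 t k i" and ?t = "grid 0 t k (Suc i)"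
      have "norm (X u \<omega> - X ?t \<omega>) \<le> w" if "u \<in> {?s..?t}" for u
        by (rule \<delta>(2)[OF _ _ _ that]) (use t i elim grid_le[of t "Suc i" k 0] in \<open>auto simp: grid_ge grid_step\<close>)
      from path_energy_step[OF lt grid_ge grid_Suc_ge this]
      show "(norm (Z ?t \<omega>))\<^sup>2 - (norm (Z ?s \<omega>))\<^sup>2 + 2 * r * (\<Lambda> ?t - \<Lambda> ?s)
        \<le> 2 * (Z ?s \<omega> \<bullet> incr ?s ?t \<omega>) + (norm (incr ?s ?t \<omega>))\<^sup>2 + \<sigma> * (t / real (Suc k))
          + w * (L * (t / real (Suc k)) + 2 * (\<Lambda> ?t - \<Lambda> ?s))"
        using t unfolding grid_step by simp
    qed
  qed
qed

text \<open>The derivative of \<open>x / (1 + c x)\<close> at \<open>x = |z|\<^sup>2\<close>. That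
  function replaces \<open>x\<close> in the energy estimate; for \<open>c > 0\<close> it is
  bounded and concave, and for \<open>c = 0\<close> it is \<open>x\<close> itself.\<close>

definition weight :: "real \<Rightarrow> 'a \<Rightarrow> real" where
  "weight c z = 1 / (1 + c * (norm z)\<^sup>2)\<^sup>2"

definition tame :: "real \<Rightarrow> 'a \<Rightarrow> real" where
  "tame c z = (norm z)\<^sup>2 / (1 + c * (norm z)\<^sup>2)"

lemma weight_bounds: "0 \<le> c \<Longrightarrow> 0 \<le> weight c z" "0 \<le> c \<Longrightarrow> weight c z \<le> 1"
  by (auto simp: weight_def divide_le_eq power2_eq_square intro!: mult_ge1_I)

lemma weight_0 [simp]: "weight 0 z = 1"
  by (simp add: weight_def)

text \<open>Makes the martingale sums of the energy estimate square integrable before any moment of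
  \<open>X\<close> is known.\<close>

lemma weight_norm_bound:
  assumes c: "0 < c" shows "(norm ((2 * weight c z) *\<^sub>R z))\<^sup>2 \<le> 4 / c"
proof -
  define x where "x = (norm z)\<^sup>2"
  have x: "0 \<le> x" by (simp add: x_def)
  have "weight c z * x \<le> weight c z * x * (1 + c * x)"
    using c x weight_bounds(1)[of c z] by (simp add: algebra_simps)
  also have "\<dots> \<le> 1 / c"
  proof -
    have "x / (1 + c * x) \<le> 1 / c" using c x by (simp add: field_simps add_pos_nonneg)
    moreover have "weight c z * x * (1 + c * x) = x / (1 + c * x)"
    proof -
      have u: "1 + c * x > 0" using c x by (intro add_pos_nonneg) auto
      have "weight c z = 1 / ((1 + c * x) * (1 + c * x))" by (simp add: weight_def x_def power2_eq_square)
      then show ?thesis using u by (simp add: divide_simps)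
    qed
    ultimately show ?thesis by simp
  qed
  finally have 1: "weight c z * x \<le> 1 / c" .
  have "(norm ((2 * weight c z) *\<^sub>R z))\<^sup>2 = 4 * (weight c z * (weight c z * x))"
    by (simp add: power_mult_distrib x_def power2_eq_square)
  also have "\<dots> \<le> 4 * (1 * (weight c z * x))"
    using c x weight_bounds[of c z] by (intro mult_left_mono mult_right_mono) auto
  finally show ?thesis using 1 by simp
qed

lemma tame_concave:
  assumes c: "0 \<le> c"
  shows "tame c z' - tame c z \<le> weight c z * ((norm z')\<^sup>2 - (norm z)\<^sup>2)"
proof -
  define x y where "x = (norm z)\<^sup>2" and "y = (norm z')\<^sup>2"
  have xy: "0 \<le> x" "0 \<le> y" by (auto simp: x_def y_def)
  then have pos: "0 < 1 + c * x" "0 < 1 + c * y" using c by (auto intro: add_pos_nonneg)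
  have "tame c z' - tame c z = (y - x) / ((1 + c * x) * (1 + c * y))"
    using pos by (simp add: tame_def x_def[symmetric] y_def[symmetric] field_simps)
  also have "\<dots> \<le> (y - x) / ((1 + c * x) * (1 + c * x))"
  proof (cases "x \<le> y")
    case True
    then show ?thesis using pos c by (intro divide_left_mono mult_left_mono mult_pos_pos) (auto intro: mult_left_mono)
  next
    case False
    then have "(x - y) / ((1 + c * x) * (1 + c * x)) \<le> (x - y) / ((1 + c * x) * (1 + c * y))"
      using pos c by (intro divide_left_mono mult_left_mono mult_pos_pos) (auto intro: mult_left_mono)
    moreover have "(y - x) / a = - ((x - y) / a)" for a by (simp add: minus_divide_left)
    ultimately show ?thesis by simp
  qed
  also have "\<dots> = weight c z * (y - x)" by (simp add: weight_def x_def power2_eq_square)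
  finally show ?thesis by (simp add: x_def y_def)
qed

definition energy_integrand :: "real \<Rightarrow> real \<Rightarrow> nat \<Rightarrow> nat \<Rightarrow> 'w \<Rightarrow> 'a" where
  "energy_integrand c t k i \<omega> = (2 * weight c (Z (grid 0 t k i) \<omega>)) *\<^sub>R Z (grid 0 t k i) \<omega>"

text \<open>By concavity the increments of \<open>tame c\<close> are at most the increments of
  \<open>|Z|\<^sup>2\<close> times the weight at the left end point, which depends on the past
  only; this replaces the second-order Ito formula. The local time is kept for \<open>c =
  0\<close>, where the weight is 1.\<close>

lemma energy_path_bound:
  assumes lt: "local_time \<omega> \<Lambda>" and t: "0 < t" and e: "0 < \<epsilon>" and c: "0 \<le> c"
  shows "eventually (\<lambda>k. tame c (Z t \<omega>) + (if c = 0 then 2 * r * (\<Lambda> t - \<Lambda> 0) else 0) \<le> \<sigma> * t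
     + (mart_sum (energy_integrand c t k) (grid 0 t k) (Suc k) \<omega> + quad_sum (grid 0 t k) (Suc k) \<omega>) + \<epsilon>) sequentially"
  using energy_grid[OF lt t e]
proof eventually_elim
  case (elim k)
  define \<tau> where "\<tau> = grid 0 t k"
  define h where "h = t / real (Suc k)"
  define z where "z i = Z (\<tau> i) \<omega>" for i
  define g where "g i = weight c (z i)" for i
  define b where "b i = incr (\<tau> i) (\<tau> (Suc i)) \<omega>" for i
  define l where "l i = \<Lambda> (\<tau> (Suc i)) - \<Lambda> (\<tau> i)" for i
  obtain w where w: "w > 0" "w * (L * t + 2 * (\<Lambda> t - \<Lambda> 0)) \<le> \<epsilon>"
    and step: "\<And>i. i < Suc k \<Longrightarrow> (norm (z (Suc i)))\<^sup>2 - (norm (z i))\<^sup>2 + 2 * r * l i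
       \<le> 2 * (z i \<bullet> b i) + (norm (b i))\<^sup>2 + \<sigma> * h + w * (L * h + 2 * l i)"
    using elim unfolding \<tau>_def h_def z_def b_def l_def by metis
  have l: "0 \<le> l i" for i unfolding l_def \<tau>_def using t
    by (simp add: local_time_mono[OF lt grid_ge grid_Suc_ge])
  have h: "0 < h" using t by (simp add: h_def)
  define \<rho> where "\<rho> = (if c = 0 then 2 * r else 0)"
  have one: "tame c (z (Suc i)) - tame c (z i) + \<rho> * l i
      \<le> ((2 * g i) *\<^sub>R z i) \<bullet> b i + (norm (b i))\<^sup>2 + \<sigma> * h + w * (L * h + 2 * l i)" if i: "i < Suc k" for i
  proof -
    have g: "0 \<le> g i" "g i \<le> 1" using weight_bounds c by (auto simp: g_def)
    have s: "(norm (z (Suc i)))\<^sup>2 - (norm (z i))\<^sup>2 + 2 * r * l i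
       \<le> 2 * (z i \<bullet> b i) + ((norm (b i))\<^sup>2 + \<sigma> * h + w * (L * h + 2 * l i))"
      using step[OF i] by linarith
    have \<rho>: "\<rho> * l i \<le> g i * (2 * r * l i)" using g l[of i] r by (auto simp: \<rho>_def g_def)
    have "tame c (z (Suc i)) - tame c (z i) \<le> g i * ((norm (z (Suc i)))\<^sup>2 - (norm (z i))\<^sup>2)"
      unfolding g_def by (rule tame_concave[OF c])
    then have "tame c (z (Suc i)) - tame c (z i) + \<rho> * l i \<le> g i * ((norm (z (Suc i)))\<^sup>2 - (norm (z i))\<^sup>2 + 2 * r * l i)"
      using \<rho> unfolding distrib_left by linarith
    also have "\<dots> \<le> g i * (2 * (z i \<bullet> b i) + ((norm (b i))\<^sup>2 + \<sigma> * h + w * (L * h + 2 * l i)))"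
      using s g by (intro mult_left_mono)
    also have "\<dots> = ((2 * g i) *\<^sub>R z i) \<bullet> b i + g i * ((norm (b i))\<^sup>2 + \<sigma> * h + w * (L * h + 2 * l i))"
      by (simp add: algebra_simps)
    also have "\<dots> \<le> ((2 * g i) *\<^sub>R z i) \<bullet> b i + 1 * ((norm (b i))\<^sup>2 + \<sigma> * h + w * (L * h + 2 * l i))"
      using g l h w \<sigma>_nonneg L_nonneg by (intro add_left_mono mult_right_mono) auto
    finally show ?thesis by simp
  qed
  have suml: "(\<Sum>i<Suc k. l i) = \<Lambda> t - \<Lambda> 0"
    unfolding l_def using sum_lessThan_telescope[of "\<lambda>i. \<Lambda> (\<tau> i)" "Suc k"] by (simp add: \<tau>_def del: sum.lessThan_Suc)
  have "tame c (z (Suc k)) - tame c (z 0) + \<rho> * (\<Lambda> t - \<Lambda> 0) = (\<Sum>i<Suc k. tame c (z (Suc i)) - tame c (z i) + \<rho> * l i)"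
    unfolding suml[symmetric] sum_distrib_left sum.distrib
    using sum_lessThan_telescope[of "\<lambda>i. tame c (z i)" "Suc k"] by (simp only:)
  also have "\<dots> \<le> (\<Sum>i<Suc k. ((2 * g i) *\<^sub>R z i) \<bullet> b i + (norm (b i))\<^sup>2 + \<sigma> * h + w * (L * h + 2 * l i))"
    using one by (intro sum_mono) auto
  also have "\<dots> = (\<Sum>i<Suc k. ((2 * g i) *\<^sub>R z i) \<bullet> b i) + (\<Sum>i<Suc k. (norm (b i))\<^sup>2) + (\<Sum>i<Suc k. \<sigma> * h)
      + w * ((\<Sum>i<Suc k. L * h) + 2 * (\<Sum>i<Suc k. l i))"
    by (simp only: sum.distrib sum_distrib_left distrib_left)
  also note suml
  also have "(\<Sum>i<Suc k. \<sigma> * h) = \<sigma> * t" unfolding h_def by (rule sum_grid_steps)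
  also have "(\<Sum>i<Suc k. L * h) = L * t" unfolding h_def by (rule sum_grid_steps)
  finally have "tame c (z (Suc k)) - tame c (z 0) + \<rho> * (\<Lambda> t - \<Lambda> 0) \<le> (\<Sum>i<Suc k. ((2 * g i) *\<^sub>R z i) \<bullet> b i) + (\<Sum>i<Suc k. (norm (b i))\<^sup>2)
     + \<sigma> * t + \<epsilon>" using w(2) by linarith
  moreover have "z (Suc k) = Z t \<omega>" by (simp add: z_def \<tau>_def)
  moreover have "tame c (z 0) = 0" using lt by (simp add: z_def \<tau>_def local_time_def tame_def)
  ultimately show ?case
    unfolding mart_sum_def quad_sum_def energy_integrand_def
    by (simp add: z_def g_def b_def \<tau>_def \<rho>_def del: sum.lessThan_Suc split: if_splits)
qed

lemma quad_sum_grid: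
  assumes t: "0 < t"
  shows "expectation (quad_sum (grid 0 t k) (Suc k)) \<le> n * t"
    and "expectation (\<lambda>\<omega>. (quad_sum (grid 0 t k) (Suc k) \<omega>)\<^sup>2) \<le> (n * t)\<^sup>2 + C4 * (t\<^sup>2 / real (Suc k))"
proof -
  show "expectation (quad_sum (grid 0 t k) (Suc k)) \<le> n * t"
    using quad_sum_mean[of "grid 0 t k" "Suc k"] strict_mono_grid[OF t] by (simp add: n)
  have "(\<Sum>i<Suc k. (grid 0 t k (Suc i) - grid 0 t k i)\<^sup>2) = t\<^sup>2 / real (Suc k)"
    unfolding grid_step by (simp add: power2_eq_square del: of_nat_Suc sum.lessThan_Suc)
  then show "expectation (\<lambda>\<omega>. (quad_sum (grid 0 t k) (Suc k) \<omega>)\<^sup>2) \<le> (n * t)\<^sup>2 + C4 * (t\<^sup>2 / real (Suc k))"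
    using quad_sum_variance[of "grid 0 t k" "Suc k"] strict_mono_grid[OF t] by (simp add: n)
qed

section \<open>Second moments of the diffusion and of its local time\<close>

text \<open>The bound holds with \<open>tame c\<close> for every \<open>c > 0\<close>, where all grid sums
  are bounded in \<open>L\<^sup>2\<close>. Then \<open>c\<close> tends to 0.\<close>

lemma second_moment_nn:
  assumes t: "0 < t"
  shows "(\<integral>\<^sup>+\<omega>. ennreal ((norm (Z t \<omega>))\<^sup>2) \<partial>M) \<le> ennreal (rate * t)"
proof -
  have Zm [measurable]: "Z t \<in> borel_measurable M" using Z_measurable_F[of t] t by (intro measurable_F) auto
  have tame: "(\<integral>\<^sup>+\<omega>. ennreal (tame c (Z t \<omega>)) \<partial>M) \<le> ennreal (rate * t)" if c: "0 < c" for c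
  proof -
    define H where "H = energy_integrand c t"
    define N where "N k = mart_sum (H k) (grid 0 t k) (Suc k)" for k
    define Q where "Q k = quad_sum (grid 0 t k) (Suc k)" for k
    have g: "0 \<le> grid 0 t k 0" "strict_mono (grid 0 t k)" for k using strict_mono_grid[OF t] by auto
    have Hm: "H k i \<in> borel_measurable (F (grid 0 t k i))" for k i
    proof -
      have [measurable]: "Z (grid 0 t k i) \<in> borel_measurable (F (grid 0 t k i))"
        by (rule Z_measurable_F[OF grid_ge[OF less_imp_le[OF t]]])
      show ?thesis unfolding H_def energy_integrand_def[abs_def] weight_def by measurable
    qed
    have Hb: "(norm (H k i \<omega>))\<^sup>2 \<le> 4 / c" for k i \<omega>
      unfolding H_def energy_integrand_def by (rule weight_norm_bound[OF c])
    have Hi: "integrable M (\<lambda>\<omega>. (norm (H k i \<omega>))\<^sup>2)" for k i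
      by (rule integrable_const_bound[of _ "4 / c"]) (use Hb measurable_F[OF Hm] in auto)
    have N: "N k \<in> borel_measurable M" "integrable M (\<lambda>\<omega>. (N k \<omega>)\<^sup>2)" "expectation (N k) = 0" for k
      unfolding N_def by (rule mart_sum_measurable mart_sum_integrable mart_sum_mean; use g Hm Hi in blast)+
    have NV: "expectation (\<lambda>\<omega>. (N k \<omega>)\<^sup>2) \<le> 4 / c * (n * t)" for k
    proof -
      have "expectation (\<lambda>\<omega>. (N k \<omega>)\<^sup>2) \<le> (\<Sum>i<Suc k. expectation (\<lambda>\<omega>. (norm (H k i \<omega>))\<^sup>2) * (n * (t / real (Suc k))))"
        unfolding N_def using mart_sum_variance[OF g Hm Hi, of k "Suc k"] unfolding grid_step n .
      also have "\<dots> \<le> (\<Sum>i<Suc k. 4 / c * (n * (t / real (Suc k))))"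
      proof (intro sum_mono mult_right_mono)
        fix i
        have "expectation (\<lambda>\<omega>. (norm (H k i \<omega>))\<^sup>2) \<le> expectation (\<lambda>\<omega>. 4 / c)"
          using Hi Hb by (intro integral_mono) auto
        then show "expectation (\<lambda>\<omega>. (norm (H k i \<omega>))\<^sup>2) \<le> 4 / c" by (simp add: prob_space)
      qed (use t n_pos in simp)
      also have "\<dots> = 4 / c * n * t" using sum_grid_steps[of "4 / c * n"] by (simp only: mult.assoc)
      finally show ?thesis by (simp only: mult.assoc)
    qed
    have Q: "Q k \<in> borel_measurable M" "integrable M (\<lambda>\<omega>. (Q k \<omega>)\<^sup>2)" "expectation (Q k) \<le> n * t" for k
      unfolding Q_def using quad_sum_measurable[OF g] quad_sum_integrable[OF g] quad_sum_grid(1)[OF t] by auto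
    have QV: "expectation (\<lambda>\<omega>. (Q k \<omega>)\<^sup>2) \<le> (n * t)\<^sup>2 + C4 * t\<^sup>2" for k
    proof -
      have "t\<^sup>2 / real (Suc k) \<le> t\<^sup>2" using t by (simp add: divide_le_eq mult_le_cancel_left1)
      then have "C4 * (t\<^sup>2 / real (Suc k)) \<le> C4 * t\<^sup>2" by (intro mult_left_mono) auto
      then show ?thesis using quad_sum_grid(2)[OF t, of k] unfolding Q_def by linarith
    qed
    have Si: "integrable M (N k)" "integrable M (Q k)" for k by (rule square_integrable_imp_integrable[OF N(1,2)] square_integrable_imp_integrable[OF Q(1,2)])+
    have "(\<integral>\<^sup>+\<omega>. ennreal (tame c (Z t \<omega>)) \<partial>M) \<le> ennreal (expectation (\<lambda>_. \<sigma> * t) + n * t)"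
    proof (rule nn_integral_le_of_L2_bounded)
      show "(\<lambda>\<omega>. tame c (Z t \<omega>)) \<in> borel_measurable M" unfolding tame_def by measurable
      show "AE \<omega> in M. 0 \<le> tame c (Z t \<omega>)" using c by (simp add: tame_def add_nonneg_nonneg)
      show "(\<lambda>\<omega>. N k \<omega> + Q k \<omega>) \<in> borel_measurable M" for k using N Q by measurable
      show "integrable M (\<lambda>\<omega>. (N k \<omega> + Q k \<omega>)\<^sup>2)" for k by (rule integrable_sum_square) (use N Q in auto)
      show "expectation (\<lambda>\<omega>. N k \<omega> + Q k \<omega>) \<le> n * t" for k using Si N(3)[of k] Q(3)[of k] by simp
      show "expectation (\<lambda>\<omega>. (N k \<omega> + Q k \<omega>)\<^sup>2) \<le> 2 * (4 / c * (n * t)) + 2 * ((n * t)\<^sup>2 + C4 * t\<^sup>2)" for k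
      proof -
        have "expectation (\<lambda>\<omega>. (N k \<omega> + Q k \<omega>)\<^sup>2) \<le> expectation (\<lambda>\<omega>. 2 * (N k \<omega>)\<^sup>2 + 2 * (Q k \<omega>)\<^sup>2)"
        proof (rule integral_mono)
          show "integrable M (\<lambda>\<omega>. (N k \<omega> + Q k \<omega>)\<^sup>2)" by (rule integrable_sum_square) (use N Q in auto)
          show "(N k \<omega> + Q k \<omega>)\<^sup>2 \<le> 2 * (N k \<omega>)\<^sup>2 + 2 * (Q k \<omega>)\<^sup>2" for \<omega>
            using sum_squares_bound[of "N k \<omega>" "Q k \<omega>"] unfolding power2_sum by linarith
        qed (use N Q in auto)
        also have "\<dots> = 2 * expectation (\<lambda>\<omega>. (N k \<omega>)\<^sup>2) + 2 * expectation (\<lambda>\<omega>. (Q k \<omega>)\<^sup>2)" using N Q by simp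
        also have "\<dots> \<le> 2 * (4 / c * (n * t)) + 2 * ((n * t)\<^sup>2 + C4 * t\<^sup>2)"
          by (intro add_mono mult_left_mono NV QV) auto
        finally show ?thesis .
      qed
      show "AE \<omega> in M. \<forall>\<epsilon>>0. \<forall>\<^sub>F k in sequentially. tame c (Z t \<omega>) \<le> \<sigma> * t + (N k \<omega> + Q k \<omega>) + \<epsilon>"
        using AE_local_time
      proof eventually_elim
        case (elim \<omega>)
        then obtain \<Lambda> where "local_time \<omega> \<Lambda>" ..
        then show ?case using energy_path_bound[OF _ t _ less_imp_le[OF c]] c unfolding N_def Q_def H_def by simp
      qed
    qed auto
    then show ?thesis by (simp add: prob_space algebra_simps)
  qed
  have lim: "(\<lambda>k. ennreal (tame (1 / real (Suc k)) z)) \<longlonglongrightarrow> ennreal ((norm z)\<^sup>2)" for z :: 'a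
  proof -
    have "(\<lambda>n. 1 / real (Suc n)) \<longlonglongrightarrow> 0" using LIMSEQ_Suc[OF lim_1_over_n] by simp
    then have "(\<lambda>k. (norm z)\<^sup>2 / (1 + 1 / real (Suc k) * (norm z)\<^sup>2)) \<longlonglongrightarrow> (norm z)\<^sup>2 / (1 + 0 * (norm z)\<^sup>2)"
      by (intro tendsto_intros) auto
    then show ?thesis unfolding tame_def by (intro tendsto_ennrealI) simp
  qed
  have "(\<integral>\<^sup>+\<omega>. ennreal ((norm (Z t \<omega>))\<^sup>2) \<partial>M) = (\<integral>\<^sup>+\<omega>. liminf (\<lambda>k. ennreal (tame (1 / real (Suc k)) (Z t \<omega>))) \<partial>M)"
    by (intro nn_integral_cong lim_imp_Liminf[symmetric] lim) simp
  also have "\<dots> \<le> liminf (\<lambda>k. \<integral>\<^sup>+\<omega>. ennreal (tame (1 / real (Suc k)) (Z t \<omega>)) \<partial>M)"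
    by (rule nn_integral_liminf) (unfold tame_def, measurable)
  also have "\<dots> \<le> liminf (\<lambda>k. ennreal (rate * t))"
    by (intro Liminf_mono always_eventually allI tame) simp
  also have "\<dots> = ennreal (rate * t)" by (simp add: Liminf_const)
  finally show ?thesis .
qed

lemma second_moment:
  assumes t: "0 \<le> t"
  shows second_moment_integrable: "integrable M (\<lambda>\<omega>. (norm (Z t \<omega>))\<^sup>2)"
    and second_moment_bound: "expectation (\<lambda>\<omega>. (norm (Z t \<omega>))\<^sup>2) \<le> rate * t"
proof -
  have Zm [measurable]: "Z t \<in> borel_measurable M" using Z_measurable_F[of t] t by (intro measurable_F) auto
  have nn: "(\<integral>\<^sup>+\<omega>. ennreal ((norm (Z t \<omega>))\<^sup>2) \<partial>M) \<le> ennreal (rate * t)"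
  proof (cases "t = 0")
    case True
    have "AE \<omega> in M. ennreal ((norm (Z 0 \<omega>))\<^sup>2) = 0"
      using AE_local_time by eventually_elim (auto simp: local_time_def)
    then have "(\<integral>\<^sup>+\<omega>. ennreal ((norm (Z 0 \<omega>))\<^sup>2) \<partial>M) = (\<integral>\<^sup>+\<omega>. 0 \<partial>M)" by (rule nn_integral_cong_AE)
    then show ?thesis using True by simp
  qed (use second_moment_nn t in auto)
  show i: "integrable M (\<lambda>\<omega>. (norm (Z t \<omega>))\<^sup>2)"
    using nn by (intro integrableI_bounded) (auto simp: less_top[symmetric] top_unique)
  have "0 \<le> rate * t" using t n_pos \<sigma>_nonneg by simp
  then show "expectation (\<lambda>\<omega>. (norm (Z t \<omega>))\<^sup>2) \<le> rate * t"
    using nn by (simp add: nn_integral_eq_integral[OF i])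
qed

lemma sum_grid_triangular: "(\<Sum>i<Suc k. real i) \<le> (real (Suc k))\<^sup>2 / 2"
proof -
  have "(\<Sum>i<j. real i) \<le> (real j)\<^sup>2 / 2" for j
    by (induction j) (simp_all add: power2_eq_square algebra_simps)
  then show ?thesis .
qed

text \<open>These weights turn second moments bounded by \<open>a\<^sup>2\<close> and \<open>2
  a\<^sup>2\<close> into the bound \<open>((1 + sqrt 2) a)\<^sup>2\<close> of the triangle
  inequality, without taking norms.\<close>

lemma square_sum_le_weighted:
  fixes x y :: real
  shows "(x + y)\<^sup>2 \<le> (1 + sqrt 2) * x\<^sup>2 + (1 + 1 / sqrt 2) * y\<^sup>2"
proof -
  define s where "s = sqrt (sqrt 2)"
  have s: "s > 0" "s\<^sup>2 = sqrt 2" by (auto simp: s_def)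
  have "0 \<le> (s * x - y / s)\<^sup>2" by simp
  also have "(s * x - y / s)\<^sup>2 = sqrt 2 * x\<^sup>2 - 2 * x * y + 1 / sqrt 2 * y\<^sup>2"
    using s(1) unfolding s(2)[symmetric] by (simp add: power2_diff power_mult_distrib power_divide)
  finally show ?thesis unfolding power2_sum by (simp add: algebra_simps)
qed

text \<open>The local time is dominated by a random variable \<open>R\<close>, the lower limit of the grid
  sums \<open>S k\<close>, which is measurable by construction. The sums are \<open>\<sigma> t +
  Q k\<close>, whose second moment tends to at most \<open>a\<^sup>2\<close>, plus a martingale
  sum \<open>N k\<close> of second moment at most \<open>2 a\<^sup>2\<close>. Fatou's lemma
  gives the second moment of \<open>R\<close>. The first moment is bounded separately, as it has
  the smaller constant 1 that the final estimate requires.\<close>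

lemma local_time_bound:
  assumes t: "0 < t"
  obtains R where "R \<in> borel_measurable M" "\<And>\<omega>. 0 \<le> R \<omega>" "integrable M (\<lambda>\<omega>. (R \<omega>)\<^sup>2)"
    "expectation (\<lambda>\<omega>. (R \<omega>)\<^sup>2) \<le> ((1 + sqrt 2) * (rate * t))\<^sup>2" "expectation R \<le> rate * t"
    "AE \<omega> in M. \<forall>\<Lambda>. local_time \<omega> \<Lambda> \<longrightarrow> 2 * r * (\<Lambda> t - \<Lambda> 0) \<le> R \<omega>"
proof -
  define a where "a = rate * t"
  have a: "0 \<le> a" "n * t \<le> a" "0 \<le> \<sigma> * t" "\<sigma> * t + n * t = a"
    using t n_pos \<sigma>_nonneg by (auto simp: a_def algebra_simps)
  define H where "H = energy_integrand 0 t"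
  have H: "H k i \<omega> = 2 *\<^sub>R Z (grid 0 t k i) \<omega>" for k i \<omega> by (simp add: H_def energy_integrand_def)
  define N where "N k = mart_sum (H k) (grid 0 t k) (Suc k)" for k
  define Q where "Q k = quad_sum (grid 0 t k) (Suc k)" for k
  define S where "S k \<omega> = \<sigma> * t + Q k \<omega> + N k \<omega>" for k \<omega>
  have g: "0 \<le> grid 0 t k 0" "strict_mono (grid 0 t k)" for k using strict_mono_grid[OF t] by auto
  have Hm: "H k i \<in> borel_measurable (F (grid 0 t k i))" for k i
  proof -
    have [measurable]: "Z (grid 0 t k i) \<in> borel_measurable (F (grid 0 t k i))"
      by (rule Z_measurable_F[OF grid_ge[OF less_imp_le[OF t]]])
    show ?thesis unfolding H[abs_def] by measurable
  qed
  have Hi: "integrable M (\<lambda>\<omega>. (norm (H k i \<omega>))\<^sup>2)"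
    and Hb: "expectation (\<lambda>\<omega>. (norm (H k i \<omega>))\<^sup>2) \<le> 4 * (rate * grid 0 t k i)" for k i
    using second_moment[OF grid_ge[OF less_imp_le[OF t]], of k i] by (auto simp: H power_mult_distrib)
  have N [measurable]: "N k \<in> borel_measurable M" and Ni: "integrable M (\<lambda>\<omega>. (N k \<omega>)\<^sup>2)" and N0: "expectation (N k) = 0" for k
    unfolding N_def by (rule mart_sum_measurable mart_sum_integrable mart_sum_mean; use g Hm Hi in blast)+
  have NV: "expectation (\<lambda>\<omega>. (N k \<omega>)\<^sup>2) \<le> 2 * a\<^sup>2" for k
  proof -
    let ?h = "t / real (Suc k)"
    have "expectation (\<lambda>\<omega>. (N k \<omega>)\<^sup>2) \<le> (\<Sum>i<Suc k. expectation (\<lambda>\<omega>. (norm (H k i \<omega>))\<^sup>2) * (n * ?h))"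
      unfolding N_def using mart_sum_variance[OF g Hm Hi, of k "Suc k"] unfolding grid_step n .
    also have "\<dots> \<le> (\<Sum>i<Suc k. 4 * (rate * (real i * ?h)) * (n * ?h))"
      using Hb[of k] t n_pos by (intro sum_mono mult_right_mono) (auto simp: grid_def)
    also have "\<dots> = 4 * rate * n * ?h\<^sup>2 * (\<Sum>i<Suc k. real i)"
      unfolding sum_distrib_left by (intro sum.cong refl) (simp add: power2_eq_square mult_ac)
    also have "\<dots> \<le> 4 * rate * n * ?h\<^sup>2 * ((real (Suc k))\<^sup>2 / 2)"
      using n_pos \<sigma>_nonneg by (intro mult_left_mono sum_grid_triangular) auto
    also have "\<dots> = 2 * (a * (n * t))"
      by (simp add: a_def power_divide power2_eq_square del: of_nat_Suc)
    also have "\<dots> \<le> 2 * (a * a)" using a by (intro mult_left_mono) auto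
    finally show ?thesis by (simp add: power2_eq_square)
  qed
  have Q [measurable]: "Q k \<in> borel_measurable M" and Qi: "integrable M (\<lambda>\<omega>. (Q k \<omega>)\<^sup>2)" and Q1: "expectation (Q k) \<le> n * t" for k
    unfolding Q_def using quad_sum_measurable[OF g] quad_sum_integrable[OF g] quad_sum_grid(1)[OF t] by auto
  have i1: "integrable M (N k)" "integrable M (Q k)" for k by (rule square_integrable_imp_integrable[OF N Ni] square_integrable_imp_integrable[OF Q Qi])+
  have Qsi: "integrable M (\<lambda>\<omega>. (\<sigma> * t + Q k \<omega>)\<^sup>2)" for k
    by (rule integrable_sum_square) (use Qi in auto)
  have QV: "expectation (\<lambda>\<omega>. (\<sigma> * t + Q k \<omega>)\<^sup>2) \<le> a\<^sup>2 + C4 * (t\<^sup>2 / real (Suc k))" for k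
  proof -
    have "expectation (\<lambda>\<omega>. (\<sigma> * t + Q k \<omega>)\<^sup>2) = (\<sigma> * t)\<^sup>2 + 2 * expectation (\<lambda>\<omega>. \<sigma> * t * Q k \<omega>) + expectation (\<lambda>\<omega>. (Q k \<omega>)\<^sup>2)"
      using integrable_sum_square(2)[of "\<lambda>_. \<sigma> * t" "Q k"] Qi by (simp add: prob_space)
    also have "expectation (\<lambda>\<omega>. \<sigma> * t * Q k \<omega>) = \<sigma> * t * expectation (Q k)" by simp
    also have "(\<sigma> * t)\<^sup>2 + 2 * (\<sigma> * t * expectation (Q k)) + expectation (\<lambda>\<omega>. (Q k \<omega>)\<^sup>2)
       \<le> (\<sigma> * t)\<^sup>2 + 2 * (\<sigma> * t * (n * t)) + ((n * t)\<^sup>2 + C4 * (t\<^sup>2 / real (Suc k)))"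
      using a(3) Q1[of k] quad_sum_grid(2)[OF t, of k] unfolding Q_def
      by (intro add_mono order.refl mult_left_mono) auto
    also have "\<dots> = a\<^sup>2 + C4 * (t\<^sup>2 / real (Suc k))" unfolding a(4)[symmetric] power2_sum by simp
    finally show ?thesis .
  qed
  have Sm [measurable]: "S k \<in> borel_measurable M" for k unfolding S_def by measurable
  have Si: "integrable M (\<lambda>\<omega>. (S k \<omega>)\<^sup>2)" for k
    unfolding S_def by (rule integrable_sum_square) (use Qsi Ni in auto)
  have SV: "expectation (\<lambda>\<omega>. (S k \<omega>)\<^sup>2) \<le> ((1 + sqrt 2) * a)\<^sup>2 + (1 + sqrt 2) * (C4 * (t\<^sup>2 / real (Suc k)))" for k
  proof -
    have "expectation (\<lambda>\<omega>. (S k \<omega>)\<^sup>2) \<le> expectation (\<lambda>\<omega>. (1 + sqrt 2) * (\<sigma> * t + Q k \<omega>)\<^sup>2 + (1 + 1 / sqrt 2) * (N k \<omega>)\<^sup>2)"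
      using Si Qsi Ni unfolding S_def by (intro integral_mono square_sum_le_weighted) auto
    also have "\<dots> = (1 + sqrt 2) * expectation (\<lambda>\<omega>. (\<sigma> * t + Q k \<omega>)\<^sup>2) + (1 + 1 / sqrt 2) * expectation (\<lambda>\<omega>. (N k \<omega>)\<^sup>2)"
      using Qsi Ni by simp
    also have "\<dots> \<le> (1 + sqrt 2) * (a\<^sup>2 + C4 * (t\<^sup>2 / real (Suc k))) + (1 + 1 / sqrt 2) * (2 * a\<^sup>2)"
      by (intro add_mono mult_left_mono QV NV) auto
    also have "\<dots> = ((1 + sqrt 2) * a)\<^sup>2 + (1 + sqrt 2) * (C4 * (t\<^sup>2 / real (Suc k)))"
    proof -
      have "(1 + 1 / sqrt 2) * (2 * a\<^sup>2) = (2 + sqrt 2) * a\<^sup>2"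
        by (simp add: algebra_simps) (simp add: real_div_sqrt field_simps)
      moreover have "((1 + sqrt 2) * a)\<^sup>2 = (3 + 2 * sqrt 2) * a\<^sup>2" by (simp add: power_mult_distrib power2_sum)
      ultimately show ?thesis by (simp add: algebra_simps)
    qed
    finally show ?thesis .
  qed
  \<comment> \<open>The lower limit is taken of squares, so that Fatou's lemma bounds the second moment of \<open>R\<close> at once.\<close>
  define R2 where "R2 \<omega> = liminf (\<lambda>k. ennreal ((max 0 (S k \<omega>))\<^sup>2))" for \<omega>
  define R where "R \<omega> = sqrt (enn2real (R2 \<omega>))" for \<omega>
  have R2m [measurable]: "R2 \<in> borel_measurable M" unfolding R2_def by measurable
  have Rm [measurable]: "R \<in> borel_measurable M" unfolding R_def by measurable
  have R0: "0 \<le> R \<omega>" for \<omega> by (simp add: R_def)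
  have Rsq: "(R \<omega>)\<^sup>2 = enn2real (R2 \<omega>)" for \<omega> by (simp add: R_def)
  have lim0: "(\<lambda>k. 1 / real (Suc k)) \<longlonglongrightarrow> 0" using LIMSEQ_Suc[OF lim_1_over_n] by simp
  have "(\<integral>\<^sup>+\<omega>. R2 \<omega> \<partial>M) \<le> liminf (\<lambda>k. \<integral>\<^sup>+\<omega>. ennreal ((max 0 (S k \<omega>))\<^sup>2) \<partial>M)"
    unfolding R2_def by (rule nn_integral_liminf) measurable
  also have "\<dots> \<le> liminf (\<lambda>k. ennreal (((1 + sqrt 2) * a)\<^sup>2 + (1 + sqrt 2) * (C4 * (t\<^sup>2 * (1 / real (Suc k))))))"
  proof (intro Liminf_mono always_eventually allI)
    fix k
    have "(\<integral>\<^sup>+\<omega>. ennreal ((max 0 (S k \<omega>))\<^sup>2) \<partial>M) \<le> (\<integral>\<^sup>+\<omega>. ennreal ((S k \<omega>)\<^sup>2) \<partial>M)"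
      by (intro nn_integral_mono ennreal_leI) (auto simp: max_def)
    also have "\<dots> = ennreal (expectation (\<lambda>\<omega>. (S k \<omega>)\<^sup>2))" using Si by (intro nn_integral_eq_integral) auto
    also have "\<dots> \<le> ennreal (((1 + sqrt 2) * a)\<^sup>2 + (1 + sqrt 2) * (C4 * (t\<^sup>2 * (1 / real (Suc k)))))"
      by (rule ennreal_leI) (use SV[of k] in simp)
    finally show "(\<integral>\<^sup>+\<omega>. ennreal ((max 0 (S k \<omega>))\<^sup>2) \<partial>M)
      \<le> ennreal (((1 + sqrt 2) * a)\<^sup>2 + (1 + sqrt 2) * (C4 * (t\<^sup>2 * (1 / real (Suc k)))))" .
  qed
  also have "\<dots> = ennreal (((1 + sqrt 2) * a)\<^sup>2 + (1 + sqrt 2) * (C4 * (t\<^sup>2 * 0)))"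
    by (intro lim_imp_Liminf tendsto_ennrealI tendsto_intros lim0) simp
  finally have R2I: "(\<integral>\<^sup>+\<omega>. R2 \<omega> \<partial>M) \<le> ennreal (((1 + sqrt 2) * a)\<^sup>2)" by simp
  then have "(\<integral>\<^sup>+\<omega>. R2 \<omega> \<partial>M) \<noteq> \<infinity>" by (auto simp: top_unique)
  then have fin: "AE \<omega> in M. R2 \<omega> \<noteq> \<infinity>" by (rule nn_integral_PInf_AE[rotated]) measurable
  have RI: "(\<integral>\<^sup>+\<omega>. ennreal ((R \<omega>)\<^sup>2) \<partial>M) \<le> ennreal (((1 + sqrt 2) * a)\<^sup>2)"
  proof -
    have "(\<integral>\<^sup>+\<omega>. ennreal ((R \<omega>)\<^sup>2) \<partial>M) = (\<integral>\<^sup>+\<omega>. R2 \<omega> \<partial>M)"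
      unfolding Rsq by (intro nn_integral_cong_AE) (use fin in eventually_elim, auto simp: less_top)
    then show ?thesis using R2I by simp
  qed
  have Ri: "integrable M (\<lambda>\<omega>. (R \<omega>)\<^sup>2)"
    using RI by (intro integrableI_bounded) (auto simp: less_top[symmetric] top_unique)
  have RV: "expectation (\<lambda>\<omega>. (R \<omega>)\<^sup>2) \<le> ((1 + sqrt 2) * a)\<^sup>2"
    using RI by (simp add: nn_integral_eq_integral[OF Ri])
  have path: "\<forall>\<^sub>F k in sequentially. 2 * r * (\<Lambda> t - \<Lambda> 0) \<le> S k \<omega> + \<epsilon>" if "local_time \<omega> \<Lambda>" "0 < \<epsilon>" for \<omega> \<Lambda> \<epsilon>
    using energy_path_bound[OF that(1) t that(2) order.refl]
  proof eventually_elim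
    case (elim k)
    have "0 \<le> tame 0 (Z t \<omega>)" by (simp add: tame_def)
    then show ?case using elim unfolding S_def N_def Q_def H_def by simp
  qed
  have path0: "0 \<le> 2 * r * (\<Lambda> t - \<Lambda> 0)" if "local_time \<omega> \<Lambda>" for \<omega> \<Lambda>
    using local_time_mono[OF that, of 0 t] t r by simp
  have dom: "AE \<omega> in M. \<forall>\<Lambda>. local_time \<omega> \<Lambda> \<longrightarrow> 2 * r * (\<Lambda> t - \<Lambda> 0) \<le> R \<omega>"
    using fin
  proof (eventually_elim, intro allI impI)
    fix \<omega> \<Lambda> assume f: "R2 \<omega> \<noteq> \<infinity>" and lt: "local_time \<omega> \<Lambda>"
    show "2 * r * (\<Lambda> t - \<Lambda> 0) \<le> R \<omega>"
    proof (rule field_le_epsilon)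
      fix \<epsilon> :: real assume e: "0 < \<epsilon>"
      define y where "y = max 0 (2 * r * (\<Lambda> t - \<Lambda> 0) - \<epsilon>)"
      have "ennreal (y\<^sup>2) \<le> R2 \<omega>" unfolding R2_def
      proof (rule Liminf_bounded)
        show "\<forall>\<^sub>F k in sequentially. ennreal (y\<^sup>2) \<le> ennreal ((max 0 (S k \<omega>))\<^sup>2)"
          using path[OF lt e] by eventually_elim (auto simp: y_def intro!: ennreal_leI power_mono)
      qed
      also have "R2 \<omega> = ennreal ((R \<omega>)\<^sup>2)" using f by (simp add: Rsq less_top)
      finally have "y\<^sup>2 \<le> (R \<omega>)\<^sup>2" by simp
      then have "y \<le> R \<omega>" using R0 by (rule power2_le_imp_le)
      then show "2 * r * (\<Lambda> t - \<Lambda> 0) \<le> R \<omega> + \<epsilon>" by (simp add: y_def)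
    qed
  qed
  have ER: "(\<integral>\<^sup>+\<omega>. ennreal (R \<omega>) \<partial>M) \<le> ennreal (expectation (\<lambda>_. 0) + a)"
  proof (rule nn_integral_le_of_L2_bounded[of _ _ S])
    show "expectation (\<lambda>\<omega>. (S k \<omega>)\<^sup>2) \<le> ((1 + sqrt 2) * a)\<^sup>2 + (1 + sqrt 2) * (C4 * t\<^sup>2)" for k
    proof -
      have "t\<^sup>2 / real (Suc k) \<le> t\<^sup>2" using t by (simp add: divide_le_eq mult_le_cancel_left1)
      then have "(1 + sqrt 2) * (C4 * (t\<^sup>2 / real (Suc k))) \<le> (1 + sqrt 2) * (C4 * t\<^sup>2)" by (intro mult_left_mono) auto
      then show ?thesis using SV[of k] by linarith
    qed
    show "expectation (S k) \<le> a" for k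
      using i1[of k] N0[of k] Q1[of k] a(4) unfolding S_def by (simp add: prob_space)
    show "AE \<omega> in M. \<forall>\<epsilon>>0. \<forall>\<^sub>F k in sequentially. R \<omega> \<le> 0 + S k \<omega> + \<epsilon>"
      using fin AE_local_time
    proof (eventually_elim, intro allI impI)
      fix \<omega> and \<epsilon> :: real assume f: "R2 \<omega> \<noteq> \<infinity>" and lt: "\<exists>\<Lambda>. local_time \<omega> \<Lambda>" and e: "0 < \<epsilon>"
      obtain \<Lambda> where \<Lambda>: "local_time \<omega> \<Lambda>" using lt ..
      \<comment> \<open>Where \<open>R\<close> is small, a lower bound on \<open>S k\<close> is needed; it holds because the local time is nonnegative.\<close>
      have ev0: "\<forall>\<^sub>F k in sequentially. 0 \<le> S k \<omega> + \<epsilon> / 2"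
        using path[OF \<Lambda>, of "\<epsilon> / 2"] e by (auto elim!: eventually_mono intro: order.trans[OF path0[OF \<Lambda>]])
      show "\<forall>\<^sub>F k in sequentially. R \<omega> \<le> 0 + S k \<omega> + \<epsilon>"
      proof (cases "R \<omega> \<le> \<epsilon> / 2")
        case True
        then show ?thesis using ev0 by (auto elim!: eventually_mono)
      next
        case False
        then have "(R \<omega> - \<epsilon> / 2)\<^sup>2 < (R \<omega>)\<^sup>2" using e by (intro power_strict_mono) auto
        then have "ennreal ((R \<omega> - \<epsilon> / 2)\<^sup>2) < R2 \<omega>"
          using f by (subst (asm) Rsq) (simp add: ennreal_less_iff[symmetric] less_top)
        then have "\<forall>\<^sub>F k in sequentially. ennreal ((R \<omega> - \<epsilon> / 2)\<^sup>2) < ennreal ((max 0 (S k \<omega>))\<^sup>2)"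
          unfolding R2_def by (rule less_LiminfD)
        then show ?thesis
        proof eventually_elim
          case (elim k)
          then have "(R \<omega> - \<epsilon> / 2)\<^sup>2 < (max 0 (S k \<omega>))\<^sup>2" by (simp add: ennreal_less_iff)
          then have "R \<omega> - \<epsilon> / 2 < max 0 (S k \<omega>)" by (rule power2_less_imp_less) simp
          then show ?case using False e by (auto simp: max_def split: if_splits)
        qed
      qed
    qed
  qed (use R0 Si in auto)
  have Ri1: "integrable M R" using square_integrable_imp_integrable[OF Rm Ri] .
  have "expectation R \<le> a" using ER a(1) R0 by (simp add: nn_integral_eq_integral[OF Ri1])
  then show ?thesis using that[OF Rm R0 Ri RV[unfolded a_def] _ dom] by (simp add: a_def)
qed

end

section \<open>Synchronous coupling with the algorithm\<close>

lemma borel_measurable_closest_point: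
  fixes K :: "'a::euclidean_space set"
  assumes "closed K" "convex K" "K \<noteq> {}"
  shows "closest_point K \<in> borel_measurable borel"
  by (intro borel_measurable_continuous_onI continuous_on_closest_point assms)

lemma sum_by_parts_inner:
  fixes b f :: "nat \<Rightarrow> 'a::real_inner"
  assumes "b 0 = 0" "f 0 = 0"
  shows "(\<Sum>i<p. b (Suc i) \<bullet> (f (Suc i) - f i)) = b p \<bullet> f p - (\<Sum>i<p. f i \<bullet> (b (Suc i) - b i))"
  using assms by (induction p) (simp_all add: inner_diff_right inner_commute algebra_simps)

text \<open>Linear bookkeeping for \<open>coupling_block\<close> and \<open>coupling_path_bound\<close>,
  with the long products of these lemmas abstracted to variables.\<close>

lemma coupling_block_arith:
  fixes E1 :: real
  shows "E1 - E0 \<le> S + c + 2 * (x - b) + y + z \<Longrightarrow> x \<le> u \<Longrightarrow> E0 = G0 \<Longrightarrow> G1 \<le> E1 \<Longrightarrow> v = 2 * u + y \<Longrightarrow> z = z'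
      \<Longrightarrow> G1 \<le> G0 + (S - 2 * b) + c + v + z'"
  unfolding right_diff_distrib by linarith

lemma coupling_sum_arith:
  fixes a :: real
  shows "a \<le> b \<Longrightarrow> G1 \<le> G0 + y + c + a + z \<Longrightarrow> B = b + B0 \<Longrightarrow> C = C0 + (c + z) \<Longrightarrow> G0 \<le> S + C0 + B0 \<Longrightarrow>
        G1 \<le> (S + y) + C + B"
  by linarith

context langevin
begin

definition noise :: "real \<Rightarrow> nat \<Rightarrow> 'w \<Rightarrow> 'a" where
  "noise \<eta> j \<omega> = incr ((real j - 1) * \<eta>) (real j * \<eta>) \<omega>"

definition chain :: "real \<Rightarrow> nat \<Rightarrow> 'w \<Rightarrow> 'a" where
  "chain \<eta> j \<omega> = langevin_algorithm K \<phi> \<eta> x0 (noise \<eta>) j \<omega>"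

lemma noise_Suc: "noise \<eta> (Suc j) \<omega> = incr (real j * \<eta>) (real j * \<eta> + \<eta>) \<omega>"
  by (simp add: noise_def algebra_simps)

lemma chain_0: "chain \<eta> 0 \<omega> = x0" by (simp add: chain_def)

lemma chain_Suc: "chain \<eta> (Suc j) \<omega> =
    closest_point K (chain \<eta> j \<omega> + noise \<eta> (Suc j) \<omega> - (\<eta> / 2) *\<^sub>R m (chain \<eta> j \<omega>))"
  by (simp add: chain_def)

lemma K_nonempty: "K \<noteq> {}" using x0 by auto

lemma chain_in_K: "chain \<eta> j \<omega> \<in> K"
  by (cases j) (auto simp: chain_0 chain_Suc x0 closest_point_in_set[OF K(1) K_nonempty])

lemma borel_measurable_m: "m \<in> borel_measurable borel"
  by (rule borel_measurable_min_subgradient[OF convex_\<phi>])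

lemma chain_measurable_F:
  assumes "0 < \<eta>" shows "chain \<eta> j \<in> borel_measurable (F (real j * \<eta>))"
proof (induction j)
  case 0
  then show ?case by (simp add: chain_def)
next
  case (Suc j)
  have le: "real j * \<eta> \<le> real (Suc j) * \<eta>" using assms by (intro mult_right_mono) auto
  have [measurable]: "chain \<eta> j \<in> borel_measurable (F (real (Suc j) * \<eta>))"
    by (rule measurable_F_mono[OF le Suc])
  have [measurable]: "noise \<eta> (Suc j) \<in> borel_measurable (F (real (Suc j) * \<eta>))"
    using incr_measurable_F[of "real j * \<eta>" "real (Suc j) * \<eta>"] le assms unfolding noise_def[abs_def] by simp
  have [measurable]: "(\<lambda>\<omega>. m (chain \<eta> j \<omega>)) \<in> borel_measurable (F (real (Suc j) * \<eta>))"
    by (rule measurable_compose[OF _ borel_measurable_m]) measurable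
  have "(\<lambda>\<omega>. chain \<eta> j \<omega> + noise \<eta> (Suc j) \<omega> - (\<eta> / 2) *\<^sub>R m (chain \<eta> j \<omega>)) \<in> borel_measurable (F (real (Suc j) * \<eta>))"
    by measurable
  from measurable_compose[OF this borel_measurable_closest_point[OF K(1,2) K_nonempty]] show ?case by (simp add: chain_Suc[abs_def])
qed

text \<open>The increment of \<open>\<Phi>\<close> since the start of the block \<open>j\<close>, of
  length \<open>\<eta>\<close>. It is cut off after the block to keep it bounded by the local
  time up to the end of the last block.\<close>

definition boundary_past :: "real \<Rightarrow> nat \<Rightarrow> nat \<Rightarrow> nat \<Rightarrow> 'w \<Rightarrow> 'a" where
  "boundary_past \<eta> q j i \<omega> = (if i < Suc q then \<Phi> (grid (real j * \<eta>) \<eta> q i) \<omega> - \<Phi> (real j * \<eta>) \<omega> else 0)"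

text \<open>Bounds the grid version of twice the pairing of the noise with the drift in the block
  \<open>j\<close>. The gradient along \<open>X\<close> is replaced by its bound
  \<open>L\<close>; the gradient at the state of the algorithm is kept, because this part has
  mean zero.\<close>

definition drift_sum :: "real \<Rightarrow> nat \<Rightarrow> nat \<Rightarrow> 'w \<Rightarrow> real" where
  "drift_sum \<eta> q j \<omega> = (\<Sum>i<Suc q. \<eta> / real (Suc q) *
      (L * norm (incr (real j * \<eta>) (grid (real j * \<eta>) \<eta> q (Suc i)) \<omega>)
       - incr (real j * \<eta>) (grid (real j * \<eta>) \<eta> q (Suc i)) \<omega> \<bullet> m (chain \<eta> j \<omega>)))"

text \<open>The martingale that summation by parts leaves from the pairing of the noise with
  \<open>d\<Phi>\<close> in the block \<open>j\<close>.\<close>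

definition boundary_sum :: "real \<Rightarrow> nat \<Rightarrow> nat \<Rightarrow> 'w \<Rightarrow> real" where
  "boundary_sum \<eta> q j = mart_sum (boundary_past \<eta> q j) (grid (real j * \<eta>) \<eta> q) (Suc q)"

text \<open>Summing \<open>path_coupling_step\<close> over a block and applying summation by parts to the
  pairing of the noise with \<open>d\<Phi>\<close>. At the end of the block the projection is
  nonexpansive and fixes \<open>X\<close>.\<close>

lemma coupling_block:
  assumes lt: "local_time \<omega> \<Lambda>" and \<eta>: "0 < \<eta>"
    and w: "\<And>s t u. 0 \<le> s \<Longrightarrow> t \<le> real (Suc j) * \<eta> \<Longrightarrow> t - s \<le> \<eta> / real (Suc q) \<Longrightarrow> u \<in> {s..t} \<Longrightarrow> norm (X u \<omega> - X t \<omega>) \<le> w"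
  shows "(norm (X (real (Suc j) * \<eta>) \<omega> - chain \<eta> (Suc j) \<omega>))\<^sup>2 \<le> (norm (X (real j * \<eta>) \<omega> - chain \<eta> j \<omega>))\<^sup>2
    + (drift_sum \<eta> q j \<omega> - 2 * boundary_sum \<eta> q j \<omega>) + L\<^sup>2 * \<eta>\<^sup>2 / 2 * (1 + 1 / real (Suc q))
    + (2 * norm (noise \<eta> (Suc j) \<omega>) + L * \<eta> + 2 * w) * (\<Lambda> (real (Suc j) * \<eta>) - \<Lambda> (real j * \<eta>)) + 2 * w * (L * \<eta>)"
proof -
  define s0 where "s0 = real j * \<eta>"
  define y where "y = chain \<eta> j \<omega>"
  define \<tau> where "\<tau> = grid s0 \<eta> q"
  define h where "h = \<eta> / real (Suc q)"
  define e where "e u = X u \<omega> - (y + incr s0 u \<omega> - ((u - s0) / 2) *\<^sub>R m y)" for u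
  define b where "b i = incr s0 (\<tau> i) \<omega>" for i
  define f where "f i = \<Phi> (\<tau> i) \<omega> - \<Phi> s0 \<omega>" for i
  define l where "l i = \<Lambda> (\<tau> (Suc i)) - \<Lambda> (\<tau> i)" for i
  have end_eq: "s0 + \<eta> = real (Suc j) * \<eta>" by (simp add: s0_def algebra_simps)
  have s0: "0 \<le> s0" using \<eta> by (simp add: s0_def)
  have h: "0 < h" using \<eta> by (simp add: h_def)
  have \<tau>: "\<tau> 0 = s0" "\<tau> (Suc q) = s0 + \<eta>" "s0 \<le> \<tau> i" "\<tau> i \<le> \<tau> (Suc i)" "\<tau> (Suc i) - \<tau> i = h" "\<tau> i - s0 = real i * h" for i
    using \<eta> by (auto simp: \<tau>_def h_def grid_ge grid_Suc_ge grid_step) (simp add: grid_def)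
  have \<tau>_end: "\<tau> (Suc i) \<le> s0 + \<eta>" if "i < Suc q" for i
    unfolding \<tau>_def using \<eta> that by (intro grid_le) auto
  have l: "0 \<le> l i" for i unfolding l_def using local_time_mono[OF lt order.trans[OF s0 \<tau>(3)] \<tau>(4)] by simp
  have one: "(norm (e (\<tau> (Suc i))))\<^sup>2 - (norm (e (\<tau> i)))\<^sup>2
      \<le> h * (L * norm (b (Suc i)) - b (Suc i) \<bullet> m y) + (L\<^sup>2 * h\<^sup>2) * real (Suc i)
        + 2 * (b (Suc i) \<bullet> (f (Suc i) - f i)) + (\<eta> * L + 2 * w) * l i + 2 * w * L * h" if i: "i < Suc q" for i
  proof -
    have "norm (X u \<omega> - X (\<tau> (Suc i)) \<omega>) \<le> w" if u: "u \<in> {\<tau> i..\<tau> (Suc i)}" for u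
      by (rule w[OF _ _ _ u]) (use s0 \<tau>(3)[of i] \<tau>(5)[of i] \<tau>_end[OF i] end_eq in \<open>auto simp: h_def\<close>)
    from path_coupling_step[OF lt s0 \<tau>(3,4) this chain_in_K e_def[unfolded y_def]]
    have "(norm (e (\<tau> (Suc i))))\<^sup>2 - (norm (e (\<tau> i)))\<^sup>2
      \<le> h * (L * norm (b (Suc i)) - b (Suc i) \<bullet> m y) + (real (Suc i) * h) * h * L\<^sup>2
        + 2 * (b (Suc i) \<bullet> (f (Suc i) - f i)) + (real (Suc i) * h) * L * l i + 2 * w * (L * h + l i)"
      unfolding \<tau>(5,6) y_def[symmetric] b_def[symmetric] l_def[symmetric] by (simp add: f_def)
    moreover have "(real (Suc i) * h) * L * l i \<le> \<eta> * L * l i"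
      using \<tau>_end[OF i] \<tau>(6)[of "Suc i"] L_nonneg l[of i] by (intro mult_right_mono) auto
    moreover have "(real (Suc i) * h) * h * L\<^sup>2 = (L\<^sup>2 * h\<^sup>2) * real (Suc i)" by (simp add: power2_eq_square)
    moreover have "2 * w * (L * h + l i) = 2 * w * L * h + 2 * w * l i" by (simp add: algebra_simps)
    moreover have "(\<eta> * L + 2 * w) * l i = \<eta> * L * l i + 2 * w * l i" by (simp add: algebra_simps)
    ultimately show ?thesis by linarith
  qed
  have "(norm (e (\<tau> (Suc q))))\<^sup>2 - (norm (e (\<tau> 0)))\<^sup>2 = (\<Sum>i<Suc q. (norm (e (\<tau> (Suc i))))\<^sup>2 - (norm (e (\<tau> i)))\<^sup>2)"
    by (rule sum_lessThan_telescope[symmetric])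
  also have "\<dots> \<le> (\<Sum>i<Suc q. h * (L * norm (b (Suc i)) - b (Suc i) \<bullet> m y) + (L\<^sup>2 * h\<^sup>2) * real (Suc i)
        + 2 * (b (Suc i) \<bullet> (f (Suc i) - f i)) + (\<eta> * L + 2 * w) * l i + 2 * w * L * h)"
    using one by (intro sum_mono) auto
  also have "\<dots> = (\<Sum>i<Suc q. h * (L * norm (b (Suc i)) - b (Suc i) \<bullet> m y)) + L\<^sup>2 * h\<^sup>2 * (\<Sum>i<Suc q. real (Suc i))
        + 2 * (\<Sum>i<Suc q. b (Suc i) \<bullet> (f (Suc i) - f i)) + (\<eta> * L + 2 * w) * (\<Sum>i<Suc q. l i) + (\<Sum>i<Suc q. 2 * w * L * h)"
    unfolding sum.distrib sum_distrib_left ..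
  also have "(\<Sum>i<Suc q. 2 * w * L * h) = 2 * w * L * \<eta>" unfolding h_def by (rule sum_grid_steps)
  also have "(\<Sum>i<Suc q. l i) = \<Lambda> (s0 + \<eta>) - \<Lambda> s0"
    unfolding l_def using sum_lessThan_telescope[of "\<lambda>i. \<Lambda> (\<tau> i)" "Suc q"] unfolding \<tau>(1,2) .
  also have "(\<Sum>i<Suc q. b (Suc i) \<bullet> (f (Suc i) - f i)) = b (Suc q) \<bullet> f (Suc q) - (\<Sum>i<Suc q. f i \<bullet> (b (Suc i) - b i))"
    by (rule sum_by_parts_inner) (simp_all add: b_def f_def \<tau>)
  also have "(\<Sum>i<Suc q. f i \<bullet> (b (Suc i) - b i)) = boundary_sum \<eta> q j \<omega>"
    unfolding boundary_sum_def mart_sum_def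
    by (intro sum.cong) (auto simp: boundary_past_def f_def b_def \<tau>_def s0_def)
  also have "(\<Sum>i<Suc q. h * (L * norm (b (Suc i)) - b (Suc i) \<bullet> m y)) = drift_sum \<eta> q j \<omega>"
    unfolding drift_sum_def h_def b_def \<tau>_def s0_def y_def ..
  also have "L\<^sup>2 * h\<^sup>2 * (\<Sum>i<Suc q. real (Suc i)) = L\<^sup>2 * \<eta>\<^sup>2 / 2 * (1 + 1 / real (Suc q))"
  proof -
    \<comment> \<open>The displacement by the gradient grows linearly within the block; this is half of the square, up to a relative error \<open>1 / Suc q\<close>.\<close>
    have "(\<Sum>i<p. real (Suc i)) = real p * (real p + 1) / 2" for p by (induction p) (simp_all add: field_simps)
    then have "(\<Sum>i<Suc q. real (Suc i)) = real (Suc q) * (real (Suc q) + 1) / 2" .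
    then show ?thesis unfolding h_def by (simp add: power2_eq_square field_simps del: sum.lessThan_Suc of_nat_Suc)
  qed
  also have "b (Suc q) \<bullet> f (Suc q) = noise \<eta> (Suc j) \<omega> \<bullet> (\<Phi> (s0 + \<eta>) \<omega> - \<Phi> s0 \<omega>)"
    by (simp add: b_def f_def \<tau> noise_Suc s0_def)
  finally have "(norm (e (\<tau> (Suc q))))\<^sup>2 - (norm (e (\<tau> 0)))\<^sup>2 \<le> drift_sum \<eta> q j \<omega> + L\<^sup>2 * \<eta>\<^sup>2 / 2 * (1 + 1 / real (Suc q))
     + 2 * (noise \<eta> (Suc j) \<omega> \<bullet> (\<Phi> (s0 + \<eta>) \<omega> - \<Phi> s0 \<omega>) - boundary_sum \<eta> q j \<omega>)
     + (\<eta> * L + 2 * w) * (\<Lambda> (s0 + \<eta>) - \<Lambda> s0) + 2 * w * L * \<eta>" .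
  moreover have "noise \<eta> (Suc j) \<omega> \<bullet> (\<Phi> (s0 + \<eta>) \<omega> - \<Phi> s0 \<omega>) \<le> norm (noise \<eta> (Suc j) \<omega>) * (\<Lambda> (s0 + \<eta>) - \<Lambda> s0)"
  proof -
    have "noise \<eta> (Suc j) \<omega> \<bullet> (\<Phi> (s0 + \<eta>) \<omega> - \<Phi> s0 \<omega>) \<le> norm (noise \<eta> (Suc j) \<omega>) * norm (\<Phi> (s0 + \<eta>) \<omega> - \<Phi> s0 \<omega>)"
      by (rule norm_cauchy_schwarz)
    also have "\<dots> \<le> norm (noise \<eta> (Suc j) \<omega>) * (\<Lambda> (s0 + \<eta>) - \<Lambda> s0)"
      using norm_boundary_increment[OF lt s0, of "s0 + \<eta>"] \<eta> by (intro mult_left_mono) auto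
    finally show ?thesis .
  qed
  moreover have "(norm (e (\<tau> 0)))\<^sup>2 = (norm (X s0 \<omega> - chain \<eta> j \<omega>))\<^sup>2" by (simp add: e_def \<tau> y_def)
  moreover have "(norm (X (s0 + \<eta>) \<omega> - chain \<eta> (Suc j) \<omega>))\<^sup>2 \<le> (norm (e (\<tau> (Suc q))))\<^sup>2"
  proof (rule power_mono)
    have "X (s0 + \<eta>) \<omega> \<in> K" using path_in_K[OF lt, of "s0 + \<eta>"] s0 \<eta> by simp
    then have "dist (X (s0 + \<eta>) \<omega>) (chain \<eta> (Suc j) \<omega>)
      \<le> dist (X (s0 + \<eta>) \<omega>) (y + noise \<eta> (Suc j) \<omega> - (\<eta> / 2) *\<^sub>R m y)"
      unfolding chain_Suc y_def[symmetric]
      using closest_point_lipschitz[OF K(2,1) K_nonempty, of "X (s0 + \<eta>) \<omega>" "y + noise \<eta> (Suc j) \<omega> - (\<eta> / 2) *\<^sub>R m y"]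
      by (simp add: closest_point_self)
    then show "norm (X (s0 + \<eta>) \<omega> - chain \<eta> (Suc j) \<omega>) \<le> norm (e (\<tau> (Suc q)))" unfolding e_def \<tau>(2) by (simp add: dist_norm noise_Suc s0_def)
  qed simp
  moreover have "(2 * norm (noise \<eta> (Suc j) \<omega>) + L * \<eta> + 2 * w) * (\<Lambda> (s0 + \<eta>) - \<Lambda> s0)
    = 2 * (norm (noise \<eta> (Suc j) \<omega>) * (\<Lambda> (s0 + \<eta>) - \<Lambda> s0)) + (\<eta> * L + 2 * w) * (\<Lambda> (s0 + \<eta>) - \<Lambda> s0)"
    by (simp add: algebra_simps)
  moreover have "2 * w * L * \<eta> = 2 * w * (L * \<eta>)" by simp
  ultimately have "(norm (X (s0 + \<eta>) \<omega> - chain \<eta> (Suc j) \<omega>))\<^sup>2 \<le> (norm (X s0 \<omega> - chain \<eta> j \<omega>))\<^sup>2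
    + (drift_sum \<eta> q j \<omega> - 2 * boundary_sum \<eta> q j \<omega>) + L\<^sup>2 * \<eta>\<^sup>2 / 2 * (1 + 1 / real (Suc q))
    + (2 * norm (noise \<eta> (Suc j) \<omega>) + L * \<eta> + 2 * w) * (\<Lambda> (s0 + \<eta>) - \<Lambda> s0) + 2 * w * (L * \<eta>)"
    by (rule coupling_block_arith)
  then show ?thesis by (simp only: end_eq) (simp only: s0_def)
qed

lemma coupling_path_bound:
  assumes lt: "local_time \<omega> \<Lambda>" and \<eta>: "0 < \<eta>" and \<Gamma>: "\<And>j. j < k \<Longrightarrow> norm (noise \<eta> (Suc j) \<omega>) \<le> \<Gamma>" and e: "0 < \<epsilon>"
  shows "\<forall>\<^sub>F q in sequentially. (norm (X (real k * \<eta>) \<omega> - chain \<eta> k \<omega>))\<^sup>2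
     \<le> (real k * (L\<^sup>2 * \<eta>\<^sup>2 / 2) + (2 * \<Gamma> + L * \<eta>) * (\<Lambda> (real k * \<eta>) - \<Lambda> 0))
       + (\<Sum>j<k. drift_sum \<eta> q j \<omega> - 2 * boundary_sum \<eta> q j \<omega>) + \<epsilon>"
proof -
  define D where "D = \<Lambda> (real k * \<eta>) - \<Lambda> 0"
  have D: "0 \<le> D" using local_time_mono[OF lt, of 0 "real k * \<eta>"] \<eta> by (simp add: D_def)
  define E where "E = 2 * D + 2 * (L * \<eta>) * real k"
  have E: "0 \<le> E" using D L_nonneg \<eta> by (simp add: E_def)
  \<comment> \<open>Half of \<open>\<epsilon>\<close> absorbs the oscillation of the path, the other half the relative error \<open>1 / Suc q\<close> of \<open>coupling_block\<close>.\<close>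
  define w where "w = \<epsilon> / 2 / (E + 1)"
  have w: "0 < w" using e E by (simp add: w_def)
  have "w * E \<le> w * (E + 1)" using w by (intro mult_left_mono) auto
  also have "\<dots> = \<epsilon> / 2"
  proof -
    have "E + 1 \<noteq> 0" using E by linarith
    then show ?thesis unfolding w_def by (rule nonzero_eq_divide_eq[THEN iffD1, OF _ refl])
  qed
  finally have wE: "w * E \<le> \<epsilon> / 2" .
  obtain \<delta> where \<delta>: "0 < \<delta>" "\<And>s t' u. 0 \<le> s \<Longrightarrow> t' \<le> real k * \<eta> \<Longrightarrow> t' - s \<le> \<delta> \<Longrightarrow> u \<in> {s..t'} \<Longrightarrow> norm (X u \<omega> - X t' \<omega>) \<le> w"
    using path_modulus[OF lt w, of "real k * \<eta>"] by metis
  from eventually_mesh_le[OF \<delta>(1), of \<eta>] eventually_mesh_le[of "\<epsilon> / 2" "real k * (L\<^sup>2 * \<eta>\<^sup>2 / 2)"] e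
  have "\<forall>\<^sub>F q in sequentially. \<eta> / real (Suc q) \<le> \<delta> \<and> real k * (L\<^sup>2 * \<eta>\<^sup>2 / 2) / real (Suc q) \<le> \<epsilon> / 2"
    by (simp add: eventually_conj_iff)
  then show ?thesis
  proof eventually_elim
    case (elim q)
    let ?c = "L\<^sup>2 * \<eta>\<^sup>2 / 2 * (1 + 1 / real (Suc q)) + 2 * w * (L * \<eta>)"
    have main: "(norm (X (real i * \<eta>) \<omega> - chain \<eta> i \<omega>))\<^sup>2
       \<le> (\<Sum>j<i. drift_sum \<eta> q j \<omega> - 2 * boundary_sum \<eta> q j \<omega>) + real i * ?c
        + (2 * \<Gamma> + L * \<eta> + 2 * w) * (\<Lambda> (real i * \<eta>) - \<Lambda> 0)" if "i \<le> k" for i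
      using that
    proof (induction i)
      case 0
      then show ?case using lt by (simp add: chain_0 local_time_def)
    next
      case (Suc i)
      have iT: "real (Suc i) * \<eta> \<le> real k * \<eta>" using Suc.prems \<eta> by (intro mult_right_mono) auto
      have mod: "norm (X u \<omega> - X t \<omega>) \<le> w"
        if "0 \<le> s" "t \<le> real (Suc i) * \<eta>" "t - s \<le> \<eta> / real (Suc q)" "u \<in> {s..t}" for s t u
        by (rule \<delta>(2)[OF that(1) order.trans[OF that(2) iT] order.trans[OF that(3)] that(4)]) (use elim in simp)
      let ?l = "\<Lambda> (real (Suc i) * \<eta>) - \<Lambda> (real i * \<eta>)"
      have "real i * \<eta> \<le> real (Suc i) * \<eta>" using \<eta> by (intro mult_right_mono) auto
      then have "0 \<le> ?l" using local_time_mono[OF lt, of "real i * \<eta>" "real (Suc i) * \<eta>"] \<eta> by simp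
      then have "(2 * norm (noise \<eta> (Suc i) \<omega>) + L * \<eta> + 2 * w) * ?l \<le> (2 * \<Gamma> + L * \<eta> + 2 * w) * ?l"
        using \<Gamma>[of i] Suc.prems by (intro mult_right_mono) auto
      moreover note coupling_block[OF lt \<eta> mod]
      moreover have "(2 * \<Gamma> + L * \<eta> + 2 * w) * (\<Lambda> (real (Suc i) * \<eta>) - \<Lambda> 0)
        = (2 * \<Gamma> + L * \<eta> + 2 * w) * ?l + (2 * \<Gamma> + L * \<eta> + 2 * w) * (\<Lambda> (real i * \<eta>) - \<Lambda> 0)"
        by (simp add: right_diff_distrib)
      moreover have "real (Suc i) * ?c = real i * ?c + ?c" by (simp only: of_nat_Suc[of i] distrib_right mult_1_left add.commute)
      moreover note Suc.IH[OF Suc_leD[OF Suc.prems]]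
      ultimately show ?case unfolding sum.lessThan_Suc by (rule coupling_sum_arith)
    qed
    have "real k * ?c + (2 * \<Gamma> + L * \<eta> + 2 * w) * D
      = real k * (L\<^sup>2 * \<eta>\<^sup>2 / 2) + real k * (L\<^sup>2 * \<eta>\<^sup>2 / 2) / real (Suc q) + (2 * \<Gamma> + L * \<eta>) * D + w * E"
      unfolding E_def by (simp add: algebra_simps add_divide_distrib)
    then show ?case using main[OF order.refl] elim wE unfolding D_def by linarith
  qed
qed

end

section \<open>Expectation of the coupled distance\<close>

text \<open>The difference of the two sides is a positive multiple of \<open>(v - u)\<^sup>2 (2 v +
  u)\<close>, where \<open>u = sqrt x\<close> and \<open>v = sqrt (x + h)\<close>.\<close>

lemma sqrt_increment_bound:
  fixes x h :: real
  assumes "0 \<le> x" "0 \<le> h"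
  shows "h * sqrt x \<le> 2 / 3 * ((sqrt (x + h)) ^ 3 - (sqrt x) ^ 3)"
proof -
  define u v where "u = sqrt x" and "v = sqrt (x + h)"
  have uv: "0 \<le> u" "0 \<le> v" "u\<^sup>2 = x" "v\<^sup>2 = x + h" using assms by (auto simp: u_def v_def)
  have "0 \<le> (v - u)\<^sup>2 * (2 * v + u)" using uv by simp
  also have "\<dots> = 2 * (v ^ 3 - u ^ 3) - 3 * ((v\<^sup>2 - u\<^sup>2) * u)"
    by (simp add: power2_eq_square power3_eq_cube algebra_simps)
  also have "v\<^sup>2 - u\<^sup>2 = h" using uv by simp
  finally show ?thesis unfolding u_def[symmetric] v_def[symmetric] by simp
qed

lemma sum_sqrt_bound:
  fixes h :: real
  assumes h: "0 \<le> h"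
  shows "(\<Sum>i<p. h * sqrt (real (Suc i) * h)) \<le> 2 / 3 * (sqrt (real p * h + h)) ^ 3"
proof -
  define f where "f i = 2 / 3 * (sqrt (real (Suc i) * h)) ^ 3" for i
  have "(\<Sum>i<p. h * sqrt (real (Suc i) * h)) \<le> (\<Sum>i<p. f (Suc i) - f i)"
  proof (rule sum_mono)
    fix i
    have "real (Suc (Suc i)) * h = real (Suc i) * h + h" by (simp add: algebra_simps)
    then show "h * sqrt (real (Suc i) * h) \<le> f (Suc i) - f i"
      using sqrt_increment_bound[of "real (Suc i) * h" h] h unfolding f_def by (simp add: right_diff_distrib)
  qed
  also have "\<dots> = f p - f 0" by (rule sum_lessThan_telescope)
  also have "\<dots> \<le> f p" using h by (simp add: f_def)
  also have "f p = 2 / 3 * (sqrt (real p * h + h)) ^ 3" by (simp add: f_def algebra_simps)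
  finally show ?thesis .
qed

context langevin
begin

lemma noise_gaussian: "0 < \<eta> \<Longrightarrow> centered_gaussian M \<eta> (noise \<eta> (Suc j))"
  using gaussian_increments[of "real j * \<eta>" "real j * \<eta> + \<eta>"] unfolding noise_Suc[abs_def] by simp

text \<open>The maximum of the noise norms is bounded by the logarithm of the sum of the exponential
  moments: with \<open>Y = (\<Sum>j<k. exp (|\<xi>\<^sub>j|\<^sup>2 / (4 \<eta>)))\<close>,
  every \<open>|\<xi>\<^sub>j|\<^sup>2\<close> is at most \<open>4 \<eta> ln Y\<close>, and
  \<open>E Y = k 2 powr (n / 2)\<close>. Concavity of the logarithm gives the bound.\<close>

lemma noise_envelope:
  assumes \<eta>: "0 < \<eta>" and k: "1 \<le> k"
  obtains \<Gamma> where "\<Gamma> \<in> borel_measurable M" "\<And>\<omega>. 0 \<le> \<Gamma> \<omega>" "\<And>\<omega> j. j < k \<Longrightarrow> norm (noise \<eta> (Suc j) \<omega>) \<le> \<Gamma> \<omega>"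
    "integrable M (\<lambda>\<omega>. (\<Gamma> \<omega>)\<^sup>2)" "expectation (\<lambda>\<omega>. (\<Gamma> \<omega>)\<^sup>2) \<le> 2 * \<eta> * (n + 2 * ln (real k))"
proof -
  define e where "e j \<omega> = exp ((norm (noise \<eta> (Suc j) \<omega>))\<^sup>2 / (4 * \<eta>))" for j \<omega>
  define Y where "Y \<omega> = (\<Sum>j<k. e j \<omega>)" for \<omega>
  define c where "c = real k * 2 powr (n / 2)"
  have c: "0 < c" using k by (simp add: c_def)
  have nm [measurable]: "noise \<eta> (Suc j) \<in> borel_measurable M" for j by (rule gaussian_measurable[OF noise_gaussian[OF \<eta>] \<eta>])
  have em [measurable]: "e j \<in> borel_measurable M" for j unfolding e_def by measurable
  have eI: "(\<integral>\<^sup>+\<omega>. ennreal (e j \<omega>) \<partial>M) = ennreal (2 powr (n / 2))" for j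
    using gaussian_exp_moment[OF noise_gaussian[OF \<eta>] \<eta>, of 2 j] by (simp add: e_def n)
  have ei: "integrable M (e j)" for j using eI by (intro integrableI_bounded) (auto simp: e_def)
  have eE: "expectation (e j) = 2 powr (n / 2)" for j
    using eI[of j] by (subst (asm) nn_integral_eq_integral[OF ei]) (auto simp: e_def)
  have Yi: "integrable M Y" unfolding Y_def[abs_def] using ei by simp
  have YE: "expectation Y = c" unfolding Y_def[abs_def] c_def using ei eE by simp
  have e1: "1 \<le> e j \<omega>" for j \<omega> using \<eta> by (simp add: e_def)
  have eY: "e j \<omega> \<le> Y \<omega>" if "j < k" for j \<omega>
    unfolding Y_def using that e1 by (intro member_le_sum) (auto intro: order.trans[of 0 1])
  have Y1: "1 \<le> Y \<omega>" for \<omega> using order.trans[OF e1 eY[of 0]] k by simp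
  define \<Gamma> where "\<Gamma> \<omega> = sqrt (4 * \<eta> * ln (Y \<omega>))" for \<omega>
  have sq: "(\<Gamma> \<omega>)\<^sup>2 = 4 * \<eta> * ln (Y \<omega>)" for \<omega> using \<eta> Y1[of \<omega>] by (simp add: \<Gamma>_def)
  have [measurable]: "Y \<in> borel_measurable M" unfolding Y_def[abs_def] by measurable
  have \<Gamma>m: "\<Gamma> \<in> borel_measurable M" unfolding \<Gamma>_def[abs_def] by measurable
  have bound: "norm (noise \<eta> (Suc j) \<omega>) \<le> \<Gamma> \<omega>" if "j < k" for j \<omega>
  proof (rule power2_le_imp_le)
    have "(norm (noise \<eta> (Suc j) \<omega>))\<^sup>2 / (4 * \<eta>) = ln (e j \<omega>)" by (simp add: e_def)
    also have "\<dots> \<le> ln (Y \<omega>)" using eY[OF that, of \<omega>] e1[of j \<omega>] by (intro ln_mono) auto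
    finally show "(norm (noise \<eta> (Suc j) \<omega>))\<^sup>2 \<le> (\<Gamma> \<omega>)\<^sup>2" unfolding sq using \<eta> by (simp add: field_simps)
    show "0 \<le> \<Gamma> \<omega>" using \<eta> Y1[of \<omega>] by (simp add: \<Gamma>_def)
  qed
  have ln_le: "ln (Y \<omega>) \<le> Y \<omega> / c - 1 + ln c" for \<omega>
    using ln_le_minus_one[of "Y \<omega> / c"] c Y1[of \<omega>] by (simp add: ln_div)
  have sqi: "integrable M (\<lambda>\<omega>. (\<Gamma> \<omega>)\<^sup>2)" unfolding sq
  proof (intro integrable_mult_right Bochner_Integration.integrable_bound[OF Yi])
    show "AE \<omega> in M. norm (ln (Y \<omega>)) \<le> norm (Y \<omega>)"
      using Y1 ln_le_minus_one[of "Y _"] by (intro AE_I2) (smt (verit) ln_ge_zero real_norm_def)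
  qed measurable
  have "expectation (\<lambda>\<omega>. (\<Gamma> \<omega>)\<^sup>2) \<le> expectation (\<lambda>\<omega>. 4 * \<eta> * (Y \<omega> / c - 1 + ln c))"
    unfolding sq using sqi[unfolded sq] Yi ln_le \<eta> by (intro integral_mono mult_left_mono) auto
  also have "\<dots> = 4 * \<eta> * (c / c - 1 + ln c)" using Yi YE by (simp add: prob_space)
  also have "\<dots> = 4 * \<eta> * ln (real k) + 2 * \<eta> * n * ln 2" using c k by (simp add: c_def ln_mult ln_powr algebra_simps)
  also have "\<dots> \<le> 4 * \<eta> * ln (real k) + 2 * \<eta> * n * 1"
    using ln_2_less_1 \<eta> n_pos by (intro add_left_mono mult_left_mono) auto
  also have "\<dots> = 2 * \<eta> * (n + 2 * ln (real k))" by (simp add: algebra_simps)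
  finally have E: "expectation (\<lambda>\<omega>. (\<Gamma> \<omega>)\<^sup>2) \<le> 2 * \<eta> * (n + 2 * ln (real k))" .
  have "0 \<le> \<Gamma> \<omega>" for \<omega> using \<eta> Y1[of \<omega>] by (simp add: \<Gamma>_def)
  then show ?thesis using that[OF \<Gamma>m _ bound sqi E] by blast
qed

lemma expectation_norm_le:
  fixes b :: "'w \<Rightarrow> 'a"
  assumes b: "b \<in> borel_measurable M" "integrable M (\<lambda>\<omega>. (norm (b \<omega>))\<^sup>2)" and v: "expectation (\<lambda>\<omega>. (norm (b \<omega>))\<^sup>2) \<le> v\<^sup>2" "0 < v"
  shows "integrable M (\<lambda>\<omega>. norm (b \<omega>))" "expectation (\<lambda>\<omega>. norm (b \<omega>)) \<le> v"
proof -
  show i: "integrable M (\<lambda>\<omega>. norm (b \<omega>))"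
    by (rule square_integrable_imp_integrable) (use b in auto)
  have "norm z \<le> ((norm z)\<^sup>2 / v + v) / 2" for z :: 'a
    using sum_squares_bound[of "norm z" v] v by (simp add: field_simps power2_eq_square)
  then have "expectation (\<lambda>\<omega>. norm (b \<omega>)) \<le> expectation (\<lambda>\<omega>. ((norm (b \<omega>))\<^sup>2 / v + v) / 2)"
    using i b by (intro integral_mono) auto
  also have "\<dots> = (expectation (\<lambda>\<omega>. (norm (b \<omega>))\<^sup>2) / v + v) / 2" using b by (simp add: prob_space)
  also have "\<dots> \<le> (v\<^sup>2 / v + v) / 2" using v by (intro divide_right_mono add_right_mono) auto
  also have "\<dots> = v" using v by (simp add: power2_eq_square)
  finally show "expectation (\<lambda>\<omega>. norm (b \<omega>)) \<le> v" .
qed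

text \<open>The gradient at the start of the block is independent of the later noise, so only \<open>L E|B
  u - B s| \<le> L sqrt (n (u - s))\<close> contributes to the mean; its integral over the block
  is \<open>2/3 L sqrt n (sqrt \<eta>)^3\<close>.\<close>

lemma drift_sum:
  assumes \<eta>: "0 < \<eta>"
  shows "drift_sum \<eta> q j \<in> borel_measurable M"
    and "integrable M (\<lambda>\<omega>. (drift_sum \<eta> q j \<omega>)\<^sup>2)"
    and "expectation (\<lambda>\<omega>. (drift_sum \<eta> q j \<omega>)\<^sup>2) \<le> 4 * L\<^sup>2 * n * \<eta> ^ 3"
    and "expectation (drift_sum \<eta> q j) \<le> L * sqrt n * (2 / 3 * (sqrt (\<eta> + \<eta> * (1 / real (Suc q)))) ^ 3)"
proof -
  define s where "s = real j * \<eta>"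
  define h where "h = \<eta> / real (Suc q)"
  define b where "b i \<omega> = incr s (grid s \<eta> q (Suc i)) \<omega>" for i \<omega>
  define a where "a \<omega> = m (chain \<eta> j \<omega>)" for \<omega>
  define d where "d i \<omega> = h * (L * norm (b i \<omega>) - b i \<omega> \<bullet> a \<omega>)" for i \<omega>
  have s: "0 \<le> s" using \<eta> by (simp add: s_def)
  have h: "0 < h" "real (Suc q) * h = \<eta>" using \<eta> by (simp_all add: h_def)
  have gs: "grid s \<eta> q (Suc i) - s = real (Suc i) * h" "s < grid s \<eta> q (Suc i)" for i
    using h(1) by (simp_all add: grid_def h_def[symmetric] del: of_nat_Suc)
  have ds: "drift_sum \<eta> q j = (\<lambda>\<omega>. \<Sum>i<Suc q. d i \<omega>)"
    unfolding drift_sum_def[abs_def] d_def b_def a_def s_def h_def ..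
  have aF: "a \<in> borel_measurable (F s)"
    unfolding a_def s_def by (rule measurable_compose[OF chain_measurable_F[OF \<eta>] borel_measurable_m])
  then have am [measurable]: "a \<in> borel_measurable M" by (rule measurable_F)
  have aL: "norm (a \<omega>) \<le> L" for \<omega> unfolding a_def by (rule norm_m[OF chain_in_K])
  have ai: "integrable M (\<lambda>\<omega>. (norm (a \<omega>))\<^sup>2)"
    by (rule integrable_const_bound[of _ "L\<^sup>2"]) (use aL in \<open>auto intro!: power_mono\<close>)
  have g: "centered_gaussian M (real (Suc i) * h) (b i)" for i
    using gaussian_increments[OF s gs(2), of i] unfolding gs(1) b_def .
  have v: "0 < real (Suc i) * h" for i using h by simp
  have bm [measurable]: "b i \<in> borel_measurable M" for i by (rule gaussian_measurable[OF g v])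
  have bi: "integrable M (\<lambda>\<omega>. (norm (b i \<omega>))\<^sup>2)" for i by (rule gaussian_square_integrable[OF g v])
  have bE: "expectation (\<lambda>\<omega>. (norm (b i \<omega>))\<^sup>2) \<le> n * (real (Suc i) * h)" for i
    unfolding n by (rule gaussian_second_moment[OF g v])
  have dm [measurable]: "d i \<in> borel_measurable M" for i unfolding d_def by measurable
  have da: "\<bar>d i \<omega>\<bar> \<le> h * (2 * L * norm (b i \<omega>))" for i \<omega>
  proof -
    have "\<bar>b i \<omega> \<bullet> a \<omega>\<bar> \<le> norm (b i \<omega>) * L"
      using Cauchy_Schwarz_ineq2[of "b i \<omega>" "a \<omega>"] aL[of \<omega>] by (meson mult_left_mono norm_ge_zero order.trans)
    then have "\<bar>L * norm (b i \<omega>) - b i \<omega> \<bullet> a \<omega>\<bar> \<le> 2 * L * norm (b i \<omega>)"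
      using L_nonneg by (simp add: abs_le_iff mult.commute)
    then show ?thesis unfolding d_def using h by (simp add: abs_mult)
  qed
  have d2: "(d i \<omega>)\<^sup>2 \<le> 4 * L\<^sup>2 * h\<^sup>2 * (norm (b i \<omega>))\<^sup>2" for i \<omega>
  proof -
    have "\<bar>d i \<omega>\<bar>\<^sup>2 \<le> (h * (2 * L * norm (b i \<omega>)))\<^sup>2" by (intro power_mono da) simp
    then show ?thesis by (simp add: power_mult_distrib mult_ac)
  qed
  have d2i: "integrable M (\<lambda>\<omega>. (d i \<omega>)\<^sup>2)" for i
    by (rule Bochner_Integration.integrable_bound[OF integrable_mult_right[OF bi[of i], of "4 * L\<^sup>2 * h\<^sup>2"]]) (use d2 in auto)
  have d2E: "expectation (\<lambda>\<omega>. (d i \<omega>)\<^sup>2) \<le> 4 * L\<^sup>2 * h\<^sup>2 * (n * \<eta>)" if "i < Suc q" for i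
  proof -
    have "expectation (\<lambda>\<omega>. (d i \<omega>)\<^sup>2) \<le> expectation (\<lambda>\<omega>. 4 * L\<^sup>2 * h\<^sup>2 * (norm (b i \<omega>))\<^sup>2)"
      using d2i bi d2 by (intro integral_mono) auto
    also have "\<dots> = 4 * L\<^sup>2 * h\<^sup>2 * expectation (\<lambda>\<omega>. (norm (b i \<omega>))\<^sup>2)" by simp
    also have "\<dots> \<le> 4 * L\<^sup>2 * h\<^sup>2 * (n * \<eta>)"
    proof (intro mult_left_mono)
      have "real (Suc i) * h \<le> real (Suc q) * h" using that h by (intro mult_right_mono) auto
      then have "n * (real (Suc i) * h) \<le> n * \<eta>" unfolding h(2) using n_pos by (intro mult_left_mono) auto
      then show "expectation (\<lambda>\<omega>. (norm (b i \<omega>))\<^sup>2) \<le> n * \<eta>" using bE[of i] by linarith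
    qed simp
    finally show ?thesis .
  qed
  show "drift_sum \<eta> q j \<in> borel_measurable M" unfolding ds by measurable
  have sq: "(\<Sum>i<Suc q. d i \<omega>)\<^sup>2 \<le> real (Suc q) * (\<Sum>i<Suc q. (d i \<omega>)\<^sup>2)" for \<omega>
    using sum_squared_le_sum_of_squares[of "\<lambda>i. d i \<omega>" "{..<Suc q}"] by (simp only: card_lessThan mult.commute)
  have sumi: "integrable M (\<lambda>\<omega>. real (Suc q) * (\<Sum>i<Suc q. (d i \<omega>)\<^sup>2))"
    by (intro integrable_mult_right Bochner_Integration.integrable_sum d2i)
  show i2: "integrable M (\<lambda>\<omega>. (drift_sum \<eta> q j \<omega>)\<^sup>2)" unfolding ds
    by (rule Bochner_Integration.integrable_bound[OF sumi])
      (use sq in \<open>auto simp del: sum.lessThan_Suc of_nat_Suc simp: sum_nonneg\<close>)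
  have "expectation (\<lambda>\<omega>. (drift_sum \<eta> q j \<omega>)\<^sup>2) \<le> expectation (\<lambda>\<omega>. real (Suc q) * (\<Sum>i<Suc q. (d i \<omega>)\<^sup>2))"
    using i2 sumi unfolding ds by (intro integral_mono sq)
  also have "\<dots> = real (Suc q) * (\<Sum>i<Suc q. expectation (\<lambda>\<omega>. (d i \<omega>)\<^sup>2))"
    using d2i by (simp only: integral_mult_right_zero Bochner_Integration.integral_sum)
  also have "\<dots> \<le> real (Suc q) * (\<Sum>i<Suc q. 4 * L\<^sup>2 * h\<^sup>2 * (n * \<eta>))"
    using d2E by (intro mult_left_mono sum_mono) auto
  also have "\<dots> = 4 * L\<^sup>2 * n * \<eta> * (real (Suc q) * h)\<^sup>2"
    by (simp add: power2_eq_square del: sum.lessThan_Suc of_nat_Suc)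
  also have "\<dots> = 4 * L\<^sup>2 * n * \<eta> ^ 3" unfolding h(2) by (simp add: power2_eq_square power3_eq_cube)
  finally show "expectation (\<lambda>\<omega>. (drift_sum \<eta> q j \<omega>)\<^sup>2) \<le> 4 * L\<^sup>2 * n * \<eta> ^ 3" .
  have di: "integrable M (d i)" for i by (rule square_integrable_imp_integrable[OF dm d2i])
  have dE: "expectation (d i) \<le> L * sqrt n * (h * sqrt (real (Suc i) * h))" for i
  proof -
    have p1: "0 < sqrt (n * (real (Suc i) * h))" using n_pos v[of i] by simp
    have p2: "expectation (\<lambda>\<omega>. (norm (b i \<omega>))\<^sup>2) \<le> (sqrt (n * (real (Suc i) * h)))\<^sup>2"
      using bE[of i] n_pos v[of i] by (subst real_sqrt_pow2) (auto simp del: of_nat_Suc intro: mult_nonneg_nonneg)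
    have nb: "integrable M (\<lambda>\<omega>. norm (b i \<omega>))" "expectation (\<lambda>\<omega>. norm (b i \<omega>)) \<le> sqrt (n * (real (Suc i) * h))"
      by (rule expectation_norm_le[OF bm bi p2 p1])+
    have ip: "integrable M (\<lambda>\<omega>. b i \<omega> \<bullet> a \<omega>)" "expectation (\<lambda>\<omega>. b i \<omega> \<bullet> a \<omega>) = 0"
      using past_inner_increment[OF s gs(2)[of i] _ _ aF ai, of "\<lambda>_. 1"] by (simp_all add: b_def inner_commute)
    have "expectation (d i) = h * (L * expectation (\<lambda>\<omega>. norm (b i \<omega>)))"
      unfolding d_def using nb ip by simp
    also have "\<dots> \<le> h * (L * sqrt (n * (real (Suc i) * h)))"
      using nb h L_nonneg by (intro mult_left_mono) auto
    also have "\<dots> = L * sqrt n * (h * sqrt (real (Suc i) * h))" by (simp add: real_sqrt_mult)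
    finally show ?thesis .
  qed
  have "expectation (drift_sum \<eta> q j) = (\<Sum>i<Suc q. expectation (d i))"
    unfolding ds using di by (simp only: Bochner_Integration.integral_sum)
  also have "\<dots> \<le> (\<Sum>i<Suc q. L * sqrt n * (h * sqrt (real (Suc i) * h)))" by (intro sum_mono dE)
  also have "\<dots> = L * sqrt n * (\<Sum>i<Suc q. h * sqrt (real (Suc i) * h))" by (rule sum_distrib_left[symmetric])
  also have "\<dots> \<le> L * sqrt n * (2 / 3 * (sqrt (real (Suc q) * h + h)) ^ 3)"
    using L_nonneg n_pos h by (intro mult_left_mono sum_sqrt_bound) auto
  finally show "expectation (drift_sum \<eta> q j) \<le> L * sqrt n * (2 / 3 * (sqrt (\<eta> + \<eta> * (1 / real (Suc q)))) ^ 3)"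
    unfolding h(2) by (simp add: h_def)
qed

text \<open>Up to the end of the last block, the increments of \<open>\<Phi>\<close> are at most the local
  time, hence at most \<open>R / (2 r)\<close>; this bounds the integrands of the martingale sum
  in \<open>L\<^sup>2\<close>.\<close>

lemma boundary_sum:
  assumes \<eta>: "0 < \<eta>" and j: "j < k"
    and R: "R \<in> borel_measurable M" "integrable M (\<lambda>\<omega>. (R \<omega>)\<^sup>2)"
      "AE \<omega> in M. \<forall>\<Lambda>. local_time \<omega> \<Lambda> \<longrightarrow> 2 * r * (\<Lambda> (real k * \<eta>) - \<Lambda> 0) \<le> R \<omega>"
  shows "boundary_sum \<eta> q j \<in> borel_measurable M"
    and "integrable M (\<lambda>\<omega>. (boundary_sum \<eta> q j \<omega>)\<^sup>2)"
    and "expectation (boundary_sum \<eta> q j) = 0"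
    and "expectation (\<lambda>\<omega>. (boundary_sum \<eta> q j \<omega>)\<^sup>2) \<le> expectation (\<lambda>\<omega>. (R \<omega> / (2 * r))\<^sup>2) * n * \<eta>"
proof -
  define s where "s = real j * \<eta>"
  have s: "0 \<le> s" using \<eta> by (simp add: s_def)
  have sT: "s + \<eta> \<le> real k * \<eta>"
  proof -
    have "real (Suc j) * \<eta> \<le> real k * \<eta>" using j \<eta> by (intro mult_right_mono) auto
    then show ?thesis by (simp add: s_def algebra_simps)
  qed
  let ?g = "grid s \<eta> q" and ?H = "boundary_past \<eta> q j"
  have g: "0 \<le> ?g 0" "strict_mono ?g" using s strict_mono_grid[OF \<eta>] by auto
  have gi: "s \<le> ?g i" for i using \<eta> by (intro grid_ge) auto
  have Hm: "?H i \<in> borel_measurable (F (?g i))" for i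
  proof (cases "i < Suc q")
    case True
    have "\<Phi> (?g i) \<in> borel_measurable (F (?g i))" "\<Phi> s \<in> borel_measurable (F (?g i))"
      using \<Phi>_measurable_F[OF order.trans[OF s gi]] measurable_F_mono[OF gi \<Phi>_measurable_F[OF s]] by auto
    then show ?thesis using True unfolding boundary_past_def[abs_def] s_def[symmetric] by simp
  qed (simp add: boundary_past_def[abs_def])
  have Hb: "AE \<omega> in M. (norm (?H i \<omega>))\<^sup>2 \<le> (R \<omega> / (2 * r))\<^sup>2" for i
    using AE_local_time R(3)
  proof eventually_elim
    case (elim \<omega>)
    then obtain \<Lambda> where lt: "local_time \<omega> \<Lambda>" by blast
    have "2 * r * (\<Lambda> (real k * \<eta>) - \<Lambda> 0) \<le> R \<omega>" using elim(2) lt by blast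
    then have RD: "\<Lambda> (real k * \<eta>) - \<Lambda> 0 \<le> R \<omega> / (2 * r)" using r by (simp add: field_simps)
    show ?case
    proof (cases "i < Suc q")
      case True
      then have le: "?g i \<le> real k * \<eta>" using grid_le[of \<eta> i q s] \<eta> sT by simp
      have "norm (?H i \<omega>) \<le> \<Lambda> (?g i) - \<Lambda> s"
        using True norm_boundary_increment[OF lt s gi] by (simp add: boundary_past_def s_def)
      also have "\<dots> \<le> \<Lambda> (real k * \<eta>) - \<Lambda> 0"
        using local_time_mono[OF lt order.trans[OF s gi] le] local_time_mono[OF lt order.refl s] by linarith
      finally show ?thesis using RD by (intro power_mono) auto
    qed (simp add: boundary_past_def)
  qed
  have Ri: "integrable M (\<lambda>\<omega>. (R \<omega> / (2 * r))\<^sup>2)" using R(2) by (simp add: power_divide)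
  have [measurable]: "?H i \<in> borel_measurable M" for i using Hm by (rule measurable_F)
  have Hi: "integrable M (\<lambda>\<omega>. (norm (?H i \<omega>))\<^sup>2)" for i
    by (rule Bochner_Integration.integrable_bound[OF Ri]) (use Hb[of i] in auto)
  have HE: "expectation (\<lambda>\<omega>. (norm (?H i \<omega>))\<^sup>2) \<le> expectation (\<lambda>\<omega>. (R \<omega> / (2 * r))\<^sup>2)" for i
    by (rule integral_mono_AE[OF Hi Ri Hb])
  have bs: "boundary_sum \<eta> q j = mart_sum ?H ?g (Suc q)" by (simp add: boundary_sum_def s_def)
  note ms = mart_sum[OF g Hm Hi, of "Suc q", folded bs]
  show "boundary_sum \<eta> q j \<in> borel_measurable M" "integrable M (\<lambda>\<omega>. (boundary_sum \<eta> q j \<omega>)\<^sup>2)"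
    "expectation (boundary_sum \<eta> q j) = 0" using ms by auto
  have "expectation (\<lambda>\<omega>. (boundary_sum \<eta> q j \<omega>)\<^sup>2) \<le> (\<Sum>i<Suc q. expectation (\<lambda>\<omega>. (norm (?H i \<omega>))\<^sup>2) * (n * (\<eta> / real (Suc q))))"
    using ms(5) unfolding grid_step n .
  also have "\<dots> \<le> (\<Sum>i<Suc q. expectation (\<lambda>\<omega>. (R \<omega> / (2 * r))\<^sup>2) * (n * (\<eta> / real (Suc q))))"
    using HE n_pos \<eta> by (intro sum_mono mult_right_mono) auto
  also have "\<dots> = expectation (\<lambda>\<omega>. (R \<omega> / (2 * r))\<^sup>2) * n * \<eta>"
    using sum_grid_steps[of "expectation (\<lambda>\<omega>. (R \<omega> / (2 * r))\<^sup>2) * n"] by (simp only: mult.assoc)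
  finally show "expectation (\<lambda>\<omega>. (boundary_sum \<eta> q j \<omega>)\<^sup>2) \<le> expectation (\<lambda>\<omega>. (R \<omega> / (2 * r))\<^sup>2) * n * \<eta>" .
qed

lemma expectation_product_le:
  fixes f g :: "'w \<Rightarrow> real"
  assumes m: "f \<in> borel_measurable M" "g \<in> borel_measurable M"
    and i: "integrable M (\<lambda>\<omega>. (f \<omega>)\<^sup>2)" "integrable M (\<lambda>\<omega>. (g \<omega>)\<^sup>2)"
    and P: "expectation (\<lambda>\<omega>. (f \<omega>)\<^sup>2) \<le> P\<^sup>2" "0 < P" and Q: "expectation (\<lambda>\<omega>. (g \<omega>)\<^sup>2) \<le> Q\<^sup>2" "0 < Q"
  shows "expectation (\<lambda>\<omega>. f \<omega> * g \<omega>) \<le> P * Q"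
proof -
  have le: "x * y \<le> Q / P / 2 * x\<^sup>2 + P / Q / 2 * y\<^sup>2" for x y :: real
  proof -
    have "0 \<le> (Q * x - P * y)\<^sup>2 / (2 * P * Q)" using P Q by simp
    also have "\<dots> = Q / P / 2 * x\<^sup>2 + P / Q / 2 * y\<^sup>2 - x * y"
      using P Q by (simp add: power2_eq_square field_simps)
    finally show ?thesis by simp
  qed
  have "expectation (\<lambda>\<omega>. f \<omega> * g \<omega>) \<le> expectation (\<lambda>\<omega>. Q / P / 2 * (f \<omega>)\<^sup>2 + P / Q / 2 * (g \<omega>)\<^sup>2)"
    using integrable_product_of_squares[OF m i] i by (intro integral_mono le) auto
  also have "\<dots> = Q / P / 2 * expectation (\<lambda>\<omega>. (f \<omega>)\<^sup>2) + P / Q / 2 * expectation (\<lambda>\<omega>. (g \<omega>)\<^sup>2)" using i by simp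
  also have "\<dots> \<le> Q / P / 2 * P\<^sup>2 + P / Q / 2 * Q\<^sup>2" using P Q by (intro add_mono mult_left_mono) auto
  also have "\<dots> = P * Q" using P Q by (simp add: power2_eq_square)
  finally show ?thesis .
qed

text \<open>In \<open>W\<close> the local time is replaced by \<open>R / (2 r)\<close> and the largest
  noise norm by \<open>\<Gamma>\<close>; the product \<open>\<Gamma> R\<close> is controlled by
  the Cauchy-Schwarz inequality. The martingales \<open>boundary_sum\<close> have mean zero, and
  the sums \<open>S q\<close> are bounded in \<open>L\<^sup>2\<close> uniformly in the grid.\<close>

lemma coupling_bound:
  assumes \<eta>: "0 < \<eta>" and k: "1 \<le> k"
  defines "a \<equiv> rate * (real k * \<eta>)"
  shows "(\<integral>\<^sup>+\<omega>. ennreal ((norm (X (real k * \<eta>) \<omega> - chain \<eta> k \<omega>))\<^sup>2) \<partial>M)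
    \<le> ennreal (real k * (L\<^sup>2 * \<eta>\<^sup>2 / 2) + (sqrt (2 * \<eta> * (n + 2 * ln (real k))) * ((1 + sqrt 2) * a) + L * \<eta> * a / 2) / r
        + real k * (L * sqrt n * (2 / 3 * (sqrt \<eta>) ^ 3)))"
proof -
  define T where "T = real k * \<eta>"
  have T: "0 < T" using \<eta> k by (simp add: T_def)
  have a: "0 < a" using T n_pos \<sigma>_nonneg unfolding a_def T_def[symmetric] by (intro mult_pos_pos) auto
  have aT: "rate * T = a" by (simp add: a_def T_def)
  obtain R where R [measurable]: "R \<in> borel_measurable M" and R0: "\<And>\<omega>. 0 \<le> R \<omega>" and R2: "integrable M (\<lambda>\<omega>. (R \<omega>)\<^sup>2)"
    and R2E: "expectation (\<lambda>\<omega>. (R \<omega>)\<^sup>2) \<le> ((1 + sqrt 2) * a)\<^sup>2" and RE: "expectation R \<le> a"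
    and Rd: "AE \<omega> in M. \<forall>\<Lambda>. local_time \<omega> \<Lambda> \<longrightarrow> 2 * r * (\<Lambda> T - \<Lambda> 0) \<le> R \<omega>"
    by (rule local_time_bound[OF T, unfolded aT]) (rule that; assumption)
  obtain \<Gamma> where \<Gamma> [measurable]: "\<Gamma> \<in> borel_measurable M" and \<Gamma>0: "\<And>\<omega>. 0 \<le> \<Gamma> \<omega>"
    and \<Gamma>b: "\<And>\<omega> j. j < k \<Longrightarrow> norm (noise \<eta> (Suc j) \<omega>) \<le> \<Gamma> \<omega>" and \<Gamma>2: "integrable M (\<lambda>\<omega>. (\<Gamma> \<omega>)\<^sup>2)"
    and \<Gamma>E: "expectation (\<lambda>\<omega>. (\<Gamma> \<omega>)\<^sup>2) \<le> 2 * \<eta> * (n + 2 * ln (real k))"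
    by (rule noise_envelope[OF \<eta> k]) (rule that; assumption)
  define P where "P = sqrt (2 * \<eta> * (n + 2 * ln (real k)))"
  have lnk: "0 \<le> ln (real k)" using k by simp
  have P: "0 < P" "P\<^sup>2 = 2 * \<eta> * (n + 2 * ln (real k))" using \<eta> n_pos lnk by (auto simp: P_def)
  have Ri: "integrable M R" by (rule square_integrable_imp_integrable[OF R R2])
  have \<Gamma>Ri: "integrable M (\<lambda>\<omega>. \<Gamma> \<omega> * R \<omega>)" by (rule integrable_product_of_squares[OF \<Gamma> R \<Gamma>2 R2])
  have \<Gamma>RE: "expectation (\<lambda>\<omega>. \<Gamma> \<omega> * R \<omega>) \<le> P * ((1 + sqrt 2) * a)"
    by (rule expectation_product_le[OF \<Gamma> R \<Gamma>2 R2 _ P(1) R2E]) (use \<Gamma>E P a in \<open>auto intro!: mult_pos_pos add_pos_pos\<close>)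
  define c where "c = real k * (L\<^sup>2 * \<eta>\<^sup>2 / 2)"
  define W where "W \<omega> = c + (\<Gamma> \<omega> * R \<omega> + L * \<eta> / 2 * R \<omega>) / r" for \<omega>
  have Wi: "integrable M W" unfolding W_def using Ri \<Gamma>Ri by simp
  have WE: "expectation W \<le> c + (P * ((1 + sqrt 2) * a) + L * \<eta> / 2 * a) / r"
  proof -
    have "expectation W = c + (expectation (\<lambda>\<omega>. \<Gamma> \<omega> * R \<omega>) + L * \<eta> / 2 * expectation R) / r"
      unfolding W_def using Ri \<Gamma>Ri by (simp add: prob_space)
    also have "\<dots> \<le> c + (P * ((1 + sqrt 2) * a) + L * \<eta> / 2 * a) / r"
      using r \<Gamma>RE RE L_nonneg \<eta> by (intro add_left_mono divide_right_mono add_mono mult_left_mono) auto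
    finally show ?thesis .
  qed
  define S where "S q \<omega> = (\<Sum>j<k. drift_sum \<eta> q j \<omega> - 2 * boundary_sum \<eta> q j \<omega>)" for q \<omega>
  define e where "e q = real k * (L * sqrt n * (2 / 3 * (sqrt (\<eta> + \<eta> * (1 / real (Suc q)))) ^ 3))" for q :: nat
  define \<rho> where "\<rho> = expectation (\<lambda>\<omega>. (R \<omega> / (2 * r))\<^sup>2) * n * \<eta>"
  define C where "C = real k * (real k * (2 * (4 * L\<^sup>2 * n * \<eta> ^ 3) + 8 * \<rho>))"
  note ds = drift_sum[OF \<eta>] and bs = boundary_sum[OF \<eta> _ R R2 Rd[unfolded T_def]]
  have dm [measurable]: "drift_sum \<eta> q j \<in> borel_measurable M" for q j by (rule ds)
  have ym: "(\<lambda>\<omega>. drift_sum \<eta> q j \<omega> - 2 * boundary_sum \<eta> q j \<omega>) \<in> borel_measurable M" if "j < k" for q j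
    using bs(1)[OF that] by measurable
  have di: "integrable M (drift_sum \<eta> q j)" for q j by (rule square_integrable_imp_integrable[OF ds(1,2)])
  have bi: "integrable M (boundary_sum \<eta> q j)" if "j < k" for q j by (rule square_integrable_imp_integrable[OF bs(1,2)[OF that]])
  have y2: "(drift_sum \<eta> q j \<omega> - 2 * boundary_sum \<eta> q j \<omega>)\<^sup>2 \<le> 2 * (drift_sum \<eta> q j \<omega>)\<^sup>2 + 8 * (boundary_sum \<eta> q j \<omega>)\<^sup>2" for q j \<omega>
  proof -
    have "0 \<le> (x + 2 * y)\<^sup>2 \<Longrightarrow> (x - 2 * y)\<^sup>2 \<le> 2 * x\<^sup>2 + 8 * y\<^sup>2" for x y :: real
      by (simp add: power2_eq_square algebra_simps)
    then show ?thesis by simp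
  qed
  have S2: "(S q \<omega>)\<^sup>2 \<le> real k * (\<Sum>j<k. 2 * (drift_sum \<eta> q j \<omega>)\<^sup>2 + 8 * (boundary_sum \<eta> q j \<omega>)\<^sup>2)" for q \<omega>
  proof -
    have "(S q \<omega>)\<^sup>2 \<le> (\<Sum>j<k. (drift_sum \<eta> q j \<omega> - 2 * boundary_sum \<eta> q j \<omega>)\<^sup>2) * real k"
      unfolding S_def using sum_squared_le_sum_of_squares[of _ "{..<k}"] by (simp only: card_lessThan)
    also have "\<dots> \<le> (\<Sum>j<k. 2 * (drift_sum \<eta> q j \<omega>)\<^sup>2 + 8 * (boundary_sum \<eta> q j \<omega>)\<^sup>2) * real k"
      by (intro mult_right_mono sum_mono y2) simp
    finally show ?thesis by (simp only: mult.commute)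
  qed
  have S2b: "integrable M (\<lambda>\<omega>. real k * (\<Sum>j<k. 2 * (drift_sum \<eta> q j \<omega>)\<^sup>2 + 8 * (boundary_sum \<eta> q j \<omega>)\<^sup>2))" for q
    using ds(2) bs(2) by (intro integrable_mult_right Bochner_Integration.integrable_sum Bochner_Integration.integrable_add) auto
  have Sm: "S q \<in> borel_measurable M" for q unfolding S_def[abs_def] using ym by (intro borel_measurable_sum) auto
  have S2i: "integrable M (\<lambda>\<omega>. (S q \<omega>)\<^sup>2)" for q
  proof (rule Bochner_Integration.integrable_bound[OF S2b[of q]])
    show "(\<lambda>\<omega>. (S q \<omega>)\<^sup>2) \<in> borel_measurable M" using Sm[of q] by measurable
    show "AE \<omega> in M. norm ((S q \<omega>)\<^sup>2) \<le> norm (real k * (\<Sum>j<k. 2 * (drift_sum \<eta> q j \<omega>)\<^sup>2 + 8 * (boundary_sum \<eta> q j \<omega>)\<^sup>2))"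
      by (intro AE_I2) (simp, rule order.trans[OF S2 abs_ge_self])
  qed
  have "(\<integral>\<^sup>+\<omega>. ennreal ((norm (X T \<omega> - chain \<eta> k \<omega>))\<^sup>2) \<partial>M)
     \<le> ennreal (expectation W + real k * (L * sqrt n * (2 / 3 * (sqrt (\<eta> + \<eta> * 0)) ^ 3)))"
  proof (rule nn_integral_le_of_L2_bounded[of _ W S C e])
    have "X T \<in> borel_measurable M" using X_measurable_F[of T] T by (intro measurable_F) auto
    moreover have "chain \<eta> k \<in> borel_measurable M" by (rule measurable_F[OF chain_measurable_F[OF \<eta>]])
    ultimately show "(\<lambda>\<omega>. (norm (X T \<omega> - chain \<eta> k \<omega>))\<^sup>2) \<in> borel_measurable M" by measurable
    show "S q \<in> borel_measurable M" "integrable M (\<lambda>\<omega>. (S q \<omega>)\<^sup>2)" for q by (rule Sm S2i)+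
    show "expectation (\<lambda>\<omega>. (S q \<omega>)\<^sup>2) \<le> C" for q
    proof -
      have "expectation (\<lambda>\<omega>. (S q \<omega>)\<^sup>2) \<le> expectation (\<lambda>\<omega>. real k * (\<Sum>j<k. 2 * (drift_sum \<eta> q j \<omega>)\<^sup>2 + 8 * (boundary_sum \<eta> q j \<omega>)\<^sup>2))"
        by (intro integral_mono S2i S2b S2)
      also have "\<dots> = real k * (\<Sum>j<k. 2 * expectation (\<lambda>\<omega>. (drift_sum \<eta> q j \<omega>)\<^sup>2) + 8 * expectation (\<lambda>\<omega>. (boundary_sum \<eta> q j \<omega>)\<^sup>2))"
        using ds(2) bs(2) by simp
      also have "\<dots> \<le> real k * (\<Sum>j<k. 2 * (4 * L\<^sup>2 * n * \<eta> ^ 3) + 8 * \<rho>)"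
        using ds(3) bs(4) unfolding \<rho>_def by (intro mult_left_mono sum_mono add_mono) auto
      also have "\<dots> = C" by (simp add: C_def)
      finally show ?thesis .
    qed
    show "expectation (S q) \<le> e q" for q
    proof -
      have "expectation (S q) = (\<Sum>j<k. expectation (drift_sum \<eta> q j) - 2 * expectation (boundary_sum \<eta> q j))"
        unfolding S_def[abs_def] using di bi by simp
      also have "\<dots> \<le> (\<Sum>j<k. L * sqrt n * (2 / 3 * (sqrt (\<eta> + \<eta> * (1 / real (Suc q)))) ^ 3))"
        using ds(4)[of q] bs(3) by (intro sum_mono) auto
      finally show ?thesis by (simp add: e_def)
    qed
    have "(\<lambda>q. 1 / real (Suc q)) \<longlonglongrightarrow> 0" using LIMSEQ_Suc[OF lim_1_over_n] by simp
    then show "e \<longlonglongrightarrow> real k * (L * sqrt n * (2 / 3 * (sqrt (\<eta> + \<eta> * 0)) ^ 3))"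
      unfolding e_def[abs_def] by (intro tendsto_intros)
    show "AE \<omega> in M. \<forall>\<epsilon>>0. \<forall>\<^sub>F q in sequentially. (norm (X T \<omega> - chain \<eta> k \<omega>))\<^sup>2 \<le> W \<omega> + S q \<omega> + \<epsilon>"
      using AE_local_time Rd
    proof (eventually_elim, intro allI impI)
      fix \<omega> and \<epsilon> :: real assume ex: "\<exists>\<Lambda>. local_time \<omega> \<Lambda>" and d: "\<forall>\<Lambda>. local_time \<omega> \<Lambda> \<longrightarrow> 2 * r * (\<Lambda> T - \<Lambda> 0) \<le> R \<omega>" and \<epsilon>: "0 < \<epsilon>"
      obtain \<Lambda> where lt: "local_time \<omega> \<Lambda>" using ex ..
      have "\<Lambda> T - \<Lambda> 0 \<le> R \<omega> / (2 * r)" using d lt r by (simp add: field_simps)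
      then have "(2 * \<Gamma> \<omega> + L * \<eta>) * (\<Lambda> T - \<Lambda> 0) \<le> (2 * \<Gamma> \<omega> + L * \<eta>) * (R \<omega> / (2 * r))"
        using \<Gamma>0 L_nonneg \<eta> by (intro mult_left_mono) auto
      also have "\<dots> = (\<Gamma> \<omega> * R \<omega> + L * \<eta> / 2 * R \<omega>) / r" using r by (simp add: field_simps)
      finally have le: "(2 * \<Gamma> \<omega> + L * \<eta>) * (\<Lambda> T - \<Lambda> 0) \<le> (\<Gamma> \<omega> * R \<omega> + L * \<eta> / 2 * R \<omega>) / r" .
      have "\<forall>\<^sub>F q in sequentially. (norm (X T \<omega> - chain \<eta> k \<omega>))\<^sup>2
         \<le> (c + (2 * \<Gamma> \<omega> + L * \<eta>) * (\<Lambda> T - \<Lambda> 0)) + S q \<omega> + \<epsilon>"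
        using coupling_path_bound[OF lt \<eta> \<Gamma>b \<epsilon>, of k] unfolding T_def c_def S_def by blast
      then show "\<forall>\<^sub>F q in sequentially. (norm (X T \<omega> - chain \<eta> k \<omega>))\<^sup>2 \<le> W \<omega> + S q \<omega> + \<epsilon>"
      proof eventually_elim
        case (elim q)
        have "x \<le> (c + u) + y + \<epsilon> \<Longrightarrow> u \<le> v \<Longrightarrow> x \<le> (c + v) + y + \<epsilon>" for x u v y :: real by linarith
        from this[OF elim le] show ?case unfolding W_def .
      qed
    qed
  qed (use Wi in auto)
  also have "\<dots> \<le> ennreal (c + (P * ((1 + sqrt 2) * a) + L * \<eta> / 2 * a) / r + real k * (L * sqrt n * (2 / 3 * (sqrt (\<eta> + \<eta> * 0)) ^ 3)))"
    using WE by (intro ennreal_leI add_right_mono)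
  finally show ?thesis unfolding T_def c_def P_def by simp
qed

end

section \<open>The law of the algorithm and the Wasserstein bound\<close>

text \<open>The state of the algorithm is a function of the noise sequence: the algorithm run on the space
  of noise sequences, with the coordinates as noise, evaluated at the given sequence.\<close>

lemma langevin_algorithm_eq_of_noise_path:
  "langevin_algorithm K \<phi> \<eta> x0 \<xi> j \<omega> = langevin_algorithm K \<phi> \<eta> x0 (\<lambda>i z. z i) j (\<lambda>i. \<xi> i \<omega>)"
  by (induction j) simp_all

lemma langevin_algorithm_restrict:
  "j \<le> k \<Longrightarrow> langevin_algorithm K \<phi> \<eta> x0 (\<lambda>i z. z i) j (restrict z {1..k}) = langevin_algorithm K \<phi> \<eta> x0 (\<lambda>i z. z i) j z"
  by (induction j) simp_all

lemma langevin_algorithm_measurable_PiM: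
  fixes \<phi> :: "'a::euclidean_space \<Rightarrow> real"
  assumes K: "closed K" "convex K" "K \<noteq> {}" and \<phi>: "convex_on UNIV \<phi>"
  shows "j \<le> k \<Longrightarrow> langevin_algorithm K \<phi> \<eta> x0 (\<lambda>i z. z i) j \<in> borel_measurable (PiM {1..k} (\<lambda>_. borel))"
proof (induction j)
  case 0
  then show ?case by (subst measurable_cong[where g = "\<lambda>_. x0"]) simp_all
next
  case (Suc j)
  let ?P = "PiM {1..k} (\<lambda>_. borel :: 'a measure)" and ?x = "langevin_algorithm K \<phi> \<eta> x0 (\<lambda>i z. z i)"
  have [measurable]: "?x j \<in> borel_measurable ?P" using Suc by simp
  have [measurable]: "(\<lambda>z. z (Suc j)) \<in> borel_measurable ?P"
    using Suc.prems by (intro measurable_component_singleton) auto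
  have [measurable]: "(\<lambda>z. min_subgradient \<phi> (?x j z)) \<in> borel_measurable ?P"
    by (rule measurable_compose[OF _ borel_measurable_min_subgradient[OF \<phi>]]) measurable
  have "(\<lambda>z. ?x j z + z (Suc j) - (\<eta> / 2) *\<^sub>R min_subgradient \<phi> (?x j z)) \<in> borel_measurable ?P" by measurable
  from measurable_compose[OF this borel_measurable_closest_point[OF K]]
  have "(\<lambda>z. closest_point K (?x j z + z (Suc j) - (\<eta> / 2) *\<^sub>R min_subgradient \<phi> (?x j z))) \<in> borel_measurable ?P" .
  then show ?case by (subst measurable_cong) simp_all
qed

lemma distr_langevin_algorithm:
  fixes \<phi> :: "'a::euclidean_space \<Rightarrow> real"
  assumes K: "closed K" "convex K" "K \<noteq> {}" and \<phi>: "convex_on UNIV \<phi>"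
    and N: "prob_space N" "prob_space.indep_vars N (\<lambda>_. borel) \<xi> {1..k}" "\<And>j. j \<in> {1..k} \<Longrightarrow> \<xi> j \<in> borel_measurable N"
    and k: "1 \<le> k"
  shows "distr N borel (langevin_algorithm K \<phi> \<eta> x0 \<xi> k) =
    distr (PiM {1..k} (\<lambda>i. distr N borel (\<xi> i))) borel (langevin_algorithm K \<phi> \<eta> x0 (\<lambda>i z. z i) k)"
proof -
  let ?x = "langevin_algorithm K \<phi> \<eta> x0 (\<lambda>i z. z i) k" and ?P = "PiM {1..k} (\<lambda>_. borel :: 'a measure)"
  let ?r = "\<lambda>\<omega>. \<lambda>i\<in>{1..k}. \<xi> i \<omega>"
  have xm: "?x \<in> borel_measurable ?P" by (rule langevin_algorithm_measurable_PiM[OF K \<phi> order.refl])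
  have rm: "?r \<in> measurable N ?P" by (intro measurable_restrict N(3)) auto
  have "langevin_algorithm K \<phi> \<eta> x0 \<xi> k = ?x \<circ> ?r"
    by (rule ext) (simp only: comp_def langevin_algorithm_restrict[OF order.refl] langevin_algorithm_eq_of_noise_path[of K \<phi> \<eta> x0 \<xi>])
  then have "distr N borel (langevin_algorithm K \<phi> \<eta> x0 \<xi> k) = distr (distr N ?P ?r) borel ?x"
    by (simp only: distr_distr[OF xm rm])
  also have "distr N ?P ?r = PiM {1..k} (\<lambda>i. distr N borel (\<xi> i))"
    using prob_space.indep_vars_iff_distr_eq_PiM'[OF N(1), where I = "{1..k}" and M' = "\<lambda>_. borel" and X = \<xi>] N k by simp
  finally show ?thesis .
qed

lemma distr_centered_gaussian:
  assumes "centered_gaussian N v Z"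
  shows "Z \<in> borel_measurable N" "distr N borel Z = density lborel (\<lambda>z. ennreal (isotropic_gaussian_density v z))"
proof -
  have D: "distributed N lborel Z (\<lambda>z. ennreal (isotropic_gaussian_density v z))" using assms by (simp add: centered_gaussian_def)
  then show "Z \<in> borel_measurable N" by (auto simp: distributed_def)
  have "distr N borel Z = distr N lborel Z" by (rule distr_cong) auto
  then show "distr N borel Z = density lborel (\<lambda>z. ennreal (isotropic_gaussian_density v z))"
    using D by (auto simp: distributed_def)
qed

context langevin
begin

text \<open>The independence of increments is used for the times \<open>0, 0, \<eta>, 2 \<eta>,
  \<dots>\<close>; the repeated 0 shifts the indices so that the noise starts at 1.\<close>

lemma noise_indep:
  assumes \<eta>: "0 < \<eta>" shows "indep_vars (\<lambda>_. borel) (noise \<eta>) {1..k}"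
proof -
  define t where "t i = real (i - 1) * \<eta>" for i :: nat
  have t: "0 \<le> t 0" "mono t" using \<eta> by (auto simp: t_def mono_def intro!: mult_right_mono)
  have "indep_vars (\<lambda>_. borel) (\<lambda>i \<omega>. incr (t i) (t (Suc i)) \<omega>) {..<Suc k}"
    by (rule independent_increments[OF t])
  then have "indep_vars (\<lambda>_. borel) (\<lambda>i \<omega>. incr (t i) (t (Suc i)) \<omega>) {1..k}"
    by (rule indep_vars_subset) auto
  moreover have "(\<lambda>\<omega>. incr (t i) (t (Suc i)) \<omega>) = noise \<eta> i" if "i \<in> {1..k}" for i
    using that by (auto simp: t_def noise_def fun_eq_iff of_nat_diff)
  ultimately show ?thesis by (subst (asm) indep_vars_cong[OF refl _ refl]) auto
qed

lemma distr_chain: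
  assumes \<eta>: "0 < \<eta>" and k: "1 \<le> k"
    and N: "prob_space N" "prob_space.indep_vars N (\<lambda>_. borel) \<xi> {1..}" "\<And>j. 1 \<le> j \<Longrightarrow> centered_gaussian N \<eta> (\<xi> j)"
  shows "distr N borel (langevin_algorithm K \<phi> \<eta> x0 \<xi> k) = distr M borel (chain \<eta> k)"
proof -
  have ng: "centered_gaussian M \<eta> (noise \<eta> j)" if "j \<in> {1..k}" for j
    using noise_gaussian[OF \<eta>, of "j - 1"] that by simp
  have Ni: "prob_space.indep_vars N (\<lambda>_. borel) \<xi> {1..k}"
    by (rule prob_space.indep_vars_subset[OF N(1,2)]) auto
  have "distr N borel (langevin_algorithm K \<phi> \<eta> x0 \<xi> k) =
    distr (PiM {1..k} (\<lambda>i. distr N borel (\<xi> i))) borel (langevin_algorithm K \<phi> \<eta> x0 (\<lambda>i z. z i) k)"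
    using distr_centered_gaussian(1)[OF N(3)] by (intro distr_langevin_algorithm K(1,2) K_nonempty convex_\<phi> N(1) Ni k) auto
  also have "PiM {1..k} (\<lambda>i. distr N borel (\<xi> i)) = PiM {1..k} (\<lambda>i. distr M borel (noise \<eta> i))"
    by (intro PiM_cong refl) (simp add: distr_centered_gaussian(2)[OF N(3)] distr_centered_gaussian(2)[OF ng])
  also have "distr (PiM {1..k} (\<lambda>i. distr M borel (noise \<eta> i))) borel (langevin_algorithm K \<phi> \<eta> x0 (\<lambda>i z. z i) k)
     = distr M borel (langevin_algorithm K \<phi> \<eta> x0 (noise \<eta>) k)"
    using distr_centered_gaussian(1)[OF ng]
    by (intro distr_langevin_algorithm[symmetric] K(1,2) K_nonempty convex_\<phi> prob_space_axioms noise_indep[OF \<eta>] k)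
  finally show ?thesis unfolding chain_def[abs_def] .
qed

lemma wasserstein_le_coupling:
  assumes \<eta>: "0 < \<eta>" and T: "0 \<le> T"
  shows "wasserstein2_sq (distr M borel (X T)) (distr M borel (chain \<eta> k))
    \<le> (\<integral>\<^sup>+\<omega>. ennreal ((norm (X T \<omega> - chain \<eta> k \<omega>))\<^sup>2) \<partial>M)"
proof -
  have Xm [measurable]: "X T \<in> borel_measurable M" by (rule measurable_F[OF X_measurable_F[OF T]])
  have cm [measurable]: "chain \<eta> k \<in> borel_measurable M" by (rule measurable_F[OF chain_measurable_F[OF \<eta>]])
  let ?f = "\<lambda>\<omega>. (X T \<omega>, chain \<eta> k \<omega>)"
  define \<pi> where "\<pi> = distr M (borel \<Otimes>\<^sub>M borel) ?f"
  have fm: "?f \<in> measurable M (borel \<Otimes>\<^sub>M borel)" by measurable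
  have "prob_space \<pi>" unfolding \<pi>_def by (rule prob_space_distr[OF fm])
  moreover have "distr \<pi> borel fst = distr M borel (X T)" "distr \<pi> borel snd = distr M borel (chain \<eta> k)"
    unfolding \<pi>_def by (simp_all add: distr_distr[OF measurable_fst fm] distr_distr[OF measurable_snd fm] comp_def)
  ultimately have "\<pi> \<in> couplings (distr M borel (X T)) (distr M borel (chain \<eta> k))"
    unfolding couplings_def by (simp add: \<pi>_def)
  then have "wasserstein2_sq (distr M borel (X T)) (distr M borel (chain \<eta> k)) \<le> (\<integral>\<^sup>+z. ennreal ((norm (fst z - snd z))\<^sup>2) \<partial>\<pi>)"
    unfolding wasserstein2_sq_def by (rule INF_lower)
  also have "\<dots> = (\<integral>\<^sup>+\<omega>. ennreal ((norm (X T \<omega> - chain \<eta> k \<omega>))\<^sup>2) \<partial>M)"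
    unfolding \<pi>_def by (subst nn_integral_distr[OF fm]) auto
  finally show ?thesis .
qed

text \<open>Arithmetic. The condition on the step size is \<open>L sqrt \<eta> \<le> sqrt n\<close>, which
  reduces every term to order \<open>\<eta> powr (3/2)\<close>. The coefficients of the two
  parts are \<open>1/2 + 2/3 = 7/6\<close> and \<open>2 + sqrt 2 + 1/2 \<le> 2 exp (1/2) +
  1\<close>.\<close>

lemma wasserstein_bound_ball:
  assumes \<eta>: "0 < \<eta>" "L\<^sup>2 * \<eta> \<le> n" and k: "1 \<le> k" and \<sigma>0: "\<sigma> = n * \<sigma>0"
    and N: "prob_space N" "prob_space.indep_vars N (\<lambda>_. borel) \<xi> {1..}" "\<And>j. 1 \<le> j \<Longrightarrow> centered_gaussian N \<eta> (\<xi> j)"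
  shows "ennreal (1 / n) * wasserstein2_sq (distr M borel (X (real k * \<eta>))) (distr N borel (langevin_algorithm K \<phi> \<eta> x0 \<xi> k))
    \<le> ennreal (((2 * exp (1/2) + 1) * (1 + \<sigma>0) * sqrt (n + 2 * ln (real k)) / r + 7 / 6 * (L / sqrt n)) * (real k * \<eta> powr (3/2)))"
proof -
  define s where "s = sqrt \<eta>"
  define d where "d = sqrt n"
  define l where "l = sqrt (n + 2 * ln (real k))"
  have s: "0 < s" "\<eta> = s\<^sup>2" using \<eta> by (auto simp: s_def)
  have d: "0 < d" "n = d\<^sup>2" using n_pos by (auto simp: d_def)
  have l: "d \<le> l" using k by (simp add: l_def d_def)
  have \<sigma>0_nonneg: "0 \<le> \<sigma>0" using \<sigma>_nonneg n_pos unfolding \<sigma>0 by (simp add: zero_le_mult_iff)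
  have Ls: "L * s \<le> d"
  proof (rule power2_le_imp_le)
    show "(L * s)\<^sup>2 \<le> d\<^sup>2" using \<eta>(2) s(2) d(2) by (simp add: power_mult_distrib)
  qed (use d in simp)
  define q where "q = (1 + \<sigma>0) * real k * s ^ 3"
  have q: "0 \<le> q" using \<sigma>0_nonneg s by (simp add: q_def)
  let ?T = "real k * (L\<^sup>2 * \<eta>\<^sup>2 / 2) + (sqrt (2 * \<eta> * (n + 2 * ln (real k))) * ((1 + sqrt 2) * ((n + \<sigma>) * (real k * \<eta>))) + L * \<eta> * ((n + \<sigma>) * (real k * \<eta>)) / 2) / r
        + real k * (L * sqrt n * (2 / 3 * (sqrt \<eta>) ^ 3))"
  have sq2: "sqrt (2 * \<eta> * (n + 2 * ln (real k))) = sqrt 2 * s * l" by (simp add: real_sqrt_mult s_def l_def)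
  have nS: "(n + \<sigma>) * (real k * \<eta>) = d\<^sup>2 * ((1 + \<sigma>0) * real k * s\<^sup>2)" unfolding \<sigma>0 d(2) s(2) by (simp add: algebra_simps)
  have 1: "L\<^sup>2 * \<eta>\<^sup>2 / 2 / n \<le> L * s ^ 3 / (2 * d)"
  proof -
    have "L\<^sup>2 * \<eta>\<^sup>2 = (L * s) * (L * s ^ 3)" unfolding s(2) by (simp add: power2_eq_square power3_eq_cube)
    also have "\<dots> \<le> d * (L * s ^ 3)" using Ls L_nonneg s by (intro mult_right_mono) auto
    finally have "L\<^sup>2 * \<eta>\<^sup>2 / (2 * d\<^sup>2) \<le> d * (L * s ^ 3) / (2 * d\<^sup>2)" by (intro divide_right_mono) auto
    then show ?thesis using d by (simp add: power2_eq_square)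
  qed
  have 2: "sqrt 2 * s * l * ((1 + sqrt 2) * ((1 + \<sigma>0) * real k * s\<^sup>2)) = (2 + sqrt 2) * (l * q)"
  proof -
    have "sqrt 2 * (1 + sqrt 2) = 2 + sqrt 2" by (simp add: algebra_simps)
    moreover have "sqrt 2 * s * l * ((1 + sqrt 2) * ((1 + \<sigma>0) * real k * s\<^sup>2)) = (sqrt 2 * (1 + sqrt 2)) * (l * q)"
      unfolding q_def by (simp add: power2_eq_square power3_eq_cube)
    ultimately show ?thesis by simp
  qed
  have 3: "L * \<eta> * ((1 + \<sigma>0) * real k * s\<^sup>2) / 2 \<le> 1 / 2 * (l * q)"
  proof -
    have "L * \<eta> * ((1 + \<sigma>0) * real k * s\<^sup>2) = (L * s) * q" unfolding s(2) q_def by (simp add: power2_eq_square power3_eq_cube)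
    also have "\<dots> \<le> l * q" using Ls l q by (intro mult_right_mono) auto
    finally show ?thesis by simp
  qed
  have const: "2 + sqrt 2 + 1 / 2 \<le> 2 * exp (1 / 2) + (1 :: real)"
  proof -
    have "sqrt 2 \<le> 3 / 2" by (rule real_le_lsqrt) (simp_all add: power2_eq_square)
    moreover have "1 + 1 / 2 + (1 / 2)\<^sup>2 / 2 \<le> exp (1 / 2 :: real)" by (rule exp_lower_Taylor_quadratic) simp
    ultimately show ?thesis by (simp add: power2_eq_square)
  qed
  have powr: "\<eta> powr (3 / 2) = s ^ 3"
  proof -
    have "\<eta> powr (3 / 2) = (\<eta> powr (1 / 2)) powr 3" by (simp add: powr_powr)
    also have "\<dots> = s ^ 3" using \<eta>(1) by (simp add: powr_half_sqrt s_def)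
    finally show ?thesis .
  qed
  have "1 / n * ?T = real k * (L\<^sup>2 * \<eta>\<^sup>2 / 2 / n) + (sqrt 2 * s * l * ((1 + sqrt 2) * ((1 + \<sigma>0) * real k * s\<^sup>2)) + L * \<eta> * ((1 + \<sigma>0) * real k * s\<^sup>2) / 2) / r
        + real k * (L * (2 / 3 * s ^ 3) / d)"
  proof -
    have "1 / d\<^sup>2 * (x * a + (u * ((1 + w) * (d\<^sup>2 * v)) + e * (d\<^sup>2 * v) / 2) / r + x * (L * d * c))
       = x * (a / d\<^sup>2) + (u * ((1 + w) * v) + e * v / 2) / r + x * (L * c / d)" for x a u w v e c
      using d(1) r(1) by (simp add: field_simps power2_eq_square)
    then show ?thesis unfolding sq2 nS unfolding s_def[symmetric] d_def[symmetric] unfolding d(2) .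
  qed
  also have "\<dots> \<le> real k * (L * s ^ 3 / (2 * d)) + ((2 + sqrt 2) * (l * q) + 1 / 2 * (l * q)) / r
        + real k * (L * (2 / 3 * s ^ 3) / d)"
    unfolding 2 using r(1)
    by (intro add_mono[OF add_mono[OF mult_left_mono[OF 1] divide_right_mono[OF add_mono[OF order.refl 3]]] order.refl]) auto
  also have "\<dots> = (2 + sqrt 2 + 1 / 2) * (l * q) / r + 7 / 6 * (L / d) * (real k * s ^ 3)"
    using d(1) r(1) by (simp add: field_simps)
  also have "\<dots> \<le> (2 * exp (1 / 2) + 1) * (l * q) / r + 7 / 6 * (L / d) * (real k * s ^ 3)"
    using const q l d r by (intro add_right_mono divide_right_mono mult_right_mono mult_nonneg_nonneg) auto
  also have "\<dots> = ((2 * exp (1/2) + 1) * (1 + \<sigma>0) * sqrt (n + 2 * ln (real k)) / r + 7 / 6 * (L / sqrt n)) * (real k * \<eta> powr (3/2))"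
    unfolding powr l_def[symmetric] d_def[symmetric] q_def by (simp add: algebra_simps)
  finally have arith: "1 / n * ?T \<le> ((2 * exp (1/2) + 1) * (1 + \<sigma>0) * sqrt (n + 2 * ln (real k)) / r + 7 / 6 * (L / sqrt n)) * (real k * \<eta> powr (3/2))" .
  have "wasserstein2_sq (distr M borel (X (real k * \<eta>))) (distr N borel (langevin_algorithm K \<phi> \<eta> x0 \<xi> k)) \<le> ennreal ?T"
  proof (subst distr_chain[OF \<eta>(1) k N])
    show "wasserstein2_sq (distr M borel (X (real k * \<eta>))) (distr M borel (chain \<eta> k)) \<le> ennreal ?T"
      by (rule order.trans[OF wasserstein_le_coupling coupling_bound[OF \<eta>(1) k]]) (use \<eta> in auto)
  qed assumption
  then have "ennreal (1 / n) * wasserstein2_sq (distr M borel (X (real k * \<eta>))) (distr N borel (langevin_algorithm K \<phi> \<eta> x0 \<xi> k)) \<le> ennreal (1 / n) * ennreal ?T"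
    by (intro mult_left_mono) auto
  also have "\<dots> = ennreal (1 / n * ?T)" using n_pos by (intro ennreal_mult'[symmetric]) simp
  also have "\<dots> \<le> ennreal (((2 * exp (1/2) + 1) * (1 + \<sigma>0) * sqrt (n + 2 * ln (real k)) / r + 7 / 6 * (L / sqrt n)) * (real k * \<eta> powr (3/2)))"
    by (rule ennreal_leI[OF arith])
  finally show ?thesis .
qed

end

text \<open>An open ball that meets \<open>K\<close> but not its boundary lies in \<open>K\<close>, by
  connectedness.\<close>

lemma cball_infdist_frontier_subset:
  fixes K :: "'a::euclidean_space set"
  assumes K: "closed K" and x: "x \<in> K" and pos: "0 < infdist x (frontier K)"
  shows "cball x (infdist x (frontier K)) \<subseteq> K"
proof -
  let ?r = "infdist x (frontier K)"
  have "ball x ?r \<subseteq> K"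
  proof (rule ccontr)
    assume "\<not> ?thesis"
    then have "ball x ?r - K \<noteq> {}" by blast
    moreover have "ball x ?r \<inter> K \<noteq> {}" using x pos centre_in_ball[of x ?r] by blast
    ultimately have "ball x ?r \<inter> frontier K \<noteq> {}" by (intro connected_Int_frontier) auto
    then obtain z where z: "z \<in> frontier K" "dist x z < ?r" by auto
    then show False using infdist_le[OF z(1), of x] by simp
  qed
  then have "closure (ball x ?r) \<subseteq> K" using K by (rule closure_minimal)
  then show ?thesis using pos by simp
qed

theorem theorem1:
  fixes K :: "(real ^ 'n) set"
    and \<phi> :: "real ^ 'n \<Rightarrow> real"
    and \<mu> :: "(real ^ 'n) measure"
    and x0 :: "real ^ 'n"
    and L \<eta> n \<sigma>0 :: real
    and r0 A :: ennreal
    and M :: "'w measure"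
    and B X \<Phi> :: "real \<Rightarrow> 'w \<Rightarrow> real ^ 'n"
    and N :: "'v measure"
    and \<xi> :: "nat \<Rightarrow> 'v \<Rightarrow> real ^ 'n"
    and k :: nat
  assumes n: "n = real CARD('n)"
    and K: "closed K" "convex K" "interior K \<noteq> {}"
    and \<phi>: "convex_on UNIV \<phi>"
    and \<mu>: "\<mu> = density lborel (\<lambda>x. indicator K x * ennreal (exp (- \<phi> x)))" "prob_space \<mu>"
    and lipschitz: "L-lipschitz_on K \<phi>"
    and x0: "x0 \<in> K"
    and r0: "r0 = (if K = UNIV then \<infinity> else ennreal (infdist x0 (frontier K)))"
    and \<sigma>0: "\<sigma>0 = (1 / n) * (\<phi> x0 - (INF y\<in>K. \<phi> y))"
    and \<eta>: "0 < \<eta>" "L \<noteq> 0 \<longrightarrow> \<eta> < n / L\<^sup>2"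
    and diffusion: "langevin_diffusion M B K \<phi> x0 X \<Phi>"
    and noise: "prob_space N" "prob_space.indep_vars N (\<lambda>_. borel) \<xi> {1..}"
      "\<And>j. 1 \<le> j \<Longrightarrow> centered_gaussian N \<eta> (\<xi> j)"
    and A: "A = ennreal ((2 * exp (1/2) + 1) * (1 + \<sigma>0) * sqrt (n + 2 * ln (real k))) / r0
              + ennreal (7 / 6 * (L / sqrt n))"
    and k: "1 \<le> k"
  shows "ennreal (1 / n) *
           wasserstein2_sq (distr M borel (X (real k * \<eta>)))
             (distr N borel (langevin_algorithm K \<phi> \<eta> x0 \<xi> k))
         \<le> A * ennreal (real k * \<eta> powr (3/2))"
proof -
  define c where "c = (2 * exp (1/2) + 1) * (1 + \<sigma>0) * sqrt (n + 2 * ln (real k))"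
  define d where "d = 7 / 6 * (L / sqrt n)"
  define p where "p = real k * \<eta> powr (3/2)"
  define \<sigma> where "\<sigma> = \<phi> x0 - (INF y\<in>K. \<phi> y)"
  let ?lhs = "ennreal (1 / n) * wasserstein2_sq (distr M borel (X (real k * \<eta>))) (distr N borel (langevin_algorithm K \<phi> \<eta> x0 \<xi> k))"
  have n1: "1 \<le> n" unfolding n by (simp add: Suc_leI)
  have L0: "0 \<le> L" using lipschitz by (simp add: lipschitz_on_def)
  have L\<eta>: "L\<^sup>2 * \<eta> \<le> n" using \<eta> n1 by (cases "L = 0") (auto simp: field_simps)
  have "(\<integral>\<^sup>+x. indicator K x * ennreal (exp (- \<phi> x)) \<partial>lborel) = 1"
  proof -
    have [measurable]: "\<phi> \<in> borel_measurable borel"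
      by (intro borel_measurable_continuous_onI continuous_on_convex_UNIV \<phi>)
    have [measurable]: "K \<in> sets borel" using K(1) by simp
    have "1 = emeasure \<mu> (space \<mu>)" using prob_space.emeasure_space_1[OF \<mu>(2)] by simp
    also have "\<dots> = (\<integral>\<^sup>+x. indicator K x * ennreal (exp (- \<phi> x)) \<partial>lborel)"
      unfolding \<mu>(1) by (subst emeasure_density) auto
    finally show ?thesis by simp
  qed
  then have bdd: "bdd_below (\<phi> ` K)" by (rule convex_potential_bdd_below[OF \<phi> K lipschitz])
  have inf: "\<phi> x0 - \<sigma> \<le> \<phi> y" if "y \<in> K" for y using cINF_lower[OF bdd that] by (simp add: \<sigma>_def)
  have \<sigma>_eq: "\<sigma> = n * \<sigma>0" using n1 by (simp add: \<sigma>_def \<sigma>0)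
  have "0 \<le> \<sigma>" using inf[OF x0] by simp
  then have \<sigma>0_nonneg: "0 \<le> \<sigma>0" using n1 unfolding \<sigma>_eq by (simp add: zero_le_mult_iff)
  have c: "0 < c" unfolding c_def using \<sigma>0_nonneg n1 k
    by (intro mult_pos_pos add_pos_nonneg real_sqrt_gt_zero) (auto intro: add_pos_nonneg)
  have d: "0 \<le> d" using L0 n1 by (simp add: d_def)
  have p: "0 < p" using \<eta> k by (simp add: p_def)
  have BM: "standard_brownian_motion M B" using diffusion by (simp add: langevin_diffusion_def)
  \<comment> \<open>This covers both positive finite \<open>r0\<close>, with \<open>r = r0\<close>, and \<open>K = UNIV\<close>, with \<open>r\<close> arbitrarily large.\<close>
  have bound: "?lhs \<le> ennreal ((c / r + d) * p)" if r: "0 < r" "cball x0 r \<subseteq> K" for r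
  proof -
    interpret standard_brownian_motion M B by (rule BM)
    interpret langevin M B K \<phi> x0 X \<Phi> L \<sigma> r n
      by unfold_locales (use n K \<phi> lipschitz x0 diffusion inf r in auto)
    show ?thesis using wasserstein_bound_ball[OF \<eta>(1) L\<eta> k \<sigma>_eq noise] by (simp add: c_def d_def p_def)
  qed
  show ?thesis
  proof (cases "K = UNIV")
    case True
    have lim0: "(\<lambda>i. 1 / real (Suc i)) \<longlonglongrightarrow> 0" using LIMSEQ_Suc[OF lim_1_over_n] by simp
    have "?lhs \<le> ennreal ((c * 0 + d) * p)"
    proof (rule LIMSEQ_le_const)
      show "(\<lambda>i. ennreal ((c * (1 / real (Suc i)) + d) * p)) \<longlonglongrightarrow> ennreal ((c * 0 + d) * p)"
        by (intro tendsto_ennrealI tendsto_intros lim0)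
      have "?lhs \<le> ennreal ((c * (1 / real (Suc i)) + d) * p)" for i
        using bound[of "real (Suc i)"] True by simp
      then show "\<exists>N. \<forall>i\<ge>N. ?lhs \<le> ennreal ((c * (1 / real (Suc i)) + d) * p)" by blast
    qed
    also have "\<dots> = A * ennreal p"
      unfolding A r0 c_def[symmetric] d_def[symmetric] using True d p by (simp add: ennreal_mult)
    finally show ?thesis unfolding p_def .
  next
    case False
    define r where "r = infdist x0 (frontier K)"
    have r0': "r0 = ennreal r" using False by (simp add: r0 r_def)
    show ?thesis
    proof (cases "r = 0")
      case True
      have "A * ennreal p = \<infinity>"
        unfolding A c_def[symmetric] d_def[symmetric] r0' using True c p by (simp add: ennreal_divide_zero ennreal_top_mult)
      then show ?thesis unfolding p_def by simp
    next
      case False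
      then have r: "0 < r" using infdist_nonneg[of x0 "frontier K"] by (simp add: r_def)
      then have "cball x0 r \<subseteq> K" unfolding r_def by (intro cball_infdist_frontier_subset K(1) x0)
      then have "?lhs \<le> ennreal ((c / r + d) * p)" using r by (intro bound)
      also have "\<dots> = A * ennreal p"
        unfolding A c_def[symmetric] d_def[symmetric] r0' using r c d p
        by (simp add: divide_ennreal ennreal_plus[symmetric] ennreal_mult del: ennreal_plus)
      finally show ?thesis unfolding p_def .
    qed
  qed
qed

end
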